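(* Assume that the residue field $\mathcal{O}_{|\cdot|}/\mathfrak{m}$ embeds into $K$. Let $\mathcal{G}\leq\operatorname{GL}_n$ be a connected linear algebraic group defined over $\mathbb{F}_q$. Let further $D=\sum_{l=0}^{\infty}D_lt^l\in\mathcal{G}(\mathcal{O}_{|\cdot|}[[t]])$ be such that $\|D_l\|<1$ for all $l>0$. Assume that there exists a matrix $Y\in\operatorname{GL}_n(\mathcal{O}_{|\cdot|}[[t]])\cap\operatorname{M}_n(\mathcal{O}_{|\cdot|}\{t\})$ satisfying $D\phi_q(Y)=Y$. Then there exists a $Y'\in\mathcal{G}(L\cap\mathcal{O}_{|\cdot|}[[t]])$ with $D\phi_q(Y')=Y'$.
   Context: $q$ is a power of a prime. $k$ is a field containing $\mathbb{F}_q$ with a fixed non-trivial non-archimedean absolute value $|\cdot|$. $K$ is the completion of an algebraic closure of the completion of $k$ with respect to $|\cdot|$ (so $K$ is complete and algebraically closed). $\mathcal{O}_{|\cdot|}=\{x\in K: |x|\le 1\}$ is its valuation ring with maximal ideal $\mathfrak{m}$. $K\{t\}=\{\sum_{i\ge0}\alpha_it^i\in K[[t]] : |\alpha_i|\to0\}$, $\mathcal{O}_{|\cdot|}\{t\}$ is the subring of those series in $K\{t\}$ with coefficients in $\mathcal{O}_{|\cdot|}$, and $L=\operatorname{Quot}(K\{t\})\subseteq K((t))$. The endomorphism $\phi_q$ of $K((t))$ raises the coefficients of a Laurent series to the $q$-th power and fixes $t$; it is applied entrywise to matrices. $\operatorname{M}_n$ denotes $n\times n$-matrices, the $D_l$ are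 matrices with entries in $\mathcal{O}_{|\cdot|}$, and $\|\cdot\|$ is the maximum norm of the entries. *)

theory Defs
  imports
    "HOL-Analysis.Analysis"
    "HOL-Library.Poly_Mapping"
    "HOL-Computational_Algebra.Formal_Laurent_Series"
    "HOL-Number_Theory.Prime_Powers"
    "HOL-Algebra.Algebraic_Closure_Type"
begin

section \<open>Non-archimedean absolute values\<close>

definition nonarch_abs :: "('a::field \<Rightarrow> real) \<Rightarrow> bool" where
  "nonarch_abs v \<longleftrightarrow>
     (\<forall>x. 0 \<le> v x) \<and> (\<forall>x. v x = 0 \<longleftrightarrow> x = 0) \<and>
     (\<forall>x y. v (x * y) = v x * v y) \<and>
     (\<forall>x y. v (x + y) \<le> max (v x) (v y))"

definition nontrivial_on :: "('a::field \<Rightarrow> real) \<Rightarrow> 'a set \<Rightarrow> bool" where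
  "nontrivial_on v k \<longleftrightarrow> (\<exists>x\<in>k. x \<noteq> 0 \<and> v x \<noteq> 1)"

definition abs_dist :: "('a::field \<Rightarrow> real) \<Rightarrow> 'a \<Rightarrow> 'a \<Rightarrow> real" where
  "abs_dist v x y = v (x - y)"

lemma nonarch_abs_minus_one:
  assumes "nonarch_abs v"
  shows "v (- 1) = 1"
proof -
  have n: "0 \<le> v x" and m: "v (x * y) = v x * v y" and z: "v x = 0 \<longleftrightarrow> x = 0" for x y
    using assms unfolding nonarch_abs_def by blast+
  have "v 1 * v 1 = v 1" using m[of 1 1] by simp
  then have one: "v 1 = 1" using z[of 1] by simp
  have "v (- 1) * v (- 1) = 1" using m[of "- 1" "- 1"] one by simp
  then have "(v (- 1))\<^sup>2 = 1\<^sup>2" by (simp add: power2_eq_square)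
  then show ?thesis by (rule power2_eq_imp_eq) (simp_all add: n)
qed

lemma Metric_space_abs_dist:
  assumes "nonarch_abs v"
  shows "Metric_space UNIV (abs_dist v)"
proof
  have n: "0 \<le> v x" and m: "v (x * y) = v x * v y" and z: "v x = 0 \<longleftrightarrow> x = 0"
    and u: "v (x + y) \<le> max (v x) (v y)" for x y
    using assms unfolding nonarch_abs_def by blast+
  fix x y w :: 'a
  show "0 \<le> abs_dist v x y" by (simp add: abs_dist_def n)
  show "abs_dist v x y = abs_dist v y x"
    using m[of "- 1" "x - y"] nonarch_abs_minus_one[OF assms] by (simp add: abs_dist_def)
  show "abs_dist v x y = 0 \<longleftrightarrow> x = y" by (simp add: abs_dist_def z)
  show "abs_dist v x w \<le> abs_dist v x y + abs_dist v y w"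
    using u[of "x - y" "y - w"] n[of "x - y"] n[of "y - w"] by (auto simp: abs_dist_def)
qed

definition abs_closure :: "('a::field \<Rightarrow> real) \<Rightarrow> 'a set \<Rightarrow> 'a set" where
  "abs_closure v S = Metric_space.mtopology UNIV (abs_dist v) closure_of S"

definition algebraic_elements :: "'a::field set \<Rightarrow> 'a set" where
  "algebraic_elements S =
     {x. \<exists>p::'a poly. p \<noteq> 0 \<and> (\<forall>i. Polynomial.coeff p i \<in> S) \<and> poly p x = 0}"

text \<open>
  The ambient field \<open>K\<close> (the type) is the completion of an algebraic closure of the completion
  of its subfield \<open>k\<close>. All three extensions are taken inside \<open>K\<close>: \<open>K\<close> being complete, the
  topological closure of \<open>k\<close> is the completion of \<open>k\<close>; \<open>K\<close> being algebraically closed, the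
  elements algebraic over that closure form an algebraic closure of it; and \<open>K\<close> is the
  completion of the latter iff it is complete and the latter is dense in it.
\<close>
definition completed_algebraic_closure_of ::
    "('a::alg_closed_field \<Rightarrow> real) \<Rightarrow> 'a set \<Rightarrow> bool" where
  "completed_algebraic_closure_of v k \<longleftrightarrow>
     Metric_space.mcomplete UNIV (abs_dist v) \<and>
     abs_closure v (algebraic_elements (abs_closure v k)) = UNIV"

definition valuation_ring :: "('a::field \<Rightarrow> real) \<Rightarrow> 'a set" where
  "valuation_ring v = {x. v x \<le> 1}"

definition maximal_ideal :: "('a::field \<Rightarrow> real) \<Rightarrow> 'a set" where
  "maximal_ideal v = {x. v x < 1}"

definition residue_field :: "('a::field \<Rightarrow> real) \<Rightarrow> 'a set ring" where
  "residue_field v =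
     ring_of_type_algebra\<lparr>carrier := valuation_ring v\<rparr> Quot maximal_ideal v"

definition residue_field_embeds :: "('a::field \<Rightarrow> real) \<Rightarrow> bool" where
  "residue_field_embeds v \<longleftrightarrow>
     (\<exists>h \<in> ring_hom (residue_field v) (ring_of_type_algebra :: 'a ring).
        inj_on h (carrier (residue_field v)))"


section \<open>Subrings of \<open>K((t))\<close> and the Frobenius endomorphism\<close>

text \<open>\<open>\<O>[[t]]\<close>, \<open>K{t}\<close>, \<open>\<O>{t}\<close> and \<open>L = Quot(K{t})\<close>, all as subsets of \<open>K((t))\<close>.\<close>

definition integral_series :: "('a::field \<Rightarrow> real) \<Rightarrow> 'a fls set" where
  "integral_series v = {fps_to_fls f | f. \<forall>i. fps_nth f i \<in> valuation_ring v}"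

definition restricted_series :: "('a::field \<Rightarrow> real) \<Rightarrow> 'a fls set" where
  "restricted_series v = {fps_to_fls f | f. (\<lambda>i. v (fps_nth f i)) \<longlonglongrightarrow> 0}"

definition integral_restricted_series :: "('a::field \<Rightarrow> real) \<Rightarrow> 'a fls set" where
  "integral_restricted_series v =
     {fps_to_fls f | f. (\<lambda>i. v (fps_nth f i)) \<longlonglongrightarrow> 0 \<and>
                        (\<forall>i. fps_nth f i \<in> valuation_ring v)}"

definition quot_restricted_series :: "('a::field \<Rightarrow> real) \<Rightarrow> 'a fls set" where
  "quot_restricted_series v =
     {f / g | f g. f \<in> restricted_series v \<and> g \<in> restricted_series v \<and> g \<noteq> 0}"

definition frob :: "nat \<Rightarrow> 'a::field fls \<Rightarrow> 'a fls" where
  "frob q f = Abs_fls (\<lambda>i. fls_nth f i ^ q)"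

lemma fls_nth_frob:
  assumes "q > 0"
  shows "fls_nth (frob q f) i = fls_nth f i ^ q"
  unfolding frob_def
  by (rule nth_Abs_fls_lower_bound[where N = "fls_subdegree f"]) (use assms in simp)


section \<open>Matrices\<close>

definition mat_over :: "'b set \<Rightarrow> ('b^'n^'n) set" where
  "mat_over R = {A. \<forall>i j. A $ i $ j \<in> R}"

text \<open>\<open>GL\<^sub>n(R)\<close> for a subring \<open>R\<close> of an ambient ring.\<close>
definition GL_over :: "'b::comm_ring_1 set \<Rightarrow> ('b^'n^'n) set" where
  "GL_over R = {A \<in> mat_over R. \<exists>B \<in> mat_over R. A ** B = mat 1 \<and> B ** A = mat 1}"

definition frob_mat :: "nat \<Rightarrow> 'a::field fls^'n^'n \<Rightarrow> 'a fls^'n^'n" where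
  "frob_mat q A = (\<chi> i j. frob q (A $ i $ j))"

definition mat_coeff :: "'a::zero fls^'n^'n \<Rightarrow> nat \<Rightarrow> 'a^'n^'n" where
  "mat_coeff A l = (\<chi> i j. fls_nth (A $ i $ j) (int l))"

definition mat_max_norm :: "('a \<Rightarrow> real) \<Rightarrow> 'a^'n::finite^'n \<Rightarrow> real" where
  "mat_max_norm v A = Max {v (A $ i $ j) | i j. True}"

definition GL_group :: "('a::field^'n^'n) monoid" where
  "GL_group = \<lparr>carrier = {A. invertible A}, monoid.mult = (**), one = mat 1\<rparr>"


section \<open>Linear algebraic groups\<close>

text \<open>Polynomials in the \<open>n\<^sup>2\<close> matrix entries; a monomial is a finitely supported exponent map.\<close>
type_synonym ('a, 'n) mat_poly = "('n \<times> 'n \<Rightarrow>\<^sub>0 nat) \<Rightarrow>\<^sub>0 'a"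

definition monom_eval :: "('n::finite \<times> 'n \<Rightarrow>\<^sub>0 nat) \<Rightarrow> 'b::comm_ring_1^'n^'n \<Rightarrow> 'b" where
  "monom_eval m A = (\<Prod>i\<in>UNIV. \<Prod>j\<in>UNIV. A $ i $ j ^ Poly_Mapping.lookup m (i, j))"

text \<open>Evaluation at a matrix over a ring to which the coefficients are mapped by \<open>h\<close>.\<close>
definition mat_poly_eval ::
    "('a::zero \<Rightarrow> 'b::comm_ring_1) \<Rightarrow> ('a, 'n::finite) mat_poly \<Rightarrow> 'b^'n^'n \<Rightarrow> 'b" where
  "mat_poly_eval h f A =
     (\<Sum>m \<in> Poly_Mapping.keys f. h (Poly_Mapping.lookup f m) * monom_eval m A)"

lemma monom_eval_add: "monom_eval (m + m') A = monom_eval m A * monom_eval m' A"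
  by (simp add: monom_eval_def lookup_add power_add prod.distrib)

lemma mat_poly_eval_superset:
  assumes "finite S" "Poly_Mapping.keys f \<subseteq> S" "h 0 = 0"
  shows "mat_poly_eval h f A = (\<Sum>m \<in> S. h (Poly_Mapping.lookup f m) * monom_eval m A)"
  unfolding mat_poly_eval_def
  by (rule sum.mono_neutral_left) (use assms in \<open>auto simp: in_keys_iff\<close>)

lemma mat_poly_eval_0 [simp]: "mat_poly_eval h 0 A = 0"
  by (simp add: mat_poly_eval_def)

lemma mat_poly_eval_single:
  "h 0 = 0 \<Longrightarrow> mat_poly_eval h (Poly_Mapping.single m c) A = h c * monom_eval m A"
  by (subst mat_poly_eval_superset[where S = "{m}"]) auto

lemma mat_poly_eval_1: "h 0 = 0 \<Longrightarrow> h 1 = 1 \<Longrightarrow> mat_poly_eval h 1 A = 1"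
  using mat_poly_eval_single[of h 0 1 A] by (simp add: monom_eval_def)

lemma mat_poly_eval_add:
  assumes "h 0 = 0" "\<And>x y. h (x + y) = h x + h y"
  shows "mat_poly_eval h (f + g) A = mat_poly_eval h f A + mat_poly_eval h g A"
proof -
  let ?S = "Poly_Mapping.keys f \<union> Poly_Mapping.keys g"
  have "mat_poly_eval h (f + g) A =
      (\<Sum>m \<in> ?S. h (Poly_Mapping.lookup (f + g) m) * monom_eval m A)"
    using keys_add[of f g] assms by (intro mat_poly_eval_superset) auto
  also have "\<dots> = (\<Sum>m \<in> ?S. h (Poly_Mapping.lookup f m) * monom_eval m A) +
      (\<Sum>m \<in> ?S. h (Poly_Mapping.lookup g m) * monom_eval m A)"
    by (simp add: lookup_add assms distrib_right sum.distrib)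
  also have "\<dots> = mat_poly_eval h f A + mat_poly_eval h g A"
    using assms by (simp add: mat_poly_eval_superset[where S = ?S])
  finally show ?thesis .
qed

lemma mat_poly_eval_sum:
  assumes "h 0 = 0" "\<And>x y. h (x + y) = h x + h y"
  shows "mat_poly_eval h (\<Sum>i\<in>I. f i) A = (\<Sum>i\<in>I. mat_poly_eval h (f i) A)"
  by (induction I rule: infinite_finite_induct) (simp_all add: mat_poly_eval_add assms)

lemma mat_poly_eq_sum_single:
  "f = (\<Sum>m \<in> Poly_Mapping.keys f. Poly_Mapping.single m (Poly_Mapping.lookup f m))"
proof (rule poly_mapping_eqI)
  fix k
  have "(\<Sum>m \<in> Poly_Mapping.keys f. if m = k then Poly_Mapping.lookup f m else 0) =
      Poly_Mapping.lookup f k"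
    by (simp add: sum.delta in_keys_iff)
  then show "Poly_Mapping.lookup f k = Poly_Mapping.lookup
      (\<Sum>m \<in> Poly_Mapping.keys f. Poly_Mapping.single m (Poly_Mapping.lookup f m)) k"
    by (simp add: lookup_sum lookup_single when_def)
qed

lemma mat_poly_eval_mult:
  fixes f g :: "('a::comm_ring_1, 'n::finite) mat_poly"
  assumes h: "h 0 = 0" "\<And>x y. h (x + y) = h x + h y" "\<And>x y. h (x * y) = h x * h y"
  shows "mat_poly_eval h (f * g) A = mat_poly_eval h f A * mat_poly_eval h g A"
proof -
  have "f * g =
      (\<Sum>m \<in> Poly_Mapping.keys f. Poly_Mapping.single m (Poly_Mapping.lookup f m)) *
      (\<Sum>m \<in> Poly_Mapping.keys g. Poly_Mapping.single m (Poly_Mapping.lookup g m))"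
    by (rule arg_cong2[where f = "(*)"]) (rule mat_poly_eq_sum_single)+
  also have "\<dots> = (\<Sum>m \<in> Poly_Mapping.keys f. \<Sum>m' \<in> Poly_Mapping.keys g.
      Poly_Mapping.single (m + m') (Poly_Mapping.lookup f m * Poly_Mapping.lookup g m'))"
    by (simp add: sum_product mult_single)
  finally have "mat_poly_eval h (f * g) A =
      (\<Sum>m \<in> Poly_Mapping.keys f. \<Sum>m' \<in> Poly_Mapping.keys g.
        (h (Poly_Mapping.lookup f m) * monom_eval m A) *
        (h (Poly_Mapping.lookup g m') * monom_eval m' A))"
    by (simp add: mat_poly_eval_sum h mat_poly_eval_single monom_eval_add mult_ac)
  then show ?thesis
    by (simp add: mat_poly_eval_def sum_product)
qed

text \<open>The Zariski topology on \<open>n \<times> n\<close> matrices over \<open>K\<close>; on \<open>GL\<^sub>n(K)\<close> it induces the Zariski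
  topology of \<open>GL\<^sub>n\<close>, since inverting the determinant gives no further closed subsets.\<close>
definition zariski_topology :: "('a::field^'n::finite^'n) topology" where
  "zariski_topology =
     topology (\<lambda>U. \<exists>S :: ('a, 'n) mat_poly set. U = {A. \<exists>f\<in>S. mat_poly_eval (\<lambda>x. x) f A \<noteq> 0})"

lemma openin_zariski:
  "openin zariski_topology (U :: ('a::field^'n::finite^'n) set) \<longleftrightarrow>
     (\<exists>S :: ('a, 'n) mat_poly set. U = {A. \<exists>f\<in>S. mat_poly_eval (\<lambda>x. x) f A \<noteq> 0})"
proof -
  let ?D = "\<lambda>S :: ('a, 'n) mat_poly set. {A. \<exists>f\<in>S. mat_poly_eval (\<lambda>x. x) f A \<noteq> 0}"
  have "istopology (\<lambda>U. \<exists>S. U = ?D S)"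
    unfolding istopology_def
  proof (intro conjI allI impI)
    fix U V assume "\<exists>S. U = ?D S" "\<exists>S. V = ?D S"
    then obtain S T where "U = ?D S" and "V = ?D T" by blast
    have "?D {f * g | f g. f \<in> S \<and> g \<in> T} =
        {A. \<exists>f\<in>S. \<exists>g\<in>T. mat_poly_eval (\<lambda>x. x) (f * g) A \<noteq> 0}" by blast
    also have "\<dots> = U \<inter> V"
      unfolding \<open>U = ?D S\<close> \<open>V = ?D T\<close> by (simp add: mat_poly_eval_mult) blast
    finally have "U \<inter> V = ?D {f * g | f g. f \<in> S \<and> g \<in> T}" by (rule sym)
    then show "\<exists>S. U \<inter> V = ?D S" by blast
  next
    fix \<U> assume "\<forall>U\<in>\<U>. \<exists>S. U = ?D S"
    then have "\<exists>S. \<forall>U\<in>\<U>. U = ?D (S U)" by (rule bchoice)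
    then obtain S where S: "\<forall>U\<in>\<U>. U = ?D (S U)" by (rule exE)
    have "\<Union>\<U> = (\<Union>U\<in>\<U>. ?D (S U))"
      by (rule arg_cong[where f = Union]) (use S in \<open>simp cong: image_cong\<close>)
    also have "\<dots> = ?D (\<Union>U\<in>\<U>. S U)" by blast
    finally have "\<Union>\<U> = ?D (\<Union>U\<in>\<U>. S U)" .
    then show "\<exists>S. \<Union>\<U> = ?D S" by blast
  qed
  then show ?thesis
    unfolding zariski_topology_def by (simp add: topology_inverse')
qed

lemma topspace_zariski [simp]: "topspace zariski_topology = (UNIV :: ('a::field^'n::finite^'n) set)"
proof -
  have "openin zariski_topology (UNIV :: ('a^'n^'n) set)"
    unfolding openin_zariski by (rule exI[of _ "{1}"]) (simp add: mat_poly_eval_1)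
  then show ?thesis by (metis openin_subset top.extremum_uniqueI)
qed

definition linear_algebraic_group :: "('a::alg_closed_field^'n::finite^'n) set \<Rightarrow> bool" where
  "linear_algebraic_group G \<longleftrightarrow>
     subgroup G GL_group \<and>
     closedin (subtopology zariski_topology (carrier GL_group)) G"

definition vanishing_ideal :: "('a::field^'n::finite^'n) set \<Rightarrow> ('a, 'n) mat_poly set" where
  "vanishing_ideal G = {f. \<forall>A\<in>G. mat_poly_eval (\<lambda>x. x) f A = 0}"

definition mat_polys_over :: "'a::zero set \<Rightarrow> ('a, 'n) mat_poly set" where
  "mat_polys_over F = {f. \<forall>m. Poly_Mapping.lookup f m \<in> F}"

text \<open>\<open>G\<close> is defined over \<open>F\<close> if its vanishing ideal is generated by polynomials over \<open>F\<close>. For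
  \<open>G \<subseteq> GL\<^sub>n(K)\<close> it makes no difference whether this is required of the vanishing ideal in
  \<open>K[X\<^sub>i\<^sub>j]\<close> (as here) or in \<open>K[X\<^sub>i\<^sub>j, 1/det]\<close>, as \<open>det\<close> has coefficients in the prime field.\<close>
definition defined_over :: "'a::field set \<Rightarrow> ('a^'n::finite^'n) set \<Rightarrow> bool" where
  "defined_over F G \<longleftrightarrow>
     (\<forall>f \<in> vanishing_ideal G. \<exists>T c. finite T \<and> T \<subseteq> vanishing_ideal G \<inter> mat_polys_over F \<and>
        f = (\<Sum>g\<in>T. c g * g))"

text \<open>\<open>\<G>(R)\<close> for a group defined over \<open>F\<close> and a subring \<open>R\<close> of \<open>K((t))\<close> containing the constants
  from \<open>F\<close>: the matrices in \<open>GL\<^sub>n(R)\<close> satisfying the equations over \<open>F\<close> of the group, which is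
  given by its set \<open>G\<close> of \<open>K\<close>-rational points.\<close>
definition group_points ::
    "'a::field set \<Rightarrow> ('a^'n::finite^'n) set \<Rightarrow> 'a fls set \<Rightarrow> ('a fls^'n^'n) set" where
  "group_points F G R =
     {A \<in> GL_over R. \<forall>f \<in> vanishing_ideal G \<inter> mat_polys_over F. mat_poly_eval fls_const f A = 0}"

end

theory Submission
  imports Defs "HOL-Library.Function_Algebras" "HOL-Real_Asymp.Real_Asymp"
begin

text \<open>
  The solutions of \<open>D \<phi>(X) = X\<close> over \<open>K[[t]]\<close> are the matrices \<open>Y C\<close> with \<open>C\<close> over \<open>\<F>\<^sub>q[[t]]\<close>. Lang's
  theorem for the group \<open>G(K[[t]])\<close> of arcs gives such a \<open>C\<close> with \<open>W = Y C \<in> G(K[[t]])\<close>. Modulo the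
  maximal ideal, \<open>D\<close> becomes constant and \<open>Y\<close> becomes polynomial in \<open>t\<close>. Let \<open>z\<close> be the constant term
  of the reduction of \<open>W\<close>, so that \<open>z \<in> G(K)\<close> after embedding the residue field into \<open>K\<close>. Then
  \<open>E = z\<^sup>-\<^sup>1 W\<close> and \<open>B = z\<^sup>-\<^sup>1 Y\<close> (reductions on the right) are fixed by \<open>\<phi>\<close>, hence have coefficients
  in \<open>\<F>\<^sub>q\<close>; moreover \<open>E \<in> G\<close>, \<open>B\<close> is a matrix of polynomials, and \<open>E = B C\<close>. So
  \<open>Y' = Y B\<^sup>-\<^sup>1 = W E\<^sup>-\<^sup>1\<close> is a solution that lies in \<open>G\<close> and has entries in \<open>L\<close>.

  Lang's theorem is proved on jets, with dimension theory replaced by a count. The Lang map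
  \<open>\<Lambda>(g) = g\<^sup>-\<^sup>1 D \<phi>(g)\<close> satisfies \<open>\<phi>(g) = D\<^sup>-\<^sup>1 g \<Lambda>(g)\<close>, so that the \<open>q\<close>-th powers of the coordinates
  of \<open>g\<close> are linear in those of \<open>g\<close>, with coefficients linear in those of \<open>\<Lambda>(g)\<close>. Hence the functions of
  \<open>g\<close> are a finite module over the functions of \<open>\<Lambda>(g)\<close>, and comparing Hilbert functions shows that a
  polynomial vanishing on the image of \<open>\<Lambda>\<close> vanishes on \<open>G\<close>. On the other hand, if no
  \<open>\<F>\<^sub>q\<close>-point satisfied all equations, elimination would produce a polynomial vanishing on the image
  of \<open>\<Lambda>\<close> but not at \<open>1\<close>.
\<close>

section \<open>Polynomial functions\<close>

text \<open>The factor \<open>C\<close> from Lang's theorem is an arbitrary power series over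
  \<open>F\<close>, so \<open>Y C\<close> lies in the group but has no reason to have entries in
  \<open>L\<close>. Reduction repairs this because the coefficients of \<open>Y\<close> tend to 0:
  modulo the maximal ideal only finitely many survive. The inverse of the resulting polynomial
  matrix is merely rational in \<open>t\<close>, hence \<open>L\<close> in the conclusion instead of
  restricted series. The given solution also shapes the proof of Lang's theorem. In the coordinates
  \<open>Yi ** A\<close> the equation "Lang image of \<open>A\<close> equals 1" says that every
  coordinate is fixed by the \<open>q\<close>-th power, so to each finite order the candidates form
  a finite set of \<open>F\<close>-points, and linear algebra on the functions on this set replaces
  a tangent space argument. Only jets that extend to arcs are considered: the equations of
  \<open>G\<close> read modulo a power of \<open>t\<close> might have further solutions, as
  smoothness is not established. The price is a separate proof of irreducibility and a compactness
  argument that assembles an arc from approximate solutions.\<close>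

definition fscale :: "'a::field \<Rightarrow> ('b \<Rightarrow> 'a) \<Rightarrow> 'b \<Rightarrow> 'a" where
  "fscale c f = (\<lambda>x. c * f x)"

interpretation fun_space: vector_space "fscale :: 'a::field \<Rightarrow> ('b \<Rightarrow> 'a) \<Rightarrow> 'b \<Rightarrow> 'a"
  by unfold_locales (auto simp: fscale_def fun_eq_iff algebra_simps)

lemma subspace_funI:
  assumes "(\<lambda>_. 0) \<in> S" "\<And>f g. f \<in> S \<Longrightarrow> g \<in> S \<Longrightarrow> (\<lambda>x. f x + g x) \<in> S"
    "\<And>c f. f \<in> S \<Longrightarrow> (\<lambda>x. c * f x) \<in> S"
  shows "fun_space.subspace S"
  unfolding fun_space.subspace_def fscale_def plus_fun_def zero_fun_def using assms by blast

lemma span_fun_mult: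
  fixes A :: "('b \<Rightarrow> 'a::field) set"
  assumes AB: "\<And>f g. f \<in> A \<Longrightarrow> g \<in> B \<Longrightarrow> (\<lambda>x. f x * g x) \<in> fun_space.span C"
    and "f \<in> fun_space.span A" "g \<in> fun_space.span B"
  shows "(\<lambda>x. f x * g x) \<in> fun_space.span C"
proof -
  have sub: "fun_space.subspace {g. (\<lambda>x. f x * g x) \<in> fun_space.span C}" for f :: "'b \<Rightarrow> 'a"
  proof (rule subspace_funI; clarsimp simp: distrib_left mult.left_commute)
    show "(\<lambda>_. 0) \<in> fun_space.span C" using fun_space.span_zero[of C] by (simp add: zero_fun_def)
  next
    fix g h assume "(\<lambda>x. f x * g x) \<in> fun_space.span C" "(\<lambda>x. f x * h x) \<in> fun_space.span C"
    from fun_space.span_add[OF this]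
    show "(\<lambda>x. f x * g x + f x * h x) \<in> fun_space.span C" by (simp add: plus_fun_def)
  next
    fix c g assume "(\<lambda>x. f x * g x) \<in> fun_space.span C"
    from fun_space.span_scale[OF this, of c]
    show "(\<lambda>x. c * (f x * g x)) \<in> fun_space.span C" by (simp add: fscale_def)
  qed
  have 1: "(\<lambda>x. f x * g x) \<in> fun_space.span C" if "f \<in> A" "g \<in> fun_space.span B" for f g
    using fun_space.span_minimal[OF _ sub[of f], of B] AB that by blast
  have "A \<subseteq> {f. (\<lambda>x. g x * f x) \<in> fun_space.span C}"
    using 1 assms(3) by (auto simp: mult.commute)
  from fun_space.span_minimal[OF this sub] assms(2) show ?thesis by (auto simp: mult.commute)
qed

text \<open>Monomials are multisets of variables: the degree is \<open>size\<close>, and removing a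
  factor \<open>x v ^ q\<close> is a multiset difference.\<close>

definition monom_fun :: "'v multiset \<Rightarrow> ('v \<Rightarrow> 'a::comm_monoid_mult) \<Rightarrow> 'a" where
  "monom_fun M x = prod_mset (image_mset x M)"

text \<open>Functions rather than formal polynomials, since identities are only tested at points.
  The degree bound stays explicit because a Hilbert function is counted later.\<close>

definition poly_funs :: "'v set \<Rightarrow> nat \<Rightarrow> (('v \<Rightarrow> 'a::field) \<Rightarrow> 'a) set" where
  "poly_funs V d = fun_space.span (monom_fun ` {M. set_mset M \<subseteq> V \<and> size M \<le> d})"

lemma poly_funs_zero: "(\<lambda>_. 0) \<in> poly_funs V d"
  using fun_space.span_zero by (auto simp: poly_funs_def zero_fun_def)

lemma poly_funs_add:
  "f \<in> poly_funs V d \<Longrightarrow> g \<in> poly_funs V d \<Longrightarrow> (\<lambda>x. f x + g x) \<in> poly_funs V d"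
  using fun_space.span_add[of f _ g] by (auto simp: poly_funs_def plus_fun_def)

lemma poly_funs_scale: "f \<in> poly_funs V d \<Longrightarrow> (\<lambda>x. c * f x) \<in> poly_funs V d"
  using fun_space.span_scale[of f _ c] by (auto simp: poly_funs_def fscale_def)

lemma poly_funs_monom: "set_mset M \<subseteq> V \<Longrightarrow> size M \<le> d \<Longrightarrow> monom_fun M \<in> poly_funs V d"
  unfolding poly_funs_def by (rule fun_space.span_base) auto

lemma poly_funs_const: "(\<lambda>_. c) \<in> poly_funs V d"
proof -
  have "monom_fun {#} = (\<lambda>_ :: 'a \<Rightarrow> 'b. 1 :: 'b)" by (auto simp: monom_fun_def)
  with poly_funs_scale[OF poly_funs_monom[of "{#}" V d], of c] show ?thesis by simp
qed

lemma poly_funs_var: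
  fixes V :: "'v set"
  assumes "v \<in> V"
  shows "(\<lambda>x :: 'v \<Rightarrow> 'a::field. x v) \<in> poly_funs V (Suc 0)"
proof -
  have "monom_fun {#v#} = (\<lambda>x :: 'v \<Rightarrow> 'a. x v)" by (auto simp: monom_fun_def)
  moreover have "monom_fun {#v#} \<in> (poly_funs V (Suc 0) :: (('v \<Rightarrow> 'a) \<Rightarrow> 'a) set)"
    using assms by (intro poly_funs_monom) auto
  ultimately show ?thesis by simp
qed

lemma poly_funs_mono: "f \<in> poly_funs V d \<Longrightarrow> d \<le> e \<Longrightarrow> f \<in> poly_funs V e"
  unfolding poly_funs_def
  by (rule subsetD[OF fun_space.span_mono]) auto

lemma poly_funs_mult:
  assumes "f \<in> poly_funs V d" "g \<in> poly_funs V e"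
  shows "(\<lambda>x. f x * g x) \<in> poly_funs V (d + e)"
  unfolding poly_funs_def
proof (rule span_fun_mult[OF _ assms[unfolded poly_funs_def]])
  fix f g :: "('a \<Rightarrow> 'b) \<Rightarrow> 'b"
  assume "f \<in> monom_fun ` {M. set_mset M \<subseteq> V \<and> size M \<le> d}"
    "g \<in> monom_fun ` {M. set_mset M \<subseteq> V \<and> size M \<le> e}"
  then obtain M N where *: "f = monom_fun M" "g = monom_fun N" "set_mset M \<subseteq> V" "size M \<le> d"
    "set_mset N \<subseteq> V" "size N \<le> e" by blast
  then have "(\<lambda>x. f x * g x) = monom_fun (M + N)" by (auto simp: monom_fun_def)
  with * show "(\<lambda>x. f x * g x) \<in> fun_space.span (monom_fun ` {M. set_mset M \<subseteq> V \<and> size M \<le> d + e})"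
    by (intro fun_space.span_base) auto
qed

lemma poly_funs_sum:
  "(\<And>i. i \<in> I \<Longrightarrow> f i \<in> poly_funs V d) \<Longrightarrow> (\<lambda>x. \<Sum>i\<in>I. f i x) \<in> poly_funs V d"
  by (induction I rule: infinite_finite_induct) (simp_all add: poly_funs_zero poly_funs_add)

lemma poly_funs_induct:
  assumes "p \<in> poly_funs V d"
    and monom: "\<And>M. set_mset M \<subseteq> V \<Longrightarrow> size M \<le> d \<Longrightarrow> Q (monom_fun M)"
    and zero: "Q (\<lambda>_. 0)"
    and add: "\<And>f g. Q f \<Longrightarrow> Q g \<Longrightarrow> Q (\<lambda>x. f x + g x)"
    and scale: "\<And>c f. Q f \<Longrightarrow> Q (\<lambda>x. c * f x)"
  shows "Q p"
proof -
  have "poly_funs V d \<subseteq> {p. Q p}"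
    unfolding poly_funs_def
  proof (rule fun_space.span_minimal)
    show "monom_fun ` {M. set_mset M \<subseteq> V \<and> size M \<le> d} \<subseteq> {p. Q p}"
      by (rule image_subsetI) (simp add: monom)
    show "fun_space.subspace {p. Q p}"
      by (rule subspace_funI; unfold mem_Collect_eq) (rule zero, erule (1) add, erule scale)
  qed
  with assms(1) show ?thesis by (simp add: subset_eq)
qed

text \<open>Determinants, matrix products and polynomial evaluations belong to such an algebra by
  closure alone. The instances are polynomial functions in several guises, functions with values in
  power series, and functions that become polynomial after inverting a matrix and clearing a power
  of its determinant.\<close>

definition funalg :: "('b \<Rightarrow> 'a::comm_ring_1) set \<Rightarrow> bool" where
  "funalg S \<longleftrightarrow> (\<forall>c. (\<lambda>_. c) \<in> S) \<and>
     (\<forall>f\<in>S. \<forall>g\<in>S. (\<lambda>x. f x + g x) \<in> S \<and> (\<lambda>x. f x * g x) \<in> S)"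

lemma
  assumes "funalg S"
  shows funalg_const: "(\<lambda>_. c) \<in> S"
    and funalg_add: "f \<in> S \<Longrightarrow> g \<in> S \<Longrightarrow> (\<lambda>x. f x + g x) \<in> S"
    and funalg_mult: "f \<in> S \<Longrightarrow> g \<in> S \<Longrightarrow> (\<lambda>x. f x * g x) \<in> S"
  using assms unfolding funalg_def by auto

lemma funalg_diff:
  assumes "funalg S" "f \<in> S" "g \<in> S" shows "(\<lambda>x. f x - g x) \<in> S"
  using funalg_add[OF assms(1,2) funalg_mult[OF assms(1) funalg_const[OF assms(1), of "-1"] assms(3)]]
  by simp

lemma funalg_sum:
  assumes "funalg S" "\<And>i. i \<in> I \<Longrightarrow> f i \<in> S" shows "(\<lambda>x. \<Sum>i\<in>I. f i x) \<in> S"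
  using assms(2)
  by (induction I rule: infinite_finite_induct)
    (simp_all add: funalg_const[OF assms(1)] funalg_add[OF assms(1)])

lemma funalg_prod:
  assumes "funalg S" "\<And>i. i \<in> I \<Longrightarrow> f i \<in> S" shows "(\<lambda>x. \<Prod>i\<in>I. f i x) \<in> S"
  using assms(2)
  by (induction I rule: infinite_finite_induct)
    (simp_all add: funalg_const[OF assms(1)] funalg_mult[OF assms(1)])

lemma funalg_power:
  assumes "funalg S" "f \<in> S" shows "(\<lambda>x. f x ^ n) \<in> S"
  by (induction n) (simp_all add: funalg_const[OF assms(1)] funalg_mult[OF assms(1) assms(2)])

lemma funalg_det:
  fixes A :: "'b \<Rightarrow> 'a::comm_ring_1^'n^'n"
  assumes "funalg S" "\<And>i j. (\<lambda>x. A x $ i $ j) \<in> S" shows "(\<lambda>x. det (A x)) \<in> S"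
  unfolding det_def
  by (intro funalg_sum[OF assms(1)] funalg_mult[OF assms(1)] funalg_const[OF assms(1)]
      funalg_prod[OF assms(1)] assms(2))

lemma funalg_poly_funs: "funalg (\<Union>d. poly_funs V d)"
  unfolding funalg_def
proof (intro conjI allI ballI)
  fix f g :: "('a \<Rightarrow> 'b) \<Rightarrow> 'b" assume "f \<in> (\<Union>d. poly_funs V d)" "g \<in> (\<Union>d. poly_funs V d)"
  then obtain d e where *: "f \<in> poly_funs V d" "g \<in> poly_funs V e" by blast
  have "(\<lambda>x. f x + g x) \<in> poly_funs V (max d e)"
    by (rule poly_funs_add[OF poly_funs_mono[OF *(1)] poly_funs_mono[OF *(2)]]) simp_all
  then show "(\<lambda>x. f x + g x) \<in> (\<Union>d. poly_funs V d)" by blast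
  show "(\<lambda>x. f x * g x) \<in> (\<Union>d. poly_funs V d)" using poly_funs_mult[OF *] by blast
qed (use poly_funs_const in blast)

lemma poly_funs_funalg:
  fixes S :: "('b \<Rightarrow> 'a::field) set"
  assumes "funalg S" "\<And>v. v \<in> V \<Longrightarrow> (\<lambda>t. x t v) \<in> S" "p \<in> poly_funs V d"
  shows "(\<lambda>t. p (x t)) \<in> S"
proof -
  have m: "(\<lambda>t. monom_fun M (x t)) \<in> S" if "set_mset M \<subseteq> V" for M
    using that
  proof (induction M)
    case empty
    show ?case using funalg_const[OF assms(1)] by (simp add: monom_fun_def)
  next
    case (add v M)
    then have "(\<lambda>t. x t v * monom_fun M (x t)) \<in> S"
      by (intro funalg_mult[OF assms(1)] assms(2)) auto
    then show ?case by (simp add: monom_fun_def)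
  qed
  show ?thesis
    by (rule poly_funs_induct[OF assms(3), where Q = "\<lambda>p. (\<lambda>t. p (x t)) \<in> S"])
      (rule m, assumption, rule funalg_const[OF assms(1)], erule (1) funalg_add[OF assms(1)],
        erule funalg_mult[OF assms(1) funalg_const[OF assms(1)]])
qed

lemma monom_fun_eq_prod:
  assumes "finite V" "set_mset M \<subseteq> V"
  shows "monom_fun M x = (\<Prod>v\<in>V. x v ^ count M v)"
proof -
  have "monom_fun M x = (\<Prod>v\<in>set_mset M. x v ^ count M v)"
    by (simp add: monom_fun_def image_prod_mset_multiplicity)
  also have "\<dots> = (\<Prod>v\<in>V. x v ^ count M v)"
    by (rule prod.mono_neutral_left) (use assms in \<open>auto simp: not_in_iff\<close>)
  finally show ?thesis .
qed

text \<open>A monomial is determined by its exponents on \<open>V\<close>, each at most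
  \<open>d\<close>. The count is crude, but only its polynomial growth in \<open>d\<close>
  matters.\<close>

lemma monom_count_bound:
  assumes "finite V"
  shows "finite {M. set_mset M \<subseteq> V \<and> size M \<le> d}" (is "finite ?S")
    and "card {M. set_mset M \<subseteq> V \<and> size M \<le> d} \<le> (d + 1) ^ card V"
proof -
  let ?f = "\<lambda>M. restrict (count M) V"
  have inj: "inj_on ?f ?S"
  proof (rule inj_onI, rule multiset_eqI)
    fix M N v assume *: "M \<in> ?S" "N \<in> ?S" "?f M = ?f N"
    show "count M v = count N v"
    proof (cases "v \<in> V")
      case True
      then show ?thesis using fun_cong[OF *(3), of v] by simp
    next
      case False
      with *(1,2) have "v \<notin># M" "v \<notin># N" by auto
      then show ?thesis by (simp add: not_in_iff)
    qed
  qed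
  have sub: "?f ` ?S \<subseteq> (\<Pi>\<^sub>E v\<in>V. {..d})"
  proof (rule image_subsetI)
    fix M assume "M \<in> ?S"
    then have "count M v \<le> d" for v using count_le_size[of M v] by simp
    then show "?f M \<in> (\<Pi>\<^sub>E v\<in>V. {..d})" by auto
  qed
  have fin: "finite (\<Pi>\<^sub>E v\<in>V. {..d})" using assms by (intro finite_PiE) auto
  show "finite ?S" by (rule inj_on_finite[OF inj sub fin])
  have "card ?S \<le> card (\<Pi>\<^sub>E v\<in>V. {..d})" by (rule card_inj_on_le[OF inj sub fin])
  then show "card ?S \<le> (d + 1) ^ card V" using assms by (simp add: card_PiE)
qed

text \<open>
  \<open>x\<close> and \<open>y\<close> play the roles of the coordinates of \<open>g\<close> and of its image under the Lang map. Rewriting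
  \<open>x\<^sub>v^q\<close> by this relation lowers the degree in \<open>x\<close> by \<open>q - 1\<close> and raises the degree in \<open>y\<close> by one, so the
  coefficients in the reduced form of a polynomial of degree \<open>d\<close> again have degree at most \<open>d\<close>.
\<close>

definition frob_rel :: "'v set \<Rightarrow> nat \<Rightarrow> ('v \<Rightarrow> 'v \<Rightarrow> 'v \<Rightarrow> 'a::field) \<Rightarrow> ('v \<Rightarrow> 'a) \<Rightarrow> ('v \<Rightarrow> 'a) \<Rightarrow> bool" where
  "frob_rel V q \<gamma> x y \<longleftrightarrow> (\<forall>v\<in>V. x v ^ q = (\<Sum>w\<in>V. \<Sum>u\<in>V. \<gamma> v w u * x w * y u))"

text \<open>The identity is demanded for all related pairs \<open>x\<close>, \<open>y\<close>, not
  only for a group element and its Lang image: it is later specialised to an \<open>F\<close>-point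
  \<open>x\<close> with \<open>y\<close> the coordinates of the unit.\<close>

definition reducible :: "'v set \<Rightarrow> nat \<Rightarrow> ('v \<Rightarrow> 'v \<Rightarrow> 'v \<Rightarrow> 'a::field) \<Rightarrow> nat \<Rightarrow> (('v \<Rightarrow> 'a) \<Rightarrow> 'a) set" where
  "reducible V q \<gamma> d = {p. \<exists>P. (\<forall>m. P m \<in> poly_funs V d) \<and>
     (\<forall>x y. frob_rel V q \<gamma> x y \<longrightarrow>
        p x = (\<Sum>m\<in>V \<rightarrow>\<^sub>E {..<q}. P m y * (\<Prod>v\<in>V. x v ^ m v)))}"

lemma reducible_add:
  assumes "p \<in> reducible V q \<gamma> d" "r \<in> reducible V q \<gamma> d"
  shows "(\<lambda>x. p x + r x) \<in> reducible V q \<gamma> d"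
proof -
  from assms obtain P R where
    "\<forall>m. P m \<in> poly_funs V d" "\<forall>m. R m \<in> poly_funs V d"
    "\<forall>x y. frob_rel V q \<gamma> x y \<longrightarrow> p x = (\<Sum>m\<in>V \<rightarrow>\<^sub>E {..<q}. P m y * (\<Prod>v\<in>V. x v ^ m v))"
    "\<forall>x y. frob_rel V q \<gamma> x y \<longrightarrow> r x = (\<Sum>m\<in>V \<rightarrow>\<^sub>E {..<q}. R m y * (\<Prod>v\<in>V. x v ^ m v))"
    unfolding reducible_def by auto
  then show ?thesis unfolding reducible_def
    by (intro CollectI exI[of _ "\<lambda>m x. P m x + R m x"])
      (simp add: poly_funs_add distrib_right sum.distrib)
qed

lemma reducible_scale:
  assumes "p \<in> reducible V q \<gamma> d"
  shows "(\<lambda>x. c * p x) \<in> reducible V q \<gamma> d"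
proof -
  from assms obtain P where
    "\<forall>m. P m \<in> poly_funs V d"
    "\<forall>x y. frob_rel V q \<gamma> x y \<longrightarrow> p x = (\<Sum>m\<in>V \<rightarrow>\<^sub>E {..<q}. P m y * (\<Prod>v\<in>V. x v ^ m v))"
    unfolding reducible_def by auto
  then show ?thesis unfolding reducible_def
    by (intro CollectI exI[of _ "\<lambda>m x. c * P m x"])
      (simp add: poly_funs_scale sum_distrib_left mult.assoc)
qed

lemma reducible_zero: "(\<lambda>_. 0) \<in> reducible V q \<gamma> d"
  unfolding reducible_def by (intro CollectI exI[of _ "\<lambda>_ _. 0"]) (simp add: poly_funs_zero)

lemma reducible_monom:
  assumes "finite V" "q \<ge> 2" "set_mset M \<subseteq> V"
  shows "monom_fun M \<in> reducible V q \<gamma> (size M)"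
  using assms(3)
proof (induction "size M" arbitrary: M rule: less_induct)
  case less
  show ?case
  proof (cases "\<forall>v\<in>V. count M v < q")
    case True
    let ?m = "restrict (count M) V"
    have m: "?m \<in> V \<rightarrow>\<^sub>E {..<q}" using True by auto
    have fin: "finite (V \<rightarrow>\<^sub>E {..<q})" using assms(1) by (intro finite_PiE) auto
    have "monom_fun M x = (\<Sum>m\<in>V \<rightarrow>\<^sub>E {..<q}. (if m = ?m then 1 else 0) * (\<Prod>v\<in>V. x v ^ m v))"
      for x :: "'a \<Rightarrow> 'b"
    proof -
      have "(\<Sum>m\<in>V \<rightarrow>\<^sub>E {..<q}. (if m = ?m then 1 else 0) * (\<Prod>v\<in>V. x v ^ m v)) =
        (\<Sum>m\<in>V \<rightarrow>\<^sub>E {..<q}. (if m = ?m then (\<Prod>v\<in>V. x v ^ m v) else 0))"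
        by (rule sum.cong) auto
      also have "\<dots> = (\<Prod>v\<in>V. x v ^ ?m v)" using m fin by (simp only: sum.delta if_True)
      also have "\<dots> = monom_fun M x"
        unfolding monom_fun_eq_prod[OF assms(1) less.prems] by (rule prod.cong) auto
      finally show ?thesis by simp
    qed
    then show ?thesis unfolding reducible_def
      by (intro CollectI exI[of _ "\<lambda>m _. if m = ?m then 1 else 0"])
        (simp add: poly_funs_const)
  next
    case False
    then obtain v where v: "v \<in> V" "count M v \<ge> q" by (auto simp: not_less)
    define N where "N = M - replicate_mset q v"
    have M: "M = replicate_mset q v + N" using v(2) by (simp add: N_def count_le_replicate_mset_subset_eq[symmetric])
    have sN: "size M = q + size N" by (simp add: M)
    have N: "set_mset N \<subseteq> V" using less.prems by (auto simp: M)
    have "\<exists>P. (\<forall>m. P m \<in> poly_funs V (size N + 1)) \<and> (\<forall>x y. frob_rel V q \<gamma> x y \<longrightarrow>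
        x w * monom_fun N x = (\<Sum>m\<in>V \<rightarrow>\<^sub>E {..<q}. P m y * (\<Prod>v\<in>V. x v ^ m v)))" if "w \<in> V" for w
      using less.hyps[of "add_mset w N"] that N sN assms(2) by (simp add: reducible_def monom_fun_def)
    then have "\<forall>w\<in>V. \<exists>P. (\<forall>m. P m \<in> poly_funs V (size N + 1)) \<and> (\<forall>x y. frob_rel V q \<gamma> x y \<longrightarrow>
        x w * monom_fun N x = (\<Sum>m\<in>V \<rightarrow>\<^sub>E {..<q}. P m y * (\<Prod>v\<in>V. x v ^ m v)))" by blast
    then obtain P where P0: "\<forall>w\<in>V. (\<forall>m. P w m \<in> poly_funs V (size N + 1)) \<and> (\<forall>x y. frob_rel V q \<gamma> x y \<longrightarrow>
        x w * monom_fun N x = (\<Sum>m\<in>V \<rightarrow>\<^sub>E {..<q}. P w m y * (\<Prod>v\<in>V. x v ^ m v)))"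
      unfolding bchoice_iff by (rule exE)
    have P: "\<And>w m. w \<in> V \<Longrightarrow> P w m \<in> poly_funs V (size N + 1)"
      "\<And>w x y. w \<in> V \<Longrightarrow> frob_rel V q \<gamma> x y \<Longrightarrow>
         x w * monom_fun N x = (\<Sum>m\<in>V \<rightarrow>\<^sub>E {..<q}. P w m y * (\<Prod>v\<in>V. x v ^ m v))" using P0 by auto
    show ?thesis unfolding reducible_def
    proof (intro CollectI exI[of _ "\<lambda>m y. \<Sum>w\<in>V. \<Sum>u\<in>V. \<gamma> v w u * (y u * P w m y)"] conjI allI impI)
      fix m
      \<comment> \<open>\<open>P w m\<close> has degree \<open>size N + 1\<close> and
        \<open>y u\<close> adds one; the sum is at most \<open>size M = q + size N\<close> because
        \<open>q\<close> is at least 2.\<close>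
      have "(\<lambda>y. y u * P w m y) \<in> poly_funs V (size M)" if "u \<in> V" "w \<in> V" for u w
        by (rule poly_funs_mono[OF poly_funs_mult[OF poly_funs_var P(1)]]) (use that assms(2) sN in auto)
      then show "(\<lambda>y. \<Sum>w\<in>V. \<Sum>u\<in>V. \<gamma> v w u * (y u * P w m y)) \<in> poly_funs V (size M)"
        by (intro poly_funs_sum poly_funs_scale)
    next
      fix x y :: "'a \<Rightarrow> 'b" assume r: "frob_rel V q \<gamma> x y"
      have "monom_fun M x = x v ^ q * monom_fun N x" by (simp add: M monom_fun_def)
      also have "\<dots> = (\<Sum>w\<in>V. \<Sum>u\<in>V. \<gamma> v w u * y u * (x w * monom_fun N x))"
        using r v(1) by (simp add: frob_rel_def sum_distrib_left sum_distrib_right mult_ac)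
      also have "\<dots> = (\<Sum>w\<in>V. \<Sum>u\<in>V. \<Sum>m\<in>V \<rightarrow>\<^sub>E {..<q}. \<gamma> v w u * (y u * P w m y) * (\<Prod>v\<in>V. x v ^ m v))"
        by (intro sum.cong refl) (simp add: P(2)[OF _ r] sum_distrib_left mult_ac)
      also have "\<dots> = (\<Sum>w\<in>V. \<Sum>m\<in>V \<rightarrow>\<^sub>E {..<q}. \<Sum>u\<in>V. \<gamma> v w u * (y u * P w m y) * (\<Prod>v\<in>V. x v ^ m v))"
        by (intro sum.cong refl sum.swap)
      also have "\<dots> = (\<Sum>m\<in>V \<rightarrow>\<^sub>E {..<q}. \<Sum>w\<in>V. \<Sum>u\<in>V. \<gamma> v w u * (y u * P w m y) * (\<Prod>v\<in>V. x v ^ m v))"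
        by (rule sum.swap)
      finally show "monom_fun M x =
          (\<Sum>m\<in>V \<rightarrow>\<^sub>E {..<q}. (\<Sum>w\<in>V. \<Sum>u\<in>V. \<gamma> v w u * (y u * P w m y)) * (\<Prod>v\<in>V. x v ^ m v))"
        by (simp add: sum_distrib_right)
    qed
  qed
qed

lemma reducible_mono: "d \<le> e \<Longrightarrow> reducible V q \<gamma> d \<subseteq> reducible V q \<gamma> e"
proof
  fix p assume "d \<le> e" "p \<in> reducible V q \<gamma> d"
  then obtain P where "\<forall>m. P m \<in> poly_funs V d" "\<forall>x y. frob_rel V q \<gamma> x y \<longrightarrow>
        p x = (\<Sum>m\<in>V \<rightarrow>\<^sub>E {..<q}. P m y * (\<Prod>v\<in>V. x v ^ m v))"
    unfolding reducible_def by auto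
  with \<open>d \<le> e\<close> show "p \<in> reducible V q \<gamma> e"
    unfolding reducible_def by (intro CollectI exI[of _ P]) (auto intro: poly_funs_mono)
qed

lemma poly_funs_reducible:
  assumes "finite V" "q \<ge> 2"
  shows "poly_funs V d \<subseteq> reducible V q \<gamma> d"
proof
  fix p :: "('a \<Rightarrow> 'b) \<Rightarrow> 'b" assume "p \<in> poly_funs V d"
  then show "p \<in> reducible V q \<gamma> d"
    by (rule poly_funs_induct[where Q = "\<lambda>p. p \<in> reducible V q \<gamma> d"])
      (rule subsetD[OF reducible_mono reducible_monom[OF assms]], assumption+, rule reducible_zero,
        erule (1) reducible_add, erule reducible_scale)
qed

section \<open>Finiteness of the Lang map\<close>

text \<open>
  Nakayama's lemma in elementary form: if the matrix \<open>B(z)\<close> is singular for all \<open>z\<close> of some set and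
  \<open>B(z0) = 1\<close>, then \<open>f\<close> (essentially \<open>det B\<close>) separates \<open>z0\<close> from that set.
\<close>

lemma elimination:
  fixes B :: "'i \<Rightarrow> 'i \<Rightarrow> 'c \<Rightarrow> 'a::field"
  assumes "finite I" "funalg S" "\<And>i j. B i j \<in> S"
    "\<And>i j. i \<in> I \<Longrightarrow> j \<in> I \<Longrightarrow> B i j z0 = (if i = j then 1 else 0)"
  shows "\<exists>f\<in>S. f z0 = 1 \<and> (\<forall>z m. (\<exists>i\<in>I. m i \<noteq> 0) \<longrightarrow> (\<forall>i\<in>I. (\<Sum>j\<in>I. B i j z * m j) = 0) \<longrightarrow> f z = 0)"
  using assms(1,3,4)
proof (induction I arbitrary: B rule: finite_induct)
  case empty
  then show ?case by (intro bexI[of _ "\<lambda>_. 1"]) (simp_all add: funalg_const[OF assms(2)])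
next
  case (insert k I)
  define C where "C i j z = B k k z * B i j z - B i k z * B k j z" for i j z
  have CS: "C i j \<in> S" for i j
    unfolding C_def by (intro funalg_diff[OF assms(2)] funalg_mult[OF assms(2)] insert.prems(1))
  have "C i j z0 = (if i = j then 1 else 0)" if "i \<in> I" "j \<in> I" for i j
    using that insert.hyps(2) by (auto simp: C_def insert.prems(2))
  from insert.IH[OF CS this] obtain f where f: "f \<in> S" "f z0 = 1"
    "\<And>z m. (\<exists>i\<in>I. m i \<noteq> 0) \<Longrightarrow> (\<forall>i\<in>I. (\<Sum>j\<in>I. C i j z * m j) = 0) \<Longrightarrow> f z = 0" by blast
  show ?case
  proof (intro bexI[of _ "\<lambda>z. f z * B k k z"] conjI allI impI)
    show "(\<lambda>z. f z * B k k z) \<in> S" by (rule funalg_mult[OF assms(2) f(1) insert.prems(1)])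
    show "f z0 * B k k z0 = 1" using f(2) insert.prems(2)[of k k] by simp
  next
    fix z and m :: "'i \<Rightarrow> 'a"
    assume nz: "\<exists>i\<in>insert k I. m i \<noteq> 0"
      and ker: "\<forall>i\<in>insert k I. (\<Sum>j\<in>insert k I. B i j z * m j) = 0"
    have ker': "(\<Sum>j\<in>I. B i j z * m j) = - (B i k z * m k)" if "i \<in> insert k I" for i
    proof -
      have "(\<Sum>j\<in>insert k I. B i j z * m j) = 0" using ker that by blast
      then show ?thesis using insert.hyps by (simp add: eq_neg_iff_add_eq_0 add.commute)
    qed
    show "f z * B k k z = 0"
    proof (cases "\<exists>i\<in>I. m i \<noteq> 0")
      case True
      have "(\<Sum>j\<in>I. C i j z * m j) = 0" if "i \<in> I" for i
      proof -
        have "(\<Sum>j\<in>I. C i j z * m j) =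
            B k k z * (\<Sum>j\<in>I. B i j z * m j) - B i k z * (\<Sum>j\<in>I. B k j z * m j)"
          by (simp add: C_def sum_subtractf sum_distrib_left algebra_simps)
        also have "\<dots> = 0" using ker'[of i] ker'[of k] that by simp
        finally show ?thesis .
      qed
      with f(3)[OF True] show ?thesis by simp
    next
      case False
      with nz have "m k \<noteq> 0" by auto
      moreover have "B k k z * m k = 0"
        using ker'[of k] False by simp
      ultimately show ?thesis by simp
    qed
  qed
qed

text \<open>A polynomial in one variable of degree below \<open>q\<close> with \<open>q\<close>
  roots is zero. Applied to one coordinate at a time, this shows that a reduced polynomial is
  determined by its values on the \<open>F\<close>-points.\<close>

lemma reduced_monomials_independent:
  fixes F :: "'a::field set" and a :: "('v \<Rightarrow> nat) \<Rightarrow> 'a"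
  assumes "finite V" "card F = q" "finite F"
    and "\<And>c. c \<in> V \<rightarrow>\<^sub>E F \<Longrightarrow> (\<Sum>m\<in>V \<rightarrow>\<^sub>E {..<q}. a m * (\<Prod>v\<in>V. c v ^ m v)) = 0"
    and "m \<in> V \<rightarrow>\<^sub>E {..<q}"
  shows "a m = 0"
  using assms(1,4,5)
proof (induction V arbitrary: a m rule: finite_induct)
  case empty
  then show ?case by simp
next
  case (insert v V)
  have inj: "inj_on (\<lambda>(i, m). m(v := i)) ({..<q} \<times> (V \<rightarrow>\<^sub>E {..<q}))"
    using inj_combinator[OF insert.hyps(2), of "\<lambda>_. {..<q}"] by simp
  obtain i m' where im: "i < q" "m' \<in> V \<rightarrow>\<^sub>E {..<q}" "m = m'(v := i)"
    using insert.prems(2) unfolding PiE_insert_eq by auto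
  have "(\<Sum>m\<in>V \<rightarrow>\<^sub>E {..<q}. a (m(v := i)) * (\<Prod>w\<in>V. c w ^ m w)) = 0"
    if c: "c \<in> V \<rightarrow>\<^sub>E F" for c
  proof -
    \<comment> \<open>The coefficient of the \<open>i\<close>-th power of the new variable once the
      other coordinates are frozen at \<open>c\<close>.\<close>
    define b where "b i = (\<Sum>m\<in>V \<rightarrow>\<^sub>E {..<q}. a (m(v := i)) * (\<Prod>w\<in>V. c w ^ m w))" for i
    define P where "P = (\<Sum>i<q. Polynomial.monom (b i) i)"
    have root: "poly P z = 0" if z: "z \<in> F" for z
    proof -
      have cz: "c(v := z) \<in> insert v V \<rightarrow>\<^sub>E F" using c z by (intro PiE_fun_upd)
      have "0 = (\<Sum>m\<in>insert v V \<rightarrow>\<^sub>E {..<q}. a m * (\<Prod>w\<in>insert v V. (c(v := z)) w ^ m w))"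
        using insert.prems(1)[OF cz] by simp
      also have "\<dots> = (\<Sum>(i, m)\<in>{..<q} \<times> (V \<rightarrow>\<^sub>E {..<q}).
          a (m(v := i)) * (\<Prod>w\<in>insert v V. (c(v := z)) w ^ (m(v := i)) w))"
        unfolding PiE_insert_eq by (subst sum.reindex[OF inj]) (simp add: case_prod_beta)
      also have "\<dots> = (\<Sum>(i, m)\<in>{..<q} \<times> (V \<rightarrow>\<^sub>E {..<q}).
          a (m(v := i)) * (z ^ i * (\<Prod>w\<in>V. c w ^ m w)))"
      proof (rule sum.cong[OF refl], clarify)
        fix i m
        have "(\<Prod>w\<in>insert v V. (c(v := z)) w ^ (m(v := i)) w) = z ^ i * (\<Prod>w\<in>V. (c(v := z)) w ^ (m(v := i)) w)"
          using insert.hyps by simp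
        also have "(\<Prod>w\<in>V. (c(v := z)) w ^ (m(v := i)) w) = (\<Prod>w\<in>V. c w ^ m w)"
          using insert.hyps(2) by (intro prod.cong) auto
        finally show "a (m(v := i)) * (\<Prod>w\<in>insert v V. (c(v := z)) w ^ (m(v := i)) w) =
            a (m(v := i)) * (z ^ i * (\<Prod>w\<in>V. c w ^ m w))" by simp
      qed
      also have "\<dots> = (\<Sum>i<q. \<Sum>m\<in>V \<rightarrow>\<^sub>E {..<q}. a (m(v := i)) * (z ^ i * (\<Prod>w\<in>V. c w ^ m w)))"
        by (simp add: sum.cartesian_product)
      also have "\<dots> = (\<Sum>i<q. b i * z ^ i)"
        by (simp add: b_def sum_distrib_left sum_distrib_right mult_ac)
      also have "\<dots> = poly P z" by (simp add: P_def poly_sum poly_monom)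
      finally show ?thesis by simp
    qed
    have "P = 0"
    proof (rule ccontr)
      assume P: "P \<noteq> 0"
      have "card F \<le> card {z. poly P z = 0}"
        by (rule card_mono) (use root poly_roots_finite[OF P] in auto)
      also have "\<dots> \<le> Polynomial.degree P" by (rule card_poly_roots_bound[OF P])
      also have "Polynomial.degree P < q"
      proof -
        have "q > 0" using im(1) by simp
        then have "Polynomial.degree P \<le> q - 1" unfolding P_def
          by (intro degree_sum_le) (auto intro: order_trans[OF degree_monom_le])
        then show ?thesis using \<open>q > 0\<close> by simp
      qed
      finally show False using assms(2) by simp
    qed
    have "b i = Polynomial.coeff P i" using im(1) by (simp add: P_def Polynomial.coeff_sum)
    then show ?thesis using \<open>P = 0\<close> by (simp add: b_def)
  qed
  from insert.IH[OF this im(2)] im(3) show ?case by simp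
qed

text \<open>What the count needs to know about the Lang map. In the application
  \<open>\<Gamma>\<close> is the group of arcs, \<open>J A\<close> the jet of
  \<open>Yi ** A\<close>, \<open>L\<close> the Lang map and \<open>e\<close> the identity matrix;
  \<open>irred\<close> says that the coordinate functions on \<open>\<Gamma>\<close> form an
  integral domain.\<close>

locale frob_set =
  fixes V :: "'v set" and q :: nat and \<gamma> :: "'v \<Rightarrow> 'v \<Rightarrow> 'v \<Rightarrow> 'a::field"
    and \<Gamma> :: "'b set" and J :: "'b \<Rightarrow> 'v \<Rightarrow> 'a" and L :: "'b \<Rightarrow> 'b" and e :: 'b
  assumes finV: "finite V" and q2: "q \<ge> 2" and e: "e \<in> \<Gamma>"
    and L: "\<And>g. g \<in> \<Gamma> \<Longrightarrow> L g \<in> \<Gamma>"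
    and rel: "\<And>g. g \<in> \<Gamma> \<Longrightarrow> frob_rel V q \<gamma> (J g) (J (L g))"
    and irred: "\<And>d p r. p \<in> poly_funs V d \<Longrightarrow> r \<in> poly_funs V d \<Longrightarrow>
      (\<forall>g\<in>\<Gamma>. p (J g) * r (J g) = 0) \<Longrightarrow> (\<forall>g\<in>\<Gamma>. p (J g) = 0) \<or> (\<forall>g\<in>\<Gamma>. r (J g) = 0)"
begin

text \<open>Values off \<open>\<Gamma>\<close> are set to zero, so that equality of total functions
  means equality on \<open>\<Gamma>\<close>. Thus \<open>res\<close> passes to the coordinate ring
  of the closure of \<open>J\<close> on \<open>\<Gamma>\<close>, and the spaces \<open>reg d\<close>
  below are its filtration by degree.\<close>

definition res :: "(('v \<Rightarrow> 'a) \<Rightarrow> 'a) \<Rightarrow> 'b \<Rightarrow> 'a" where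
  "res p = (\<lambda>g. if g \<in> \<Gamma> then p (J g) else 0)"

definition pull :: "('b \<Rightarrow> 'a) \<Rightarrow> 'b \<Rightarrow> 'a" where
  "pull w = (\<lambda>g. if g \<in> \<Gamma> then w (L g) else 0)"

definition reg :: "nat \<Rightarrow> ('b \<Rightarrow> 'a) set" where
  "reg d = res ` poly_funs V d"

lemma reg_subspace: "fun_space.subspace (reg d)"
proof (rule subspace_funI)
  have "(\<lambda>_. 0) = res (\<lambda>_. 0)" by (auto simp: res_def)
  then show "(\<lambda>_. 0) \<in> reg d" unfolding reg_def using poly_funs_zero by blast
next
  fix f g assume "f \<in> reg d" "g \<in> reg d"
  then obtain p r where *: "f = res p" "g = res r" "p \<in> poly_funs V d" "r \<in> poly_funs V d"
    unfolding reg_def by blast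
  then have "(\<lambda>x. f x + g x) = res (\<lambda>x. p x + r x)" by (auto simp: res_def)
  then show "(\<lambda>x. f x + g x) \<in> reg d" unfolding reg_def using poly_funs_add[OF *(3,4)] by simp
next
  fix c f assume "f \<in> reg d"
  then obtain p where *: "f = res p" "p \<in> poly_funs V d" unfolding reg_def by blast
  then have "(\<lambda>x. c * f x) = res (\<lambda>x. c * p x)" by (auto simp: res_def)
  then show "(\<lambda>x. c * f x) \<in> reg d" unfolding reg_def using poly_funs_scale[OF *(2)] by simp
qed

lemma reg_span: "reg d \<subseteq> fun_space.span (res ` monom_fun ` {M. set_mset M \<subseteq> V \<and> size M \<le> d})"
proof -
  let ?S = "fun_space.span (res ` monom_fun ` {M. set_mset M \<subseteq> V \<and> size M \<le> d})"
  have "res p \<in> ?S" if "p \<in> poly_funs V d" for p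
    using that
  proof (rule poly_funs_induct[where Q = "\<lambda>p. res p \<in> ?S"])
    fix M :: "'v multiset" assume "set_mset M \<subseteq> V" "size M \<le> d"
    then show "res (monom_fun M) \<in> ?S" by (intro fun_space.span_base) auto
  next
    have "res (\<lambda>_. 0) = 0" by (auto simp: res_def fun_eq_iff)
    then show "res (\<lambda>_. 0) \<in> ?S" by (simp add: fun_space.span_zero)
  next
    fix f g assume "res f \<in> ?S" "res g \<in> ?S"
    then have "res f + res g \<in> ?S" by (rule fun_space.span_add)
    also have "res f + res g = res (\<lambda>x. f x + g x)" by (auto simp: res_def fun_eq_iff)
    finally show "res (\<lambda>x. f x + g x) \<in> ?S" .
  next
    fix c f assume "res f \<in> ?S"
    then have "fscale c (res f) \<in> ?S" by (rule fun_space.span_scale)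
    also have "fscale c (res f) = res (\<lambda>x. c * f x)" by (auto simp: res_def fscale_def fun_eq_iff)
    finally show "res (\<lambda>x. c * f x) \<in> ?S" .
  qed
  then show ?thesis unfolding reg_def by (simp add: image_subset_iff)
qed

lemma reg_dim: "fun_space.dim (reg d) \<le> (d + 1) ^ card V"
proof -
  note b = monom_count_bound[OF finV, of d]
  have "fun_space.dim (reg d) \<le> card (res ` monom_fun ` {M. set_mset M \<subseteq> V \<and> size M \<le> d})"
    by (rule fun_space.dim_le_card[OF reg_span]) (intro finite_imageI b)
  also have "\<dots> \<le> card {M. set_mset M \<subseteq> V \<and> size M \<le> d}"
    by (rule order_trans[OF card_image_le card_image_le]) (intro finite_imageI b)+
  also have "\<dots> \<le> (d + 1) ^ card V" by (rule b(2))
  finally show ?thesis .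
qed

lemma reg_basis:
  assumes "S \<subseteq> reg d" "fun_space.independent S"
  obtains B where "S \<subseteq> B" "B \<subseteq> reg d" "fun_space.independent B" "reg d \<subseteq> fun_space.span B"
    "finite B" "card B = fun_space.dim (reg d)"
proof -
  obtain B where B: "S \<subseteq> B" "B \<subseteq> reg d" "fun_space.independent B" "reg d \<subseteq> fun_space.span B"
    using fun_space.maximal_independent_subset_extend[OF assms] by blast
  have "finite (res ` monom_fun ` {M. set_mset M \<subseteq> V \<and> size M \<le> d})"
    by (intro finite_imageI monom_count_bound[OF finV])
  from fun_space.independent_span_bound[OF this B(3)] B(2) reg_span
  have "finite B" by blast
  with that[OF B] fun_space.basis_card_eq_dim[OF B(2,4,3)] show ?thesis by blast
qed

end

lemma sum_fun_apply: "(\<Sum>i\<in>I. f i) x = (\<Sum>i\<in>I. f i x :: 'a::comm_monoid_add)"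
  by (induction I rule: infinite_finite_induct) simp_all

context frob_set
begin

lemma pull_subspace: "fun_space.subspace {w. pull w \<in> fun_space.span C}"
proof (rule subspace_funI, unfold mem_Collect_eq)
  have "pull (\<lambda>_. 0) = 0" by (auto simp: pull_def fun_eq_iff)
  then show "pull (\<lambda>_. 0) \<in> fun_space.span C" by (simp add: fun_space.span_zero)
next
  fix f g assume "pull f \<in> fun_space.span C" "pull g \<in> fun_space.span C"
  then have "pull f + pull g \<in> fun_space.span C" by (rule fun_space.span_add)
  also have "pull f + pull g = pull (\<lambda>x. f x + g x)" by (auto simp: pull_def fun_eq_iff)
  finally show "pull (\<lambda>x. f x + g x) \<in> fun_space.span C" .
next
  fix c f assume "pull f \<in> fun_space.span C"
  then have "fscale c (pull f) \<in> fun_space.span C" by (rule fun_space.span_scale)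
  also have "fscale c (pull f) = pull (\<lambda>x. c * f x)" by (auto simp: pull_def fscale_def fun_eq_iff)
  finally show "pull (\<lambda>x. c * f x) \<in> fun_space.span C" .
qed

text \<open>
  With \<open>H\<close> the Hilbert function and \<open>c = q ^ card V\<close>: multiplication by \<open>f\<close> embeds the functions of degree
  \<open>n\<close> into those of degree \<open>n + d\<close> killed by \<open>pull\<close>, and \<open>c\<close> reduced monomials generate all functions over
  the image of \<open>pull\<close>. Hence \<open>H (n + d) \<le> c * (H (n + d) - H n)\<close>, and \<open>H\<close> would grow exponentially.
\<close>

lemma dim_growth:
  assumes f: "f \<in> poly_funs V d" and pf: "\<forall>g\<in>\<Gamma>. f (J (L g)) = 0" and nz: "\<not> (\<forall>g\<in>\<Gamma>. f (J g) = 0)"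
  shows "fun_space.dim (reg (n + d)) + q ^ card V * fun_space.dim (reg n)
     \<le> q ^ card V * fun_space.dim (reg (n + d))"
proof -
  define M where "M = V \<rightarrow>\<^sub>E {..<q}"
  have M: "finite M" "card M = q ^ card V"
    using finV by (auto simp: M_def card_PiE intro: finite_PiE)
  obtain B where B: "B \<subseteq> reg n" "fun_space.independent B" "finite B" "card B = fun_space.dim (reg n)"
    using reg_basis[OF empty_subsetI fun_space.independent_empty] by metis
  define m where "m w = (\<lambda>g. res f g * w g)" for w
  have m_add: "m (u + w) = m u + m w" and m_scale: "m (fscale c w) = fscale c (m w)" for u w c
    by (auto simp: m_def fscale_def fun_eq_iff algebra_simps)
  have m_lin: "Vector_Spaces.linear fscale fscale m"
    unfolding Vector_Spaces.linear_iff using m_add m_scale fun_space.vector_space_axioms by blast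
  interpret m: Vector_Spaces.linear fscale fscale m by (rule m_lin)
  have m_reg: "m w \<in> reg (n + d)" if "w \<in> reg n" for w
  proof -
    from that obtain p where p: "w = res p" "p \<in> poly_funs V n" unfolding reg_def by blast
    have "m w = res (\<lambda>x. p x * f x)" by (auto simp: m_def p res_def)
    then show ?thesis using poly_funs_mult[OF p(2) f] unfolding reg_def by blast
  qed
  \<comment> \<open>Here irreducibility enters: a product with \<open>f\<close> vanishes on
    \<open>\<Gamma>\<close> but \<open>f\<close> does not. The bound \<open>max n d\<close> is a
    common degree for both factors.\<close>
  have m_inj: "w = 0" if w: "w \<in> reg n" "m w = 0" for w
  proof -
    from w obtain p where p: "w = res p" "p \<in> poly_funs V n" unfolding reg_def by blast
    have "\<forall>g\<in>\<Gamma>. f (J g) * p (J g) = 0"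
    proof
      fix g assume "g \<in> \<Gamma>"
      with fun_cong[OF w(2), of g] show "f (J g) * p (J g) = 0" by (simp add: m_def p res_def)
    qed
    from irred[OF _ _ this, of "max n d"] nz have "\<forall>g\<in>\<Gamma>. p (J g) = 0"
      using poly_funs_mono[OF f] poly_funs_mono[OF p(2)] by auto
    then show ?thesis by (auto simp: p res_def fun_eq_iff)
  qed
  have spanB: "fun_space.span B \<subseteq> reg n"
    by (rule fun_space.span_minimal[OF B(1) reg_subspace])
  have mB_inj: "inj_on m (fun_space.span B)"
  proof (rule inj_onI)
    fix u w assume "u \<in> fun_space.span B" "w \<in> fun_space.span B" "m u = m w"
    then have "u - w \<in> reg n" "m (u - w) = 0"
      using spanB fun_space.span_diff[of u B w] by (auto simp: m.diff)
    from m_inj[OF this] show "u = w" by simp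
  qed
  have ind: "fun_space.independent (m ` B)"
    using m.independent_injective_image[OF B(2) mB_inj] .
  have "m ` B \<subseteq> reg (n + d)" using m_reg B(1) by blast
  from reg_basis[OF this ind] obtain C where C: "m ` B \<subseteq> C" "C \<subseteq> reg (n + d)"
    "reg (n + d) \<subseteq> fun_space.span C" "finite C" "card C = fun_space.dim (reg (n + d))" by metis
  \<comment> \<open>Since \<open>pull\<close> kills the image of \<open>m\<close>, the basis
    elements outside that image already account for everything in the range of \<open>pull\<close>;
    this is the saving of \<open>H n\<close> in the count.\<close>
  define T where "T = pull ` (C - m ` B)"
  have "card (m ` B) = card B"
    using card_image[OF inj_on_subset[OF mB_inj fun_space.span_superset]] .
  then have cardT: "card T + fun_space.dim (reg n) \<le> fun_space.dim (reg (n + d))"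
    using card_image_le[of "C - m ` B" pull] card_Diff_subset[OF _ C(1)] card_mono[OF C(4,1)] B(3,4) C(4,5)
    by (simp add: T_def)
  have finT: "finite T" using C(4) by (simp add: T_def)
  have pull_m: "pull (m w) = 0" for w
  proof (rule ext)
    fix g show "pull (m w) g = 0 g" using pf L[of g] by (simp add: pull_def m_def res_def)
  qed
  have "C \<subseteq> {w. pull w \<in> fun_space.span T}"
  proof
    fix w assume "w \<in> C"
    show "w \<in> {w. pull w \<in> fun_space.span T}"
    proof (cases "w \<in> m ` B")
      case True
      then have "pull w = 0" using pull_m by blast
      then show ?thesis by (simp add: fun_space.span_zero)
    next
      case False
      then show ?thesis using \<open>w \<in> C\<close> by (auto simp: T_def intro: fun_space.span_base)
    qed
  qed
  from fun_space.span_minimal[OF this pull_subspace] C(3)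
  have pullT: "pull w \<in> fun_space.span T" if "w \<in> reg (n + d)" for w using that by blast
  define mon where "mon k = res (\<lambda>x. \<Prod>v\<in>V. x v ^ k v)" for k
  define U where "U = (\<lambda>(t, k) g. t g * mon k g) ` (T \<times> M)"
  have "card U \<le> card T * card M"
    unfolding U_def card_cartesian_product[symmetric] by (rule card_image_le) (simp add: finT M)
  have finU: "finite U" by (simp add: U_def finT M)
  have "reg (n + d) \<subseteq> fun_space.span U"
  proof
    fix w assume "w \<in> reg (n + d)"
    then obtain p where p: "w = res p" "p \<in> poly_funs V (n + d)" unfolding reg_def by blast
    from subsetD[OF poly_funs_reducible[OF finV q2] p(2), of \<gamma>]
    obtain P where P: "\<And>k. P k \<in> poly_funs V (n + d)"
      "\<And>x y. frob_rel V q \<gamma> x y \<Longrightarrow> p x = (\<Sum>k\<in>M. P k y * (\<Prod>v\<in>V. x v ^ k v))"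
      unfolding reducible_def M_def by blast
    \<comment> \<open>On \<open>\<Gamma>\<close> the reduced form of \<open>p\<close> has
      coefficients evaluated at \<open>J (L g)\<close>, that is, pullbacks of functions of degree
      \<open>n + d\<close>.\<close>
    have w: "w = (\<Sum>k\<in>M. (\<lambda>g. pull (res (P k)) g * mon k g))"
    proof (rule ext)
      fix g
      have "w g = (\<Sum>k\<in>M. pull (res (P k)) g * mon k g)"
      proof (cases "g \<in> \<Gamma>")
        case True
        then show ?thesis using P(2)[OF rel[OF True]] L[OF True]
          by (simp add: p res_def pull_def mon_def)
      next
        case False
        then show ?thesis by (simp add: p res_def pull_def)
      qed
      then show "w g = (\<Sum>k\<in>M. (\<lambda>g. pull (res (P k)) g * mon k g)) g"
        by (simp add: sum_fun_apply)
    qed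
    have "(\<lambda>g. pull (res (P k)) g * mon k g) \<in> fun_space.span U" if k: "k \<in> M" for k
    proof (rule span_fun_mult)
      show "pull (res (P k)) \<in> fun_space.span T" using pullT P(1) by (auto simp: reg_def)
      show "mon k \<in> fun_space.span {mon k}" by (rule fun_space.span_base) simp
      fix t h assume "t \<in> T" "h \<in> {mon k}"
      then show "(\<lambda>x. t x * h x) \<in> fun_space.span U"
        using k by (intro fun_space.span_base) (auto simp: U_def intro!: rev_image_eqI[of "(t, k)"])
    qed
    then show "w \<in> fun_space.span U" unfolding w by (rule fun_space.span_sum)
  qed
  from fun_space.dim_le_card[OF this finU] \<open>card U \<le> _\<close>
  have "fun_space.dim (reg (n + d)) \<le> q ^ card V * card T" by (simp add: M(2) mult.commute)
  also have "\<dots> + q ^ card V * fun_space.dim (reg n) = q ^ card V * (card T + fun_space.dim (reg n))"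
    by (simp add: algebra_simps)
  also have "\<dots> \<le> q ^ card V * fun_space.dim (reg (n + d))" using cardT by simp
  finally show ?thesis by simp
qed

text \<open>The algebraic form of the statement that the Lang map has dense image. If it failed, the
  Hilbert function would gain a constant factor larger than 1 with every \<open>d\<close> degrees,
  against its polynomial bound.\<close>

lemma pull_injective:
  assumes f: "f \<in> poly_funs V d" and pf: "\<forall>g\<in>\<Gamma>. f (J (L g)) = 0"
  shows "\<forall>g\<in>\<Gamma>. f (J g) = 0"
proof (rule ccontr)
  assume nz: "\<not> ?thesis"
  define H where "H n = fun_space.dim (reg n)" for n
  define c where "c = q ^ card V"
  have growth: "H (n + d) + c * H n \<le> c * H (n + d)" for n
    unfolding H_def c_def by (rule dim_growth[OF f pf nz])
  have c: "c > 0" using q2 by (simp add: c_def)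
  \<comment> \<open>The growth inequality implies in particular \<open>H n \<le> H (n + d)\<close>,
    which allows its first summand to be replaced by \<open>H n\<close>.\<close>
  have step: "(1 + 1 / real c) * real (H n) \<le> real (H (n + d))" for n
  proof -
    have "real (H (n + d)) + real c * real (H n) \<le> real c * real (H (n + d))"
      using growth[of n] by (metis of_nat_add of_nat_mult of_nat_le_iff)
    moreover have "real c * real (H n) \<le> real c * real (H (n + d))"
      using growth[of n] by (metis add_leD2 of_nat_mult of_nat_le_iff)
    then have "real (H n) \<le> real (H (n + d))" using c by simp
    ultimately have "real c * ((1 + 1 / real c) * real (H n)) \<le> real c * real (H (n + d))"
      using c by (simp add: algebra_simps)
    then show ?thesis using c by simp
  qed
  have H0: "H 0 > 0"
  proof (rule ccontr)
    assume "\<not> H 0 > 0"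
    obtain B where "reg 0 \<subseteq> fun_space.span B" "finite B" "card B = H 0"
      using reg_basis[OF empty_subsetI fun_space.independent_empty] unfolding H_def by metis
    with \<open>\<not> H 0 > 0\<close> have "reg 0 \<subseteq> {0}" by simp
    moreover have "res (\<lambda>_. 1) \<in> reg 0" unfolding reg_def using poly_funs_const by blast
    ultimately have "res (\<lambda>_. 1) = 0" by blast
    from fun_cong[OF this, of e] e show False by (simp add: res_def)
  qed
  have "(1 + 1 / real c) ^ k \<le> real (H (k * d))" for k
  proof (induction k)
    case 0
    show ?case using H0 by simp
  next
    case (Suc k)
    have "(1 + 1 / real c) ^ Suc k \<le> (1 + 1 / real c) * real (H (k * d))"
      using Suc by (simp add: mult_left_mono)
    also have "\<dots> \<le> real (H (Suc k * d))" using step[of "k * d"] by (simp add: add.commute)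
    finally show ?case .
  qed
  also have "real (H (k * d)) \<le> (real k * real d + 1) ^ card V" for k
    using reg_dim[of "k * d"] unfolding H_def
    by (metis (no_types, lifting) of_nat_add of_nat_1 of_nat_le_iff of_nat_mult of_nat_power)
  finally have bound: "(1 + 1 / real c) ^ k \<le> (real k * real d + 1) ^ card V" for k .
  define a where "a = 1 + 1 / real c"
  define D where "D = real d"
  define N where "N = card V"
  have "a > 1" "D \<ge> 0" using c by (auto simp: a_def D_def)
  \<comment> \<open>\<open>D + 1\<close> instead of \<open>D\<close> keeps the leading coefficient
    positive even when \<open>d = 0\<close>.\<close>
  have "eventually (\<lambda>k. (real k * (D + 1) + 1) ^ N < a ^ k) at_top"
    using \<open>a > 1\<close> \<open>D \<ge> 0\<close> by real_asymp
  then obtain k where "(real k * (D + 1) + 1) ^ N < a ^ k"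
    by (auto simp: eventually_at_top_linorder)
  moreover have "(real k * D + 1) ^ N \<le> (real k * (D + 1) + 1) ^ N"
    using \<open>D \<ge> 0\<close> by (intro power_mono) (auto intro!: mult_left_mono add_nonneg_nonneg)
  ultimately show False using bound[of k] by (simp add: a_def D_def N_def)
qed

text \<open>Suppose every \<open>F\<close>-point with nonzero \<open>\<delta>\<close> violates some
  equation of \<open>\<Gamma>\<close>. Then a function \<open>u\<close> vanishes at all
  \<open>F\<close>-points and equals \<open>\<epsilon>\<close> of the Lang image on
  \<open>\<Gamma>\<close>. Multiplication by \<open>u\<close> on reduced monomials is given by a
  matrix \<open>P\<close> of functions of \<open>y\<close>, which is zero at the unit but has
  \<open>\<epsilon>\<close> as an eigenvalue at every Lang image. Eliminating the eigenvector gives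
  a function that vanishes on all Lang images and not at the unit, which
  \<open>pull_injective\<close> forbids.\<close>

lemma fixed_point_in_closure:
  assumes F: "finite F" "card F = q" "\<And>c. c \<in> V \<rightarrow>\<^sub>E F \<Longrightarrow> frob_rel V q \<gamma> c (J e)"
    and \<delta>: "\<delta> \<in> (\<Union>d. poly_funs V d)" and \<epsilon>: "\<epsilon> \<in> (\<Union>d. poly_funs V d)"
    and \<delta>\<epsilon>: "\<And>g. g \<in> \<Gamma> \<Longrightarrow> \<delta> (J g) ^ (q - 1) = \<epsilon> (J (L g))" and \<epsilon>e: "\<epsilon> (J e) = 1"
  shows "\<exists>c\<in>V \<rightarrow>\<^sub>E F. \<delta> c \<noteq> 0 \<and> (\<forall>d. \<forall>p\<in>poly_funs V d. (\<forall>g\<in>\<Gamma>. p (J g) = 0) \<longrightarrow> p c = 0)"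
proof (rule ccontr)
  let ?S = "\<Union>d. poly_funs V d :: (('v \<Rightarrow> 'a) \<Rightarrow> 'a) set"
  note S = funalg_poly_funs[of V, where 'b = 'a]
  assume neg: "\<not> ?thesis"
  define C where "C = {c \<in> V \<rightarrow>\<^sub>E F. \<delta> c \<noteq> 0}"
  have finC: "finite C" 
    by (rule finite_subset[OF _ finite_PiE[OF finV, of "\<lambda>_. F"]]) (use F(1) in \<open>auto simp: C_def\<close>)
  have "\<exists>p. p \<in> ?S \<and> (\<forall>g\<in>\<Gamma>. p (J g) = 0) \<and> p c \<noteq> 0" if "c \<in> C" for c
  proof -
    have "c \<in> V \<rightarrow>\<^sub>E F" "\<delta> c \<noteq> 0" using that by (simp_all add: C_def)
    with neg obtain d p where "p \<in> poly_funs V d" "\<forall>g\<in>\<Gamma>. p (J g) = 0" "p c \<noteq> 0" by blast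
    then show ?thesis by (intro exI[of _ p] conjI UN_I[OF UNIV_I])
  qed
  then obtain f where f: "\<forall>c\<in>C. f c \<in> ?S \<and> (\<forall>g\<in>\<Gamma>. f c (J g) = 0) \<and> f c c \<noteq> 0"
    unfolding bchoice_iff[symmetric] by metis
  \<comment> \<open>On \<open>\<Gamma>\<close> every \<open>f c\<close> vanishes and the product is
    1; at a point of \<open>C\<close> its own factor is zero. The power of \<open>\<delta>\<close>
    deals with the \<open>F\<close>-points outside \<open>C\<close>.\<close>
  define u where "u x = \<delta> x ^ (q - 1) * (\<Prod>c\<in>C. 1 - inverse (f c c) * f c x)" for x
  have fS: "f c \<in> ?S" if "c \<in> C" for c by (rule bspec[OF f that, THEN conjunct1])
  have u: "u \<in> ?S"
    unfolding u_def
  proof (rule funalg_mult[OF S funalg_power[OF S \<delta>] funalg_prod[OF S]])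
    fix c assume "c \<in> C"
    then show "(\<lambda>x. 1 - inverse (f c c) * f c x) \<in> ?S"
      by (rule funalg_diff[OF S funalg_const[OF S] funalg_mult[OF S funalg_const[OF S] fS]])
  qed
  have u\<Gamma>: "u (J g) = \<epsilon> (J (L g))" if g: "g \<in> \<Gamma>" for g
  proof -
    have "(\<Prod>c\<in>C. 1 - inverse (f c c) * f c (J g)) = (\<Prod>c\<in>C. 1)"
      by (rule prod.cong) (use f g in simp_all)
    then show ?thesis using \<delta>\<epsilon>[OF g] by (simp add: u_def)
  qed
  have uF: "u c = 0" if "c \<in> V \<rightarrow>\<^sub>E F" for c
  proof (cases "\<delta> c = 0")
    case True
    then show ?thesis using q2 by (simp add: u_def)
  next
    case False
    then have "c \<in> C" using that by (simp add: C_def)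
    then have "(\<Prod>b\<in>C. 1 - inverse (f b b) * f b c) = 0"
      using f finC by (intro prod_zero bexI[of _ c]) auto
    then show ?thesis by (simp add: u_def)
  qed
  define M where "M = V \<rightarrow>\<^sub>E {..<q}"
  have finM: "finite M" unfolding M_def using finV by (intro finite_PiE) auto
  define mon where "mon k x = (\<Prod>v\<in>V. x v ^ k v)" for k :: "'v \<Rightarrow> nat" and x :: "'v \<Rightarrow> 'a"
  have var: "(\<lambda>x. x v) \<in> ?S" if "v \<in> V" for v using poly_funs_var[OF that] by blast
  have "(\<lambda>x. u x * mon k x) \<in> ?S" for k
    unfolding mon_def
    by (intro funalg_mult[OF S] funalg_power[OF S] funalg_prod[OF S] u var)
  then have "\<exists>P. (\<forall>l. P l \<in> ?S) \<and>
     (\<forall>x y. frob_rel V q \<gamma> x y \<longrightarrow> u x * mon k x = (\<Sum>l\<in>M. P l y * mon l x))" for k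
  proof -
    obtain d where "(\<lambda>x. u x * mon k x) \<in> poly_funs V d" using \<open>(\<lambda>x. u x * mon k x) \<in> ?S\<close> by blast
    from subsetD[OF poly_funs_reducible[OF finV q2] this, of \<gamma>]
    obtain P where "\<And>l. P l \<in> poly_funs V d"
      "\<And>x y. frob_rel V q \<gamma> x y \<Longrightarrow> u x * mon k x = (\<Sum>l\<in>M. P l y * mon l x)"
      unfolding reducible_def M_def mon_def by blast
    then show ?thesis by (intro exI[of _ P] conjI allI impI UN_I[OF UNIV_I]) simp_all
  qed
  then have "\<forall>k. \<exists>P. (\<forall>l. P l \<in> ?S) \<and>
     (\<forall>x y. frob_rel V q \<gamma> x y \<longrightarrow> u x * mon k x = (\<Sum>l\<in>M. P l y * mon l x))" by blast
  then obtain P where P: "\<forall>k. (\<forall>l. P k l \<in> ?S) \<and>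
     (\<forall>x y. frob_rel V q \<gamma> x y \<longrightarrow> u x * mon k x = (\<Sum>l\<in>M. P k l y * mon l x))"
    unfolding choice_iff by (rule exE)
  \<comment> \<open>The pair of an \<open>F\<close>-point and \<open>J e\<close> satisfies the
    relation, and \<open>u\<close> vanishes there; independence of the reduced monomials on
    \<open>F\<close>-points then kills each coefficient.\<close>
  have Pe: "P k l (J e) = 0" if "l \<in> M" for k l
  proof (rule reduced_monomials_independent[OF finV F(2,1)])
    show "l \<in> V \<rightarrow>\<^sub>E {..<q}" using that by (simp add: M_def)
    fix c assume c: "c \<in> V \<rightarrow>\<^sub>E F"
    have "u c * mon k c = (\<Sum>l\<in>M. P k l (J e) * mon l c)" using P F(3)[OF c] by blast
    then show "(\<Sum>l\<in>V \<rightarrow>\<^sub>E {..<q}. P k l (J e) * (\<Prod>v\<in>V. c v ^ l v)) = 0"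
      using uF[OF c] by (simp add: M_def mon_def)
  qed
  define B where "B k l z = (if k = l then 1 else 0) * \<epsilon> z - P k l z" for k l z
  have B: "B k l \<in> ?S" for k l
    unfolding B_def by (intro funalg_diff[OF S] funalg_mult[OF S] funalg_const[OF S] \<epsilon>) (simp only: P)
  have Be: "B k l (J e) = (if k = l then 1 else 0)" if "k \<in> M" "l \<in> M" for k l
    using that Pe \<epsilon>e by (simp add: B_def)
  from elimination[of M ?S B "J e", OF finM S B Be] obtain h where h: "h \<in> ?S"
    "h (J e) = 1 \<and> (\<forall>z m. (\<exists>i\<in>M. m i \<noteq> 0) \<longrightarrow> (\<forall>i\<in>M. (\<Sum>j\<in>M. B i j z * m j) = 0) \<longrightarrow> h z = 0)"
    by (rule bexE)
  have h3: "h z = 0" if "\<exists>i\<in>M. m i \<noteq> 0" "\<forall>i\<in>M. (\<Sum>j\<in>M. B i j z * m j) = 0" for z m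
    using h(2) that by blast
  \<comment> \<open>The values of the reduced monomials at \<open>J g\<close> form a kernel vector
    of \<open>B\<close> at the Lang image. It is nonzero because the constant monomial has value
    1.\<close>
  have "h (J (L g)) = 0" if g: "g \<in> \<Gamma>" for g
  proof (rule h3[of "\<lambda>k. mon k (J g)"])
    have "(\<lambda>v\<in>V. 0) \<in> M" using q2 by (auto simp: M_def)
    moreover have "mon (\<lambda>v\<in>V. 0) (J g) = 1" by (simp add: mon_def)
    ultimately show "\<exists>i\<in>M. mon i (J g) \<noteq> 0" by (metis zero_neq_one)
    show "\<forall>k\<in>M. (\<Sum>l\<in>M. B k l (J (L g)) * mon l (J g)) = 0"
    proof
      fix k assume k: "k \<in> M"
      have "(\<Sum>l\<in>M. B k l (J (L g)) * mon l (J g)) =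
          (\<Sum>l\<in>M. if k = l then \<epsilon> (J (L g)) * mon l (J g) else 0) - (\<Sum>l\<in>M. P k l (J (L g)) * mon l (J g))"
        unfolding sum_subtractf[symmetric] by (rule sum.cong) (auto simp: B_def algebra_simps)
      also have "\<dots> = \<epsilon> (J (L g)) * mon k (J g) - u (J g) * mon k (J g)"
        using P rel[OF g] finM k by simp
      finally show "(\<Sum>l\<in>M. B k l (J (L g)) * mon l (J g)) = 0" using u\<Gamma>[OF g] by simp
    qed
  qed
  moreover from h(1) obtain d where "h \<in> poly_funs V d" by blast
  ultimately have "\<forall>g\<in>\<Gamma>. h (J g) = 0" by (intro pull_injective) auto
  with conjunct1[OF h(2)] e show False by simp
qed

end

section \<open>Connected groups are irreducible\<close>

text \<open>
  \<open>\<B>\<close> is not closed under unions, so irreducibility has to be tested against finite covers by members of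
  \<open>\<B>\<close>, not only against covers by two of them.
\<close>

lemma homogeneous_connected_irreducible:
  fixes G :: "'a set" and \<B> :: "'a set set" and \<mu> :: "'a set \<Rightarrow> nat"
  assumes sub: "\<And>Z. Z \<in> \<B> \<Longrightarrow> Z \<subseteq> G" and G: "G \<in> \<B>" "G \<noteq> {}"
    and int: "\<And>S Y. S \<in> \<B> \<Longrightarrow> Y \<in> \<B> \<Longrightarrow> S \<inter> Y \<in> \<B>"
    and \<mu>: "\<And>S Y. S \<in> \<B> \<Longrightarrow> Y \<in> \<B> \<Longrightarrow> S \<subset> Y \<Longrightarrow> \<mu> S < \<mu> Y"
    and homog: "\<And>g h. g \<in> G \<Longrightarrow> h \<in> G \<Longrightarrow> \<exists>\<tau>. bij_betw \<tau> G G \<and> \<tau> h = g \<and>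
      (\<forall>Z\<in>\<B>. \<tau> ` Z \<in> \<B> \<and> G \<inter> \<tau> -` Z \<in> \<B>)"
    and conn: "\<And>\<C> S. finite \<C> \<Longrightarrow> \<C> \<subseteq> \<B> \<Longrightarrow> S \<in> \<B> \<Longrightarrow> G = S \<union> \<Union>\<C> \<Longrightarrow> S \<inter> \<Union>\<C> = {} \<Longrightarrow>
      S = {} \<or> \<Union>\<C> = {}"
    and XY: "S \<in> \<B>" "Y \<in> \<B>" "G \<subseteq> S \<union> Y"
  shows "S = G \<or> Y = G"
proof -
  define irr where "irr Z \<longleftrightarrow> Z \<in> \<B> \<and> (\<forall>\<C>\<subseteq>\<B>. finite \<C> \<longrightarrow> Z \<subseteq> \<Union>\<C> \<longrightarrow> (\<exists>S\<in>\<C>. Z \<subseteq> S))" for Z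
  have irrD: "\<exists>S\<in>\<C>. Z \<subseteq> S" if "irr Z" "\<C> \<subseteq> \<B>" "finite \<C>" "Z \<subseteq> \<Union>\<C>" for Z \<C>
    using that unfolding irr_def by blast
  have decomp: "\<exists>\<C>. finite \<C> \<and> (\<forall>Z\<in>\<C>. irr Z) \<and> \<Union>\<C> = Z" if "Z \<in> \<B>" for Z
    using that
  proof (induction "\<mu> Z" arbitrary: Z rule: less_induct)
    case less
    show ?case
    proof (cases "irr Z")
      case True
      then show ?thesis by (intro exI[of _ "{Z}"]) simp
    next
      case False
      then obtain \<C> where \<C>: "\<C> \<subseteq> \<B>" "finite \<C>" "Z \<subseteq> \<Union>\<C>" "\<And>S. S \<in> \<C> \<Longrightarrow> \<not> Z \<subseteq> S"
        using less.prems unfolding irr_def by blast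
      have "\<exists>\<D>. finite \<D> \<and> (\<forall>Z\<in>\<D>. irr Z) \<and> \<Union>\<D> = Z \<inter> S" if "S \<in> \<C>" for S
      proof (rule less.hyps)
        show "Z \<inter> S \<in> \<B>" using int less.prems \<C>(1) that by blast
        then show "\<mu> (Z \<inter> S) < \<mu> Z" using \<mu> less.prems \<C>(4)[OF that] by blast
      qed
      then have "\<forall>S\<in>\<C>. \<exists>\<D>. finite \<D> \<and> (\<forall>Z\<in>\<D>. irr Z) \<and> \<Union>\<D> = Z \<inter> S" by blast
      then obtain \<D> where "\<forall>S\<in>\<C>. finite (\<D> S) \<and> (\<forall>Z\<in>\<D> S. irr Z) \<and> \<Union>(\<D> S) = Z \<inter> S"
        unfolding bchoice_iff by (rule exE)
      then have \<D>: "\<And>S. S \<in> \<C> \<Longrightarrow> finite (\<D> S)" "\<And>S Z. S \<in> \<C> \<Longrightarrow> Z \<in> \<D> S \<Longrightarrow> irr Z"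
        "\<And>S. S \<in> \<C> \<Longrightarrow> \<Union>(\<D> S) = Z \<inter> S" by simp_all
      have "\<Union>(\<Union>(\<D> ` \<C>)) = (\<Union>S\<in>\<C>. \<Union>(\<D> S))" by blast
      also have "\<dots> = (\<Union>S\<in>\<C>. Z \<inter> S)" using \<D>(3) by simp
      also have "\<dots> = Z" using \<C>(3) by blast
      finally show ?thesis using \<C>(2) \<D>(1,2) by (intro exI[of _ "\<Union>(\<D> ` \<C>)"]) auto
    qed
  qed
  obtain \<C> where \<C>: "finite \<C>" "\<And>Z. Z \<in> \<C> \<Longrightarrow> irr Z" "\<Union>\<C> = G" using decomp[OF G(1)] by blast
  \<comment> \<open>The maximal members of an irreducible decomposition, i.e. the irreducible
    components of \<open>G\<close>.\<close>
  define \<D> where "\<D> = {S \<in> \<C>. \<forall>Y\<in>\<C>. S \<subseteq> Y \<longrightarrow> S = Y}"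
  have fin\<D>: "finite \<D>" and \<D>_irr: "\<And>Z. Z \<in> \<D> \<Longrightarrow> irr Z" and anti: "\<And>S Y. S \<in> \<D> \<Longrightarrow> Y \<in> \<D> \<Longrightarrow> S \<subseteq> Y \<Longrightarrow> S = Y"
    using \<C> by (auto simp: \<D>_def)
  have \<D>\<B>: "\<D> \<subseteq> \<B>" using \<D>_irr by (auto simp: irr_def)
  have \<D>G: "\<Union>\<D> = G"
  proof
    show "\<Union>\<D> \<subseteq> G" using \<C>(3) by (auto simp: \<D>_def)
    show "G \<subseteq> \<Union>\<D>"
    proof
      fix x assume "x \<in> G"
      then obtain S where S: "S \<in> \<C>" "x \<in> S" using \<C>(3) by blast
      from finite_has_maximal2[OF \<C>(1) S(1)] obtain M where "M \<in> \<C>" "S \<subseteq> M" "\<forall>Y\<in>\<C>. M \<subseteq> Y \<longrightarrow> M = Y"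
        by auto
      then show "x \<in> \<Union>\<D>" using S(2) by (auto simp: \<D>_def)
    qed
  qed
  from \<D>G G(2) obtain X0 where X0: "X0 \<in> \<D>" "X0 \<noteq> {}" by blast
  \<comment> \<open>A component is not covered by the others, by irreducibility with respect to
    finite covers; so \<open>g\<close> can be chosen on \<open>X0\<close> alone. Homogeneity will
    move any point \<open>h\<close> common to two components onto \<open>g\<close>.\<close>
  have "\<not> X0 \<subseteq> \<Union>(\<D> - {X0})"
  proof
    assume "X0 \<subseteq> \<Union>(\<D> - {X0})"
    then obtain Y where "Y \<in> \<D> - {X0}" "X0 \<subseteq> Y"
      using irrD[OF \<D>_irr[OF X0(1)], of "\<D> - {X0}"] \<D>\<B> fin\<D> by blast
    then show False using anti[OF X0(1)] by blast
  qed
  then obtain g where g: "g \<in> X0" "\<And>Y. Y \<in> \<D> \<Longrightarrow> g \<in> Y \<Longrightarrow> Y = X0" by blast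
  have gG: "g \<in> G" using g(1) X0(1) \<D>G by blast
  have disj: "X0 \<inter> \<Union>(\<D> - {X0}) = {}"
  proof (rule ccontr)
    assume "X0 \<inter> \<Union>(\<D> - {X0}) \<noteq> {}"
    then obtain h Y where Y: "h \<in> X0" "h \<in> Y" "Y \<in> \<D>" "Y \<noteq> X0" by blast
    then have hG: "h \<in> G" using \<D>G by blast
    from homog[OF gG hG] obtain \<tau> where \<tau>: "bij_betw \<tau> G G" "\<tau> h = g"
      "\<And>Z. Z \<in> \<B> \<Longrightarrow> \<tau> ` Z \<in> \<B>" "\<And>Z. Z \<in> \<B> \<Longrightarrow> G \<inter> \<tau> -` Z \<in> \<B>" by blast
    have \<tau>G: "\<tau> ` G = G" and inj: "inj_on \<tau> G" using \<tau>(1) by (auto simp: bij_betw_def)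
    have irr_im: "irr (\<tau> ` Z)" if "irr Z" for Z
    proof -
      have Z: "Z \<in> \<B>" using that by (simp add: irr_def)
      have "\<exists>S\<in>\<E>. \<tau> ` Z \<subseteq> S" if E: "\<E> \<subseteq> \<B>" "finite \<E>" "\<tau> ` Z \<subseteq> \<Union>\<E>" for \<E>
      proof -
        have "\<exists>S\<in>(\<lambda>S. G \<inter> \<tau> -` S) ` \<E>. Z \<subseteq> S"
        proof (rule irrD[OF \<open>irr Z\<close>])
          show "(\<lambda>S. G \<inter> \<tau> -` S) ` \<E> \<subseteq> \<B>" using E(1) \<tau>(4) by blast
          show "Z \<subseteq> \<Union>((\<lambda>S. G \<inter> \<tau> -` S) ` \<E>)" using E(3) sub[OF Z] by blast
        qed (use E(2) in simp)
        then show ?thesis by blast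
      qed
      then show ?thesis using \<tau>(3)[OF Z] by (simp add: irr_def)
    qed
    have irr_vim: "irr (G \<inter> \<tau> -` Z)" if "irr Z" for Z
    proof -
      have Z: "Z \<in> \<B>" using that by (simp add: irr_def)
      have im: "\<tau> ` (G \<inter> \<tau> -` Z) = Z" 
      proof
        show "Z \<subseteq> \<tau> ` (G \<inter> \<tau> -` Z)"
        proof
          fix z assume "z \<in> Z"
          with sub[OF Z] \<tau>G obtain y where "y \<in> G" "\<tau> y = z" by (metis imageE subsetD)
          with \<open>z \<in> Z\<close> show "z \<in> \<tau> ` (G \<inter> \<tau> -` Z)" by blast
        qed
      qed blast
      have "\<exists>S\<in>\<E>. G \<inter> \<tau> -` Z \<subseteq> S" if E: "\<E> \<subseteq> \<B>" "finite \<E>" "G \<inter> \<tau> -` Z \<subseteq> \<Union>\<E>" for \<E>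
      proof -
        have "\<tau> ` (G \<inter> \<tau> -` Z) \<subseteq> \<Union>((`) \<tau> ` \<E>)" using E(3) by blast
        then have Zsub: "Z \<subseteq> \<Union>((`) \<tau> ` \<E>)" unfolding im .
        have "(`) \<tau> ` \<E> \<subseteq> \<B>" using E(1) \<tau>(3) by blast
        from irrD[OF \<open>irr Z\<close> this finite_imageI[OF E(2)] Zsub]
        have "\<exists>S\<in>(`) \<tau> ` \<E>. Z \<subseteq> S" .
        then obtain S where S: "S \<in> \<E>" "Z \<subseteq> \<tau> ` S" by blast
        have "G \<inter> \<tau> -` Z \<subseteq> S"
        proof
          fix x assume x: "x \<in> G \<inter> \<tau> -` Z"
          then obtain y where "y \<in> S" "\<tau> x = \<tau> y" using S(2) by blast
          moreover have "y \<in> G" using sub S(1) E(1) \<open>y \<in> S\<close> by blast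
          ultimately show "x \<in> S" using inj x by (auto dest: inj_onD)
        qed
        then show ?thesis using S(1) by blast
      qed
      then show ?thesis using \<tau>(4)[OF Z] by (simp add: irr_def)
    qed
    \<comment> \<open>The image of a component through \<open>h\<close> is irreducible and contains
      \<open>g\<close>, and \<open>X0\<close> is the only component through
      \<open>g\<close>.\<close>
    have in_X0: "\<tau> ` W \<subseteq> X0" if W: "W \<in> \<D>" "h \<in> W" for W
    proof -
      have "\<tau> ` W \<subseteq> \<Union>\<D>" using W(1) \<D>G \<tau>G by blast
      from irrD[OF irr_im[OF \<D>_irr[OF W(1)]] \<D>\<B> fin\<D> this]
      obtain S' where "S' \<in> \<D>" "\<tau> ` W \<subseteq> S'" by blast
      moreover from this W(2) \<tau>(2) have "g \<in> S'" by blast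
      ultimately show ?thesis using g(2) by blast
    qed
    \<comment> \<open>The preimage of \<open>X0\<close> is irreducible as well, so a single
      component \<open>W\<close> contains it; but it contains both \<open>X0\<close> and
      \<open>Y\<close>.\<close>
    have "G \<inter> \<tau> -` X0 \<subseteq> \<Union>\<D>" using \<D>G by blast
    from irrD[OF irr_vim[OF \<D>_irr[OF X0(1)]] \<D>\<B> fin\<D> this]
    obtain W where W: "W \<in> \<D>" "G \<inter> \<tau> -` X0 \<subseteq> W" by blast
    have "X0 \<subseteq> W" "Y \<subseteq> W"
      using in_X0[OF X0(1) Y(1)] in_X0[OF Y(3,2)] W(2) \<D>G X0(1) Y(3) by blast+
    then show False using anti W(1) X0(1) Y(3,4) by metis
  qed
  have "G = X0 \<union> \<Union>(\<D> - {X0})" using \<D>G X0(1) by blast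
  then have "X0 = {} \<or> \<Union>(\<D> - {X0}) = {}"
    by (intro conn disj) (use fin\<D> \<D>\<B> X0(1) in auto)
  with X0(2) \<open>G = _\<close> have "X0 = G" by blast
  with \<D>_irr[OF X0(1)] have "irr G" by simp
  from irrD[OF this, of "{S, Y}"] XY have "G \<subseteq> S \<or> G \<subseteq> Y" by auto
  then show ?thesis using sub XY(1,2) by blast
qed

section \<open>Polynomial functions on matrices and Zariski closed sets\<close>

lemma mat_poly_eval_funalg:
  fixes M :: "'b \<Rightarrow> 'c::comm_ring_1^'n::finite^'n"
  assumes S: "funalg S" and M: "\<And>i j. (\<lambda>x. M x $ i $ j) \<in> S"
  shows "(\<lambda>x. mat_poly_eval h f (M x)) \<in> S"
  unfolding mat_poly_eval_def monom_eval_def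
  by (intro funalg_sum[OF S] funalg_mult[OF S] funalg_const[OF S] funalg_prod[OF S] funalg_power[OF S] M)

definition mat_poly_funs :: "('a::comm_ring_1^'n::finite^'n \<Rightarrow> 'a) set" where
  "mat_poly_funs = range (mat_poly_eval (\<lambda>x. x))"

lemma funalg_mat_poly_funs: "funalg (mat_poly_funs :: ('a::comm_ring_1^'n::finite^'n \<Rightarrow> 'a) set)"
  unfolding funalg_def
proof (intro conjI allI ballI)
  fix c :: 'a
  have "(\<lambda>_. c) = mat_poly_eval (\<lambda>x. x) (Poly_Mapping.single 0 c :: ('a, 'n) mat_poly)"
    by (auto simp: mat_poly_eval_single monom_eval_def)
  then show "(\<lambda>_. c) \<in> (mat_poly_funs :: ('a^'n^'n \<Rightarrow> 'a) set)" by (simp add: mat_poly_funs_def)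
next
  fix f g :: "'a^'n^'n \<Rightarrow> 'a" assume "f \<in> mat_poly_funs" "g \<in> mat_poly_funs"
  then obtain p r :: "('a, 'n) mat_poly" where "f = mat_poly_eval (\<lambda>x. x) p" "g = mat_poly_eval (\<lambda>x. x) r"
    by (auto simp: mat_poly_funs_def)
  then have "(\<lambda>x. f x + g x) = mat_poly_eval (\<lambda>x. x) (p + r)"
    and "(\<lambda>x. f x * g x) = mat_poly_eval (\<lambda>x. x) (p * r)"
    by (auto simp: mat_poly_eval_add mat_poly_eval_mult)
  then show "(\<lambda>x. f x + g x) \<in> mat_poly_funs" "(\<lambda>x. f x * g x) \<in> mat_poly_funs"
    by (simp_all add: mat_poly_funs_def)
qed

lemma mat_poly_funs_entry: "(\<lambda>A. A $ i $ j) \<in> (mat_poly_funs :: ('a::comm_ring_1^'n::finite^'n \<Rightarrow> 'a) set)"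
proof -
  have "monom_eval (Poly_Mapping.single (i, j) 1) A = A $ i $ j" for A :: "'a^'n^'n"
  proof -
    have *: "A $ a $ b ^ Poly_Mapping.lookup (Poly_Mapping.single (i, j) 1) (a, b) =
        (if b = j then if a = i then A $ a $ b else 1 else 1)" for a b
      by (auto simp: lookup_single when_def)
    have "monom_eval (Poly_Mapping.single (i, j) 1) A = (\<Prod>a\<in>UNIV. if a = i then A $ a $ j else 1)"
      unfolding monom_eval_def * by simp
    then show ?thesis by simp
  qed
  then have "(\<lambda>A :: 'a^'n^'n. A $ i $ j) =
      mat_poly_eval (\<lambda>x. x) (Poly_Mapping.single (Poly_Mapping.single (i, j) 1) 1)"
    by (auto simp: mat_poly_eval_single)
  then show ?thesis by (simp add: mat_poly_funs_def)
qed

text \<open>Affine substitutions keep the same bound \<open>d\<close>, not merely some bound. Hence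
  translations in the group act on the zero sets of polynomials of degree \<open>d\<close>.\<close>

lemma poly_funs_subst:
  fixes p :: "('v \<Rightarrow> 'a::field) \<Rightarrow> 'a"
  assumes p: "p \<in> poly_funs V d" and x: "\<And>v. v \<in> V \<Longrightarrow> (\<lambda>t. x t v) \<in> poly_funs W (Suc 0)"
  shows "(\<lambda>t. p (x t)) \<in> poly_funs W d"
proof -
  have m: "(\<lambda>t. monom_fun M (x t)) \<in> poly_funs W (size M)" if "set_mset M \<subseteq> V" for M
    using that
  proof (induction M)
    case empty
    show ?case using poly_funs_const[of 1] by (simp add: monom_fun_def)
  next
    case (add v M)
    then have "(\<lambda>t. x t v * monom_fun M (x t)) \<in> poly_funs W (Suc 0 + size M)"
      by (intro poly_funs_mult x) auto
    then show ?case by (simp add: monom_fun_def)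
  qed
  show ?thesis
    by (rule poly_funs_induct[OF p, where Q = "\<lambda>p. (\<lambda>t. p (x t)) \<in> poly_funs W d"])
      (rule poly_funs_mono[OF m], assumption+, rule poly_funs_zero, erule (1) poly_funs_add,
        erule poly_funs_scale)
qed

lemma (in vector_space) dim_strict_mono:
  assumes "subspace S" "S \<subset> T" "T \<subseteq> span W" "finite W"
  shows "dim S < dim T"
proof -
  obtain B where B: "B \<subseteq> S" "independent B" "S \<subseteq> span B" using maximal_independent_subset by metis
  then obtain C where C: "B \<subseteq> C" "C \<subseteq> T" "independent C" "T \<subseteq> span C"
    using maximal_independent_subset_extend[of B T] assms(2) by blast
  have "finite C" using independent_span_bound[OF assms(4) C(3)] C(2) assms(3) by blast
  have "span B \<subseteq> S" using span_minimal[OF B(1) assms(1)] .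
  then have "B \<noteq> C" using C(4) assms(2) by blast
  then have "card B < card C" using C(1) \<open>finite C\<close> by (simp add: psubset_card_mono psubset_eq)
  then show ?thesis using basis_card_eq_dim[OF B(1,3,2)] basis_card_eq_dim[OF C(2,4,3)] by simp
qed

definition entries :: "'a^'n^'n \<Rightarrow> 'n \<times> 'n \<Rightarrow> 'a" where
  "entries A = (\<lambda>(i, j). A $ i $ j)"

text \<open>Links the formal polynomials behind the Zariski topology with the spaces filtered by
  degree, in which dimensions can be counted.\<close>

lemma mat_poly_funs_iff:
  "f \<in> (mat_poly_funs :: ('a::field^'n::finite^'n \<Rightarrow> 'a) set) \<longleftrightarrow>
     (\<exists>d. \<exists>p\<in>poly_funs UNIV d. f = (\<lambda>A. p (entries A)))"
proof
  assume "f \<in> mat_poly_funs"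
  then obtain r where r: "f = mat_poly_eval (\<lambda>x. x) r" by (auto simp: mat_poly_funs_def)
  have "(\<lambda>x. mat_poly_eval (\<lambda>x. x) r (\<chi> i j. x (i, j))) \<in> (\<Union>d. poly_funs UNIV d)"
    by (rule mat_poly_eval_funalg[OF funalg_poly_funs], unfold vec_lambda_beta)
      (rule UN_I[OF UNIV_I], rule poly_funs_var, simp)
  then obtain d where d: "(\<lambda>x. mat_poly_eval (\<lambda>x. x) r (\<chi> i j. x (i, j))) \<in> poly_funs UNIV d" by blast
  show "\<exists>d. \<exists>p\<in>poly_funs UNIV d. f = (\<lambda>A. p (entries A))"
    by (rule exI, rule bexI[OF _ d]) (simp add: r entries_def fun_eq_iff)
next
  assume "\<exists>d. \<exists>p\<in>poly_funs UNIV d. f = (\<lambda>A. p (entries A))"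
  then obtain d p where p: "p \<in> poly_funs UNIV d" "f = (\<lambda>A. p (entries A))" by blast
  show "f \<in> mat_poly_funs" unfolding p(2)
    by (rule poly_funs_funalg[OF funalg_mat_poly_funs _ p(1)])
      (simp add: entries_def case_prod_beta mat_poly_funs_entry)
qed

lemma closedin_zariski_zeros:
  assumes "E \<subseteq> mat_poly_funs"
  shows "closedin zariski_topology {A. \<forall>f\<in>E. f A = 0}"
proof -
  define S where "S = {r. mat_poly_eval (\<lambda>x. x) r \<in> E}"
  have "E = mat_poly_eval (\<lambda>x. x) ` S" using assms by (auto simp: S_def mat_poly_funs_def)
  then have "UNIV - {A. \<forall>f\<in>E. f A = 0} = {A. \<exists>r\<in>S. mat_poly_eval (\<lambda>x. x) r A \<noteq> 0}" by auto
  then show ?thesis unfolding closedin_def openin_zariski by auto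
qed

lemma group_GL: "group (GL_group :: ('a::field^'n::finite^'n) monoid)"
proof (rule groupI)
  fix A B :: "'a^'n^'n" assume "A \<in> carrier GL_group" "B \<in> carrier GL_group"
  then show "A \<otimes>\<^bsub>GL_group\<^esub> B \<in> carrier GL_group" by (simp add: GL_group_def invertible_mult)
next
  fix A :: "'a^'n^'n" assume "A \<in> carrier GL_group"
  then have "invertible A" by (simp add: GL_group_def)
  then obtain B where "A ** B = mat 1" "B ** A = mat 1" by (auto simp: invertible_def)
  then show "\<exists>B\<in>carrier GL_group. B \<otimes>\<^bsub>GL_group\<^esub> A = \<one>\<^bsub>GL_group\<^esub>"
    by (intro bexI[of _ B]) (auto simp: GL_group_def invertible_def)
qed (auto simp: GL_group_def matrix_mul_assoc invertible_def intro: exI[of _ "mat 1"])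

lemma
  assumes "subgroup G (GL_group :: ('a::field^'n::finite^'n) monoid)"
  shows subgroup_GL_one: "mat 1 \<in> G"
    and subgroup_GL_mult: "A \<in> G \<Longrightarrow> B \<in> G \<Longrightarrow> A ** B \<in> G"
    and subgroup_GL_inv: "A \<in> G \<Longrightarrow> \<exists>B\<in>G. A ** B = mat 1 \<and> B ** A = mat 1"
    and subgroup_GL_invertible: "A \<in> G \<Longrightarrow> invertible A"
proof -
  interpret group "GL_group :: ('a^'n^'n) monoid" by (rule group_GL)
  show "mat 1 \<in> G" using subgroup.one_closed[OF assms] by (simp add: GL_group_def)
  show "A ** B \<in> G" if "A \<in> G" "B \<in> G" using subgroup.m_closed[OF assms that] by (simp add: GL_group_def)
  show "invertible A" if "A \<in> G" using subgroup.mem_carrier[OF assms that] by (simp add: GL_group_def)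
  show "\<exists>B\<in>G. A ** B = mat 1 \<and> B ** A = mat 1" if "A \<in> G"
    using subgroup.m_inv_closed[OF assms that] l_inv[OF subgroup.mem_carrier[OF assms that]]
      r_inv[OF subgroup.mem_carrier[OF assms that]] by (auto simp: GL_group_def)
qed

text \<open>
  Applied to the zero sets of polynomials of a fixed degree \<open>d\<close>: these are permuted by translations,
  and they satisfy the descending chain condition because the polynomials of degree \<open>d\<close> form a finite
  dimensional space. This replaces Hilbert's basis theorem.
\<close>

lemma connected_group_irreducible:
  fixes G :: "('a::alg_closed_field^'n::finite^'n) set"
  assumes G: "subgroup G GL_group" and conn: "connectedin zariski_topology G"
    and fg: "f \<in> mat_poly_funs" "g \<in> mat_poly_funs" "\<And>A. A \<in> G \<Longrightarrow> f A * g A = 0"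
  shows "(\<forall>A\<in>G. f A = 0) \<or> (\<forall>A\<in>G. g A = 0)"
proof -
  obtain df dg p r where p: "p \<in> poly_funs UNIV df" "f = (\<lambda>A. p (entries A))"
    and r: "r \<in> poly_funs UNIV dg" "g = (\<lambda>A. r (entries A))"
    using fg(1,2) unfolding mat_poly_funs_iff by blast
  define d where "d = max df dg"
  define \<P> where "\<P> = (poly_funs UNIV d :: (('n \<times> 'n \<Rightarrow> 'a) \<Rightarrow> 'a) set)"
  define zr where "zr E = {A \<in> G. \<forall>p\<in>E. p (entries A) = 0}" for E :: "(('n \<times> 'n \<Rightarrow> 'a) \<Rightarrow> 'a) set"
  define vi where "vi Z = {p \<in> \<P>. \<forall>A\<in>Z. p (entries A) = 0}" for Z
  define \<B> where "\<B> = zr ` Pow \<P>"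
  have vi_sub: "fun_space.subspace (vi Z)" for Z
    unfolding vi_def \<P>_def
    by (rule subspace_funI) (simp_all add: poly_funs_zero poly_funs_add poly_funs_scale)
  \<comment> \<open>\<open>zr\<close> and \<open>vi\<close> form a Galois connection, so a member of
    \<open>\<B>\<close> is recovered from its equations of degree \<open>d\<close>, and a strict
    inclusion shows in the dimension of \<open>vi\<close>.\<close>
  have zr_vi: "zr (vi Z) = Z" if "Z \<in> \<B>" for Z
  proof -
    from that obtain E where E: "E \<subseteq> \<P>" "Z = zr E" by (auto simp: \<B>_def)
    have "E \<subseteq> vi Z" using E(1) by (auto simp: vi_def E(2) zr_def)
    then have "zr (vi Z) \<subseteq> zr E" by (auto simp: zr_def)
    moreover have "zr E \<subseteq> zr (vi Z)" by (auto simp: E(2) zr_def vi_def)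
    ultimately show ?thesis using E(2) by blast
  qed
  have finW: "finite {M. set_mset M \<subseteq> (UNIV :: ('n \<times> 'n) set) \<and> size M \<le> d}"
    by (rule monom_count_bound) simp
  have \<P>_span: "\<P> \<subseteq> fun_space.span (monom_fun ` {M. set_mset M \<subseteq> UNIV \<and> size M \<le> d})"
    by (simp add: \<P>_def poly_funs_def)
  have dimP: "fun_space.dim (vi Z) \<le> card (monom_fun ` {M. set_mset M \<subseteq> UNIV \<and> size M \<le> d} ::
     (('n \<times> 'n \<Rightarrow> 'a) \<Rightarrow> 'a) set)" (is "_ \<le> ?D") for Z
    by (rule fun_space.dim_le_card) (use \<P>_span finW in \<open>auto simp: vi_def\<close>)
  have vi_strict: "fun_space.dim (vi Y) < fun_space.dim (vi Z)" if "Z \<in> \<B>" "Y \<in> \<B>" "Z \<subset> Y" for Y Z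
  proof (rule fun_space.dim_strict_mono[OF vi_sub])
    show "vi Y \<subset> vi Z"
    proof
      show "vi Y \<subseteq> vi Z" using that(3) by (auto simp: vi_def)
      show "vi Y \<noteq> vi Z"
      proof
        assume "vi Y = vi Z"
        then have "zr (vi Y) = zr (vi Z)" by simp
        then show False using that(3) by (simp add: zr_vi that(1,2))
      qed
    qed
    show "vi Z \<subseteq> fun_space.span (monom_fun ` {M. set_mset M \<subseteq> UNIV \<and> size M \<le> d})"
      using \<P>_span by (auto simp: vi_def)
  qed (use finW in simp)
  \<comment> \<open>Smaller sets have more equations, so the measure subtracts
    \<open>dim (vi Z)\<close> from an upper bound; \<open>dimP\<close> guarantees that this natural
    subtraction does not truncate.\<close>
  have "zr {p} = G \<or> zr {r} = G"
  proof (rule homogeneous_connected_irreducible[where \<B> = \<B> and \<mu> = "\<lambda>Z. ?D - fun_space.dim (vi Z)" and G = G])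
    show "Z \<subseteq> G" if "Z \<in> \<B>" for Z using that by (auto simp: \<B>_def zr_def)
    show "G \<in> \<B>" unfolding \<B>_def by (rule image_eqI[of _ _ "{}"]) (auto simp: zr_def)
    show "G \<noteq> {}" using subgroup_GL_one[OF G] by blast
    show "Y \<inter> Z \<in> \<B>" if "Y \<in> \<B>" "Z \<in> \<B>" for Y Z
    proof -
      from that obtain E E' where "Y = zr E" "Z = zr E'" "E \<subseteq> \<P>" "E' \<subseteq> \<P>" by (auto simp: \<B>_def)
      then show ?thesis unfolding \<B>_def by (intro image_eqI[of _ _ "E \<union> E'"]) (auto simp: zr_def)
    qed
    show "?D - fun_space.dim (vi Z) < ?D - fun_space.dim (vi Y)" if "Z \<in> \<B>" "Y \<in> \<B>" "Z \<subset> Y" for Y Z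
      using vi_strict[OF that] dimP[of Z] by simp
    show "\<exists>\<tau>. bij_betw \<tau> G G \<and> \<tau> h = g \<and> (\<forall>Z\<in>\<B>. \<tau> ` Z \<in> \<B> \<and> G \<inter> \<tau> -` Z \<in> \<B>)"
      if gh: "g \<in> G" "h \<in> G" for g h
    proof -
      have pre: "G \<inter> (**) c -` Z \<in> \<B>" if c: "c \<in> G" and Z: "Z \<in> \<B>" for c Z
      proof -
        from Z obtain E where E: "Z = zr E" "E \<subseteq> \<P>" by (auto simp: \<B>_def)
        define tr where "tr p = (\<lambda>x. p (entries (c ** (\<chi> i j. x (i, j)))))" for p :: "('n \<times> 'n \<Rightarrow> 'a) \<Rightarrow> 'a"
        have "tr p \<in> \<P>" if "p \<in> E" for p
          unfolding tr_def \<P>_def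
        proof (rule poly_funs_subst[where p = p and V = UNIV and x = "\<lambda>x. entries (c ** (\<chi> i j. x (i, j)))"])
          show "p \<in> poly_funs UNIV d" using that E(2) by (auto simp: \<P>_def)
          fix v :: "'n \<times> 'n"
          show "(\<lambda>x. entries (c ** (\<chi> i j. x (i, j))) v) \<in> poly_funs UNIV (Suc 0)"
            unfolding entries_def matrix_matrix_mult_def case_prod_beta vec_lambda_beta
            by (intro poly_funs_sum poly_funs_scale poly_funs_var) simp
        qed
        moreover have "G \<inter> (**) c -` Z = zr (tr ` E)"
        proof -
          have "tr p (entries A) = p (entries (c ** A))" for p A by (simp add: tr_def entries_def)
          then show ?thesis using subgroup_GL_mult[OF G c] by (auto simp: E(1) zr_def)
        qed
        ultimately show ?thesis unfolding \<B>_def by (intro image_eqI[of _ _ "tr ` E"]) auto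
      qed
      obtain h' where h': "h' \<in> G" "h ** h' = mat 1" "h' ** h = mat 1" using subgroup_GL_inv[OF G gh(2)] by blast
      obtain g' where g': "g' \<in> G" "g ** g' = mat 1" "g' ** g = mat 1" using subgroup_GL_inv[OF G gh(1)] by blast
      \<comment> \<open>Translation by \<open>g h^-1\<close> takes \<open>h\<close> to
        \<open>g\<close>. Images under it are preimages under the inverse translation, so treating
        preimages is enough.\<close>
      define c where "c = g ** h'"
      define c' where "c' = h ** g'"
      have cG: "c \<in> G" "c' \<in> G" unfolding c_def c'_def by (intro subgroup_GL_mult[OF G] gh g'(1) h'(1))+
      have "g ** (h' ** h) ** g' = mat 1" "h ** (g' ** g) ** h' = mat 1" by (simp_all add: h' g')
      then have cc': "c ** c' = mat 1" "c' ** c = mat 1" by (simp_all add: c_def c'_def matrix_mul_assoc)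
      have 1: "c ** (c' ** A) = A" "c' ** (c ** A) = A" for A :: "'a^'n^'n"
        by (simp_all add: matrix_mul_assoc cc')
      show ?thesis
      proof (intro exI[of _ "(**) c"] conjI ballI)
        show "bij_betw ((**) c) G G"
          by (rule bij_betw_byWitness[of _ "(**) c'"]) (auto simp: 1 intro: subgroup_GL_mult[OF G] cG)
        show "c ** h = g" unfolding c_def by (simp add: matrix_mul_assoc[symmetric] h')
        fix Z assume Z: "Z \<in> \<B>"
        have "(**) c ` Z = G \<inter> (**) c' -` Z"
        proof
          show "(**) c ` Z \<subseteq> G \<inter> (**) c' -` Z"
            using Z by (auto simp: 1 \<B>_def zr_def intro: subgroup_GL_mult[OF G cG(1)])
          show "G \<inter> (**) c' -` Z \<subseteq> (**) c ` Z"
          proof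
            fix A assume "A \<in> G \<inter> (**) c' -` Z"
            then show "A \<in> (**) c ` Z" by (intro image_eqI[of _ _ "c' ** A"]) (simp_all add: 1)
          qed
        qed
        then show "(**) c ` Z \<in> \<B>" using pre[OF cG(2) Z] by simp
        show "G \<inter> (**) c -` Z \<in> \<B>" by (rule pre[OF cG(1) Z])
      qed
    qed
    show "Z = {} \<or> \<Union>\<C> = {}"
      if C: "finite \<C>" "\<C> \<subseteq> \<B>" "Z \<in> \<B>" "G = Z \<union> \<Union>\<C>" "Z \<inter> \<Union>\<C> = {}" for \<C> Z
    proof -
      have cl: "\<exists>E. closedin zariski_topology E \<and> Y = G \<inter> E" if "Y \<in> \<B>" for Y
      proof -
        from that obtain E where E: "Y = zr E" "E \<subseteq> \<P>" by (auto simp: \<B>_def)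
        have "closedin zariski_topology {A. \<forall>f\<in>(\<lambda>p A. p (entries A)) ` E. f A = 0}"
        proof (rule closedin_zariski_zeros, rule image_subsetI)
          fix p assume "p \<in> E"
          then have "p \<in> poly_funs UNIV d" using E(2) by (auto simp: \<P>_def)
          then show "(\<lambda>A. p (entries A)) \<in> mat_poly_funs"
            unfolding mat_poly_funs_iff by (intro exI[of _ d] bexI[of _ p] refl)
        qed
        moreover have "Y = G \<inter> {A. \<forall>f\<in>(\<lambda>p A. p (entries A)) ` E. f A = 0}" by (auto simp: E zr_def)
        ultimately show ?thesis by blast
      qed
      from C(1,2) have "\<exists>E. closedin zariski_topology E \<and> \<Union>\<C> = G \<inter> E"
      proof (induction \<C> rule: finite_induct)
        case empty
        then show ?case by (intro exI[of _ "{}"]) simp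
      next
        case (insert Y \<C>)
        from insert.prems have "Y \<in> \<B>" "\<C> \<subseteq> \<B>" by simp_all
        from cl[OF this(1)] obtain E' where "closedin zariski_topology E'" "Y = G \<inter> E'" by (elim exE conjE)
        moreover from insert.IH[OF \<open>\<C> \<subseteq> \<B>\<close>]
        obtain E where "closedin zariski_topology E" "\<Union>\<C> = G \<inter> E" by (elim exE conjE)
        ultimately
        show ?case by (intro exI[of _ "E' \<union> E"] conjI closedin_Un) (simp_all add: Int_Un_distrib)
      qed
      then obtain E2 where E2: "closedin zariski_topology E2" "\<Union>\<C> = G \<inter> E2" by (elim exE conjE)
      from cl[OF C(3)] obtain E1 where E1: "closedin zariski_topology E1" "Z = G \<inter> E1" by (elim exE conjE)
      have cover: "G \<subseteq> E1 \<union> E2" "E1 \<inter> E2 \<inter> G = {}"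
        using C(4,5) unfolding E1(2) E2(2) by blast+
      from conn have "\<not> (\<exists>E1 E2. closedin zariski_topology E1 \<and> closedin zariski_topology E2 \<and>
          G \<subseteq> E1 \<union> E2 \<and> E1 \<inter> E2 \<inter> G = {} \<and> E1 \<inter> G \<noteq> {} \<and> E2 \<inter> G \<noteq> {})"
        unfolding connectedin_closedin by (rule conjunct2)
      then have "\<not> (E1 \<inter> G \<noteq> {} \<and> E2 \<inter> G \<noteq> {})"
        by (rule contrapos_nn) (intro exI[of _ E1] exI[of _ E2] conjI E1(1) E2(1) cover; simp)
      then show ?thesis unfolding E1(2) E2(2) by (simp add: Int_commute)
    qed
    have "p \<in> \<P>" "r \<in> \<P>"
      using poly_funs_mono[OF p(1)] poly_funs_mono[OF r(1)] by (simp_all add: \<P>_def d_def)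
    then show "zr {p} \<in> \<B>" "zr {r} \<in> \<B>" unfolding \<B>_def by blast+
    show "G \<subseteq> zr {p} \<union> zr {r}" using fg(3) by (auto simp: zr_def p(2) r(2))
  qed
  then show ?thesis unfolding zr_def p(2) r(2) by blast
qed

section \<open>The group of arcs\<close>

definition map_mat :: "('a \<Rightarrow> 'b) \<Rightarrow> 'a^'n^'m \<Rightarrow> 'b^'n^'m" where
  "map_mat h A = (\<chi> i j. h (A $ i $ j))"

lemma map_mat_nth [simp]: "map_mat h A $ i $ j = h (A $ i $ j)"
  by (simp add: map_mat_def)

text \<open>Relative to a subset because reduction is defined on the valuation ring only. Taking the
  identity for \<open>\<theta>\<close> expresses that \<open>R\<close> contains 0 and 1 and is
  closed under sums and products.\<close>

definition ring_hom_on :: "'a::comm_ring_1 set \<Rightarrow> ('a \<Rightarrow> 'b::comm_ring_1) \<Rightarrow> bool" where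
  "ring_hom_on R \<theta> \<longleftrightarrow> 0 \<in> R \<and> 1 \<in> R \<and> \<theta> 0 = 0 \<and> \<theta> 1 = 1 \<and>
     (\<forall>x\<in>R. \<forall>y\<in>R. x + y \<in> R \<and> x * y \<in> R \<and> \<theta> (x + y) = \<theta> x + \<theta> y \<and> \<theta> (x * y) = \<theta> x * \<theta> y)"

lemma ring_hom_onI:
  assumes "\<theta> 0 = 0" "\<theta> 1 = 1" "\<And>x y. \<theta> (x + y) = \<theta> x + \<theta> y" "\<And>x y. \<theta> (x * y) = \<theta> x * \<theta> y"
  shows "ring_hom_on UNIV \<theta>"
  using assms by (simp add: ring_hom_on_def)

context
  fixes R :: "'a::comm_ring_1 set" and \<theta> :: "'a \<Rightarrow> 'b::comm_ring_1"
  assumes \<theta>: "ring_hom_on R \<theta>"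
begin

lemma ring_hom_on_basic:
  shows "0 \<in> R" "1 \<in> R" "\<theta> 0 = 0" "\<theta> 1 = 1"
    and "x \<in> R \<Longrightarrow> y \<in> R \<Longrightarrow> x + y \<in> R" "x \<in> R \<Longrightarrow> y \<in> R \<Longrightarrow> x * y \<in> R"
    and "x \<in> R \<Longrightarrow> y \<in> R \<Longrightarrow> \<theta> (x + y) = \<theta> x + \<theta> y" "x \<in> R \<Longrightarrow> y \<in> R \<Longrightarrow> \<theta> (x * y) = \<theta> x * \<theta> y"
  using \<theta> by (auto simp: ring_hom_on_def)

lemma ring_hom_on_power: "x \<in> R \<Longrightarrow> x ^ n \<in> R \<and> \<theta> (x ^ n) = \<theta> x ^ n"
  by (induction n) (simp_all add: ring_hom_on_basic)

lemma ring_hom_on_prod: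
  "(\<And>i. i \<in> I \<Longrightarrow> f i \<in> R) \<Longrightarrow> prod f I \<in> R \<and> \<theta> (prod f I) = (\<Prod>i\<in>I. \<theta> (f i))"
  by (induction I rule: infinite_finite_induct) (simp_all add: ring_hom_on_basic)

lemma ring_hom_on_sum:
  "(\<And>i. i \<in> I \<Longrightarrow> f i \<in> R) \<Longrightarrow> sum f I \<in> R \<and> \<theta> (sum f I) = (\<Sum>i\<in>I. \<theta> (f i))"
  by (induction I rule: infinite_finite_induct) (simp_all add: ring_hom_on_basic)

lemma mat_poly_eval_hom:
  assumes h: "\<And>m. h (Poly_Mapping.lookup f m) \<in> R" and A: "A \<in> mat_over R"
  shows "\<theta> (mat_poly_eval h f A) = mat_poly_eval (\<lambda>x. \<theta> (h x)) f (map_mat \<theta> A)"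
proof -
  have A': "A $ i $ j \<in> R" for i j using A by (simp add: mat_over_def)
  have p: "A $ i $ j ^ k \<in> R" "\<theta> (A $ i $ j ^ k) = \<theta> (A $ i $ j) ^ k" for i j k
    using ring_hom_on_power[OF A'] by auto
  have 1: "(\<Prod>j\<in>UNIV. A $ i $ j ^ Poly_Mapping.lookup m (i, j)) \<in> R"
    "\<theta> (\<Prod>j\<in>UNIV. A $ i $ j ^ Poly_Mapping.lookup m (i, j)) =
      (\<Prod>j\<in>UNIV. \<theta> (A $ i $ j) ^ Poly_Mapping.lookup m (i, j))" for i m
    using ring_hom_on_prod[of UNIV "\<lambda>j. A $ i $ j ^ Poly_Mapping.lookup m (i, j)"] p by auto
  have 2: "monom_eval m A \<in> R" "\<theta> (monom_eval m A) = monom_eval m (map_mat \<theta> A)" for m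
    using ring_hom_on_prod[of UNIV "\<lambda>i. \<Prod>j\<in>UNIV. A $ i $ j ^ Poly_Mapping.lookup m (i, j)"] 1
    by (auto simp: monom_eval_def)
  show ?thesis unfolding mat_poly_eval_def
    using ring_hom_on_sum[of "Poly_Mapping.keys f" "\<lambda>m. h (Poly_Mapping.lookup f m) * monom_eval m A"]
    by (simp add: ring_hom_on_basic h 2)
qed

lemma map_mat_mult:
  assumes "A \<in> mat_over R" "B \<in> mat_over R"
  shows "A ** B \<in> mat_over R" "map_mat \<theta> (A ** B) = map_mat \<theta> A ** map_mat \<theta> B"
proof -
  have AB: "A $ i $ j \<in> R" "B $ i $ j \<in> R" for i j using assms by (simp_all add: mat_over_def)
  have *: "(\<Sum>k\<in>UNIV. A $ i $ k * B $ k $ j) \<in> R \<and> \<theta> (\<Sum>k\<in>UNIV. A $ i $ k * B $ k $ j) =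
      (\<Sum>k\<in>UNIV. \<theta> (A $ i $ k) * \<theta> (B $ k $ j))" for i j
    using ring_hom_on_sum[of UNIV "\<lambda>k. A $ i $ k * B $ k $ j"] by (simp add: ring_hom_on_basic AB)
  show "A ** B \<in> mat_over R" "map_mat \<theta> (A ** B) = map_mat \<theta> A ** map_mat \<theta> B"
    using * by (simp_all add: mat_over_def matrix_matrix_mult_def map_mat_def)
qed

lemma map_mat_1: "map_mat \<theta> (mat 1) = mat 1"
  by (simp add: map_mat_def mat_def vec_eq_iff ring_hom_on_basic)

end

lemma mat_over_UNIV [simp]: "A \<in> mat_over UNIV"
  by (simp add: mat_over_def)

lemma map_mat_invertible:
  fixes A :: "'a::comm_ring_1^'n::finite^'n" and \<theta> :: "'a \<Rightarrow> 'b::comm_ring_1"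
  assumes "ring_hom_on UNIV \<theta>" "invertible A"
  shows "invertible (map_mat \<theta> A)"
proof -
  obtain B where "A ** B = mat 1" "B ** A = mat 1" using assms(2) by (auto simp: invertible_def)
  then have "map_mat \<theta> A ** map_mat \<theta> B = mat 1" "map_mat \<theta> B ** map_mat \<theta> A = mat 1"
    by (simp_all add: map_mat_mult(2)[OF assms(1), symmetric] map_mat_1[OF assms(1)])
  then show ?thesis by (auto simp: invertible_def)
qed

lemma hom_fps_const: "ring_hom_on UNIV (fps_const :: 'a::comm_ring_1 \<Rightarrow> 'a fps)"
  by (rule ring_hom_onI) simp_all

lemma det_replace_row:
  fixes r :: "'n::finite \<Rightarrow> 'a::comm_ring_1"
  shows "det (\<chi> a b. if a = i then r b else if a = b then 1 else 0) = r i"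
proof -
  let ?Z = "\<chi> a b. if a = i then r b else if a = b then 1 else (0 :: 'a)"
  have "det ?Z = (\<Sum>p\<in>{id}. of_int (sign p) * (\<Prod>a\<in>UNIV. ?Z $ a $ p a))"
    unfolding det_def
  proof (rule sum.mono_neutral_right)
    show "finite {p. p permutes (UNIV :: 'n set)}" by (simp add: finite_permutations)
    show "{id} \<subseteq> {p. p permutes (UNIV :: 'n set)}" by (simp add: permutes_id)
    show "\<forall>p\<in>{p. p permutes UNIV} - {id}. of_int (sign p) * (\<Prod>a\<in>UNIV. ?Z $ a $ p a) = 0"
    proof
      fix p :: "'n \<Rightarrow> 'n" assume p: "p \<in> {p. p permutes UNIV} - {id}"
      have "\<exists>a. a \<noteq> i \<and> p a \<noteq> a"
      proof (rule ccontr)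
        assume "\<not> ?thesis"
        then have fx: "p a = a" if "a \<noteq> i" for a using that by blast
        have "inj p" using p by (auto intro: permutes_inj)
        then have "p i = i" using fx by (metis injD)
        with fx have "p x = x" for x by (cases "x = i") simp_all
        then have "p = id" by (simp add: fun_eq_iff)
        with p show False by simp
      qed
      then obtain a where "a \<noteq> i" "p a \<noteq> a" by blast
      then have "(\<Prod>a\<in>UNIV. ?Z $ a $ p a) = 0" by (intro prod_zero bexI[of _ a]) auto
      then show "of_int (sign p) * (\<Prod>a\<in>UNIV. ?Z $ a $ p a) = 0" by simp
    qed
  qed
  also have "\<dots> = (\<Prod>a\<in>UNIV. if a = i then r i else 1)"
  proof -
    have "(\<Prod>a\<in>UNIV. ?Z $ a $ a) = (\<Prod>a\<in>UNIV. if a = i then r i else 1)" by (rule prod.cong) auto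
    then show ?thesis by (simp add: sign_id)
  qed
  also have "\<dots> = r i" by simp
  finally show ?thesis .
qed

text \<open>Cramer's rule: left multiplication by the identity matrix with row \<open>j\<close>
  replaced by row \<open>i\<close> of \<open>B\<close> puts row \<open>i\<close> of
  \<open>B ** A = mat 1\<close> in place of row \<open>j\<close> of \<open>A\<close>. Compare
  determinants.\<close>

lemma inverse_entry_det:
  fixes A B :: "'a::comm_ring_1^'n::finite^'n"
  assumes "B ** A = mat 1"
  shows "B $ i $ j * det A = det (\<chi> a b. if a = j then if b = i then 1 else 0 else A $ a $ b)"
proof -
  let ?Z = "\<chi> a b. if a = j then B $ i $ b else if a = b then 1 else (0 :: 'a)"
  have BA: "(\<Sum>k\<in>UNIV. B $ i $ k * A $ k $ b) = (if b = i then 1 else 0)" for b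
  proof -
    have "(B ** A) $ i $ b = mat 1 $ i $ b" using assms by simp
    then show ?thesis by (auto simp: matrix_matrix_mult_def mat_def)
  qed
  have "?Z ** A = (\<chi> a b. if a = j then if b = i then 1 else 0 else A $ a $ b)"
    by (simp add: vec_eq_iff matrix_matrix_mult_def BA if_distrib[of "\<lambda>x. x * _"] cong: if_cong)
  then show ?thesis using det_replace_row[of j "\<lambda>b. B $ i $ b"] det_mul[of ?Z A] by simp
qed

text \<open>The \<open>K[[t]]\<close>-points of \<open>G\<close>, tested against the whole vanishing
  ideal over \<open>K\<close>; \<open>vanishing_ideal_defined_over\<close> reduces membership to the
  equations over \<open>F\<close>.\<close>

definition arcs :: "('a::field^'n::finite^'n) set \<Rightarrow> ('a fps^'n^'n) set" where
  "arcs G = {A. invertible A \<and> (\<forall>f\<in>vanishing_ideal G. mat_poly_eval fps_const f A = 0)}"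

text \<open>A polynomial over \<open>K[[t]]\<close> is split by powers of \<open>t\<close> in its
  coefficients into polynomials over \<open>K\<close>, to which the vanishing ideal applies.\<close>

lemma fps_nth_mat_poly_eval:
  fixes p :: "('a::field fps, 'n::finite) mat_poly"
  shows "fps_nth (mat_poly_eval (\<lambda>x. x) p A) k =
    (\<Sum>i\<le>k. fps_nth (mat_poly_eval fps_const (Poly_Mapping.map (\<lambda>c. fps_nth c i) p) A) (k - i))"
proof -
  have "mat_poly_eval fps_const (Poly_Mapping.map (\<lambda>c. fps_nth c i) p) A =
      (\<Sum>m\<in>Poly_Mapping.keys p. fps_const (fps_nth (Poly_Mapping.lookup p m) i) * monom_eval m A)" for i
    by (subst mat_poly_eval_superset[where S = "Poly_Mapping.keys p"])
      (auto simp: in_keys_iff Poly_Mapping.map.rep_eq when_def intro!: sum.cong)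
  then have "(\<Sum>i\<le>k. fps_nth (mat_poly_eval fps_const (Poly_Mapping.map (\<lambda>c. fps_nth c i) p) A) (k - i)) =
      (\<Sum>i\<le>k. \<Sum>m\<in>Poly_Mapping.keys p. fps_nth (Poly_Mapping.lookup p m) i * fps_nth (monom_eval m A) (k - i))"
    by (simp add: fps_sum_nth)
  also have "\<dots> = (\<Sum>m\<in>Poly_Mapping.keys p. \<Sum>i\<le>k. fps_nth (Poly_Mapping.lookup p m) i * fps_nth (monom_eval m A) (k - i))"
    by (rule sum.swap)
  also have "\<dots> = fps_nth (mat_poly_eval (\<lambda>x. x) p A) k"
    by (simp add: mat_poly_eval_def fps_sum_nth fps_mult_nth atLeast0AtMost)
  finally show ?thesis by simp
qed

lemma mat_poly_eval_const:
  "mat_poly_eval fps_const f (map_mat fps_const a) = fps_const (mat_poly_eval (\<lambda>x. x) f a)"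
  using mat_poly_eval_hom[OF hom_fps_const, of "\<lambda>x. x" f a] by simp

text \<open>
  Equations over \<open>K[[t]]\<close> that hold on \<open>G(K)\<close> hold on \<open>G(K[[t]])\<close>: compare the coefficients of each power
  of \<open>t\<close>.
\<close>

lemma arcs_eqs:
  fixes A :: "'a::field fps^'n::finite^'n"
  assumes A: "A \<in> arcs G" and \<Phi>: "\<Phi> \<in> mat_poly_funs" "\<And>a. a \<in> G \<Longrightarrow> \<Phi> (map_mat fps_const a) = 0"
  shows "\<Phi> A = 0"
proof -
  obtain p where p: "\<Phi> = mat_poly_eval (\<lambda>x. x) p" using \<Phi>(1) by (auto simp: mat_poly_funs_def)
  let ?p = "\<lambda>i. Poly_Mapping.map (\<lambda>c. fps_nth c i) p"
  have "?p i \<in> vanishing_ideal G" for i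
    unfolding vanishing_ideal_def
  proof (intro CollectI ballI)
    fix a assume a: "a \<in> G"
    have "0 = fps_nth (mat_poly_eval (\<lambda>x. x) p (map_mat fps_const a)) i" using \<Phi>(2)[OF a] by (simp add: p)
    also have "\<dots> = (\<Sum>k\<le>i. if k = i then mat_poly_eval (\<lambda>x. x) (?p k) a else 0)"
      unfolding fps_nth_mat_poly_eval mat_poly_eval_const by (rule sum.cong) auto
    finally show "mat_poly_eval (\<lambda>x. x) (?p i) a = 0" by simp
  qed
  then have "mat_poly_eval fps_const (?p i) A = 0" for i using A by (auto simp: arcs_def)
  then show ?thesis by (simp add: p fps_eq_iff fps_nth_mat_poly_eval)
qed

lemma mat_poly_funs_ev:
  fixes M :: "'a::field fps^'n::finite^'n \<Rightarrow> 'a fps^'n^'n"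
  assumes "\<And>i j. (\<lambda>x. M x $ i $ j) \<in> mat_poly_funs"
  shows "(\<lambda>x. mat_poly_eval fps_const f (M x)) \<in> mat_poly_funs"
  by (rule mat_poly_eval_funalg[OF funalg_mat_poly_funs assms])

lemma mat_poly_funs_mult:
  fixes B :: "'a::comm_ring_1^'n::finite^'n"
  shows "(\<lambda>A. (B ** A) $ i $ j) \<in> mat_poly_funs" "(\<lambda>A. (A ** B) $ i $ j) \<in> mat_poly_funs"
  unfolding matrix_matrix_mult_def vec_lambda_beta
  by (intro funalg_sum[OF funalg_mat_poly_funs] funalg_mult[OF funalg_mat_poly_funs]
      funalg_const[OF funalg_mat_poly_funs] mat_poly_funs_entry)+

lemma arcs_const:
  assumes "subgroup G GL_group" "a \<in> G" shows "map_mat fps_const a \<in> arcs G"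
  using assms(2) map_mat_invertible[OF hom_fps_const subgroup_GL_invertible[OF assms]]
  by (simp add: arcs_def mat_poly_eval_const vanishing_ideal_def)

text \<open>Two applications of \<open>arcs_eqs\<close>: one equation in \<open>A\<close> with
  \<open>B\<close> fixed reduces to constant \<open>A\<close>, then one in \<open>B\<close> with
  that constant fixed reduces to a product in \<open>G\<close>.\<close>

lemma arcs_mult:
  fixes A B :: "'a::field fps^'n::finite^'n"
  assumes G: "subgroup G GL_group" and A: "A \<in> arcs G" and B: "B \<in> arcs G"
  shows "A ** B \<in> arcs G"
proof -
  have "mat_poly_eval fps_const f (A ** B) = 0" if f: "f \<in> vanishing_ideal G" for f
  proof (rule arcs_eqs[OF A, of "\<lambda>A. mat_poly_eval fps_const f (A ** B)"])
    show "(\<lambda>A. mat_poly_eval fps_const f (A ** B)) \<in> mat_poly_funs"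
      by (intro mat_poly_funs_ev mat_poly_funs_mult)
    fix a assume a: "a \<in> G"
    show "mat_poly_eval fps_const f (map_mat fps_const a ** B) = 0"
    proof (rule arcs_eqs[OF B, of "\<lambda>B. mat_poly_eval fps_const f (map_mat fps_const a ** B)"])
      show "(\<lambda>B. mat_poly_eval fps_const f (map_mat fps_const a ** B)) \<in> mat_poly_funs"
        by (intro mat_poly_funs_ev mat_poly_funs_mult)
      fix b assume b: "b \<in> G"
      have "mat_poly_eval (\<lambda>x. x) f (a ** b) = 0"
        using f subgroup_GL_mult[OF G a b] by (simp add: vanishing_ideal_def)
      then show "mat_poly_eval fps_const f (map_mat fps_const a ** map_mat fps_const b) = 0"
        by (simp add: map_mat_mult(2)[OF hom_fps_const, symmetric] mat_poly_eval_const)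
    qed
  qed
  moreover have "invertible (A ** B)" using A B by (simp add: arcs_def invertible_mult)
  ultimately show ?thesis by (simp add: arcs_def)
qed

text \<open>Inversion is not polynomial, so \<open>arcs_eqs\<close> does not apply directly. The
  functions \<open>\<psi>\<close> for which some \<open>det(Z)^d \<psi>(Z^-1)\<close> is polynomial
  in \<open>Z\<close> form an algebra, which contains the entries by Cramer's rule; the determinant
  is cancelled at the end.\<close>

lemma arcs_inverse:
  fixes A B :: "'a::field fps^'n::finite^'n"
  assumes G: "subgroup G GL_group" and A: "A \<in> arcs G" and AB: "A ** B = mat 1" "B ** A = mat 1"
  shows "B \<in> arcs G"
proof -
  define Q where "Q = {\<psi> :: 'a fps^'n^'n \<Rightarrow> 'a fps. \<exists>d. \<exists>\<Phi>\<in>mat_poly_funs.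
    \<forall>Z Y. Y ** Z = mat 1 \<longrightarrow> \<Phi> Z = det Z ^ d * \<psi> Y}"
  note S = funalg_mat_poly_funs[where 'a = "'a fps" and 'n = 'n]
  have det: "det \<in> (mat_poly_funs :: ('a fps^'n^'n \<Rightarrow> 'a fps) set)"
    using funalg_det[OF S, of "\<lambda>A. A", OF mat_poly_funs_entry] by simp
  have Q: "funalg Q"
    unfolding funalg_def
  proof (intro conjI allI ballI)
    fix c
    show "(\<lambda>_. c) \<in> Q" unfolding Q_def
      by (intro CollectI exI[of _ 0] bexI[OF _ funalg_const[OF S, of c]]) simp
  next
    fix f g assume "f \<in> Q" "g \<in> Q"
    then obtain d e \<Phi> \<Psi> where *: "\<Phi> \<in> mat_poly_funs" "\<Psi> \<in> mat_poly_funs"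
      "\<And>Z Y. Y ** Z = mat 1 \<Longrightarrow> \<Phi> Z = det Z ^ d * f Y" "\<And>Z Y. Y ** Z = mat 1 \<Longrightarrow> \<Psi> Z = det Z ^ e * g Y"
      unfolding Q_def by auto
    have 1: "(\<lambda>Z. det Z ^ e * \<Phi> Z + det Z ^ d * \<Psi> Z) \<in> mat_poly_funs"
      by (intro funalg_add[OF S] funalg_mult[OF S] funalg_power[OF S] det *(1,2))
    have 2: "(\<lambda>Z. \<Phi> Z * \<Psi> Z) \<in> mat_poly_funs" by (intro funalg_mult[OF S] *(1,2))
    show "(\<lambda>x. f x + g x) \<in> Q" unfolding Q_def
      by (intro CollectI exI[of _ "d + e"] bexI[OF _ 1]) (simp add: *(3,4) power_add algebra_simps)
    show "(\<lambda>x. f x * g x) \<in> Q" unfolding Q_def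
      by (intro CollectI exI[of _ "d + e"] bexI[OF _ 2]) (simp add: *(3,4) power_add algebra_simps)
  qed
  have entry: "(\<lambda>Y. Y $ i $ j) \<in> Q" for i j
  proof -
    let ?\<Phi> = "\<lambda>Z :: 'a fps^'n^'n. det (\<chi> a b. if a = j then if b = i then 1 else 0 else Z $ a $ b)"
    have "(\<lambda>Z :: 'a fps^'n^'n. (\<chi> a b. if a = j then if b = i then 1 else 0 else Z $ a $ b) $ a $ b) \<in> mat_poly_funs"
      for a b
      by (cases "a = j") (simp_all add: mat_poly_funs_entry funalg_const[OF S])
    from funalg_det[OF S this] have 1: "?\<Phi> \<in> mat_poly_funs" .
    show ?thesis unfolding Q_def
      by (intro CollectI exI[of _ 1] bexI[OF _ 1]) (simp add: inverse_entry_det[symmetric] mult.commute)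
  qed
  have detA: "det A \<noteq> 0"
  proof
    assume "det A = 0"
    then have "det (A ** B) = 0" by (simp add: det_mul)
    then show False by (simp add: AB)
  qed
  have "mat_poly_eval fps_const f B = 0" if f: "f \<in> vanishing_ideal G" for f
  proof -
    have "mat_poly_eval fps_const f \<in> Q" using mat_poly_eval_funalg[OF Q entry, of fps_const f] by simp
    then obtain d \<Phi> where \<Phi>: "\<Phi> \<in> mat_poly_funs"
      "\<And>Z Y. Y ** Z = mat 1 \<Longrightarrow> \<Phi> Z = det Z ^ d * mat_poly_eval fps_const f Y"
      unfolding Q_def by auto
    have "\<Phi> A = 0"
    proof (rule arcs_eqs[OF A \<Phi>(1)])
      fix a assume "a \<in> G"
      then obtain b where b: "b \<in> G" "b ** a = mat 1" using subgroup_GL_inv[OF G] by blast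
      then have "map_mat fps_const b ** map_mat fps_const a = (mat 1 :: 'a fps^'n^'n)"
        by (simp add: map_mat_mult(2)[OF hom_fps_const, symmetric] map_mat_1[OF hom_fps_const])
      from \<Phi>(2)[OF this] show "\<Phi> (map_mat fps_const a) = 0"
        using f b(1) by (simp add: mat_poly_eval_const vanishing_ideal_def)
    qed
    with \<Phi>(2)[OF AB(2)] detA show ?thesis by simp
  qed
  moreover have "invertible B" unfolding invertible_def using AB by blast
  ultimately show ?thesis by (simp add: arcs_def)
qed

lemma vanishing_ideal_defined_over:
  fixes h :: "'a::field \<Rightarrow> 'b::comm_ring_1"
  assumes "defined_over F G" "ring_hom_on UNIV h"
    and "\<And>f. f \<in> vanishing_ideal G \<inter> mat_polys_over F \<Longrightarrow> mat_poly_eval h f A = 0"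
    and "f \<in> vanishing_ideal G"
  shows "mat_poly_eval h f A = 0"
proof -
  have h: "h 0 = 0" "\<And>x y. h (x + y) = h x + h y" "\<And>x y. h (x * y) = h x * h y"
    using assms(2) by (simp_all add: ring_hom_on_def)
  from assms(1,4) obtain T c where T: "T \<subseteq> vanishing_ideal G \<inter> mat_polys_over F"
    "f = (\<Sum>g\<in>T. c g * g)" unfolding defined_over_def by blast
  have "mat_poly_eval h f A = (\<Sum>g\<in>T. mat_poly_eval h (c g) A * mat_poly_eval h g A)"
    unfolding T(2) mat_poly_eval_sum[of h, OF h(1,2)] mat_poly_eval_mult[of h, OF h] ..
  also have "\<dots> = 0"
  proof (rule sum.neutral, rule ballI)
    fix g assume "g \<in> T"
    then have "mat_poly_eval h g A = 0" by (intro assms(3) subsetD[OF T(1)])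
    then show "mat_poly_eval h (c g) A * mat_poly_eval h g A = 0" by simp
  qed
  finally show ?thesis .
qed

section \<open>Operations on arcs: maps of coefficients and rescaling of \<open>t\<close>\<close>

definition fps_map :: "('a \<Rightarrow> 'b) \<Rightarrow> 'a fps \<Rightarrow> 'b fps" where
  "fps_map h f = Abs_fps (\<lambda>n. h (fps_nth f n))"

lemma fps_map_nth [simp]: "fps_nth (fps_map h f) n = h (fps_nth f n)"
  by (simp add: fps_map_def)

lemma ring_hom_on_fps_map:
  assumes h: "ring_hom_on R h"
  shows "ring_hom_on {f. \<forall>n. fps_nth f n \<in> R} (fps_map h)"
proof -
  note b = ring_hom_on_basic[OF h]
  show ?thesis
    unfolding ring_hom_on_def
  proof (intro conjI ballI)
    fix f g assume "f \<in> {f. \<forall>n. fps_nth f n \<in> R}" "g \<in> {f. \<forall>n. fps_nth f n \<in> R}"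
    then have fg: "fps_nth f n \<in> R" "fps_nth g n \<in> R" for n by auto
    then have "(\<Sum>i=0..n. fps_nth f i * fps_nth g (n - i)) \<in> R \<and>
        h (\<Sum>i=0..n. fps_nth f i * fps_nth g (n - i)) = (\<Sum>i=0..n. h (fps_nth f i) * h (fps_nth g (n - i)))" for n
      using ring_hom_on_sum[OF h, of "{0..n}" "\<lambda>i. fps_nth f i * fps_nth g (n - i)"] by (simp add: b)
    then show "f * g \<in> {f. \<forall>n. fps_nth f n \<in> R}" "fps_map h (f * g) = fps_map h f * fps_map h g"
      by (simp_all add: fps_eq_iff fps_mult_nth)
    show "f + g \<in> {f. \<forall>n. fps_nth f n \<in> R}" "fps_map h (f + g) = fps_map h f + fps_map h g"
      using fg by (simp_all add: fps_eq_iff b)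
  qed (simp_all add: fps_eq_iff fps_one_nth b)
qed

lemma ring_hom_on_nth0: "ring_hom_on UNIV (\<lambda>f :: 'a::comm_ring_1 fps. fps_nth f 0)"
  by (rule ring_hom_onI) simp_all

text \<open>The substitution of \<open>s t\<close> for \<open>t\<close>. At \<open>s = 1\<close> it
  is the identity and at \<open>s = 0\<close>, where \<open>0 ^ 0 = 1\<close>, it keeps just the
  constant term.\<close>

definition fps_scale :: "'a::comm_ring_1 \<Rightarrow> 'a fps \<Rightarrow> 'a fps" where
  "fps_scale s f = Abs_fps (\<lambda>n. s ^ n * fps_nth f n)"

lemma fps_scale_nth [simp]: "fps_nth (fps_scale s f) n = s ^ n * fps_nth f n"
  by (simp add: fps_scale_def)

lemma ring_hom_on_fps_scale: "ring_hom_on UNIV (fps_scale s)"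
proof (rule ring_hom_onI)
  fix f g
  have "s ^ n * (fps_nth f i * fps_nth g (n - i)) = s ^ i * fps_nth f i * (s ^ (n - i) * fps_nth g (n - i))"
    if "i \<le> n" for i n
  proof -
    have "s ^ n = s ^ i * s ^ (n - i)" using that by (simp flip: power_add)
    then show ?thesis by (simp add: mult_ac)
  qed
  then show "fps_scale s (f * g) = fps_scale s f * fps_scale s g"
    by (simp add: fps_eq_iff fps_mult_nth sum_distrib_left)
qed (simp_all add: fps_eq_iff fps_one_nth algebra_simps)

text \<open>An endomorphism fixing \<open>F\<close> preserves the equations over \<open>F\<close>,
  and these generate the ideal. It is applied to the Frobenius map and to rescalings of
  \<open>t\<close>.\<close>

lemma arcs_hom:
  assumes \<theta>: "ring_hom_on UNIV (\<theta> :: 'a::field fps \<Rightarrow> 'a fps)" and F: "defined_over F G"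
    and const: "\<And>c. c \<in> F \<Longrightarrow> \<theta> (fps_const c) = fps_const c" and A: "A \<in> arcs G"
  shows "map_mat \<theta> A \<in> arcs G"
proof -
  have "mat_poly_eval fps_const f (map_mat \<theta> A) = 0" if f: "f \<in> vanishing_ideal G" for f
  proof (rule vanishing_ideal_defined_over[OF F hom_fps_const _ f])
    fix f assume f: "f \<in> vanishing_ideal G \<inter> mat_polys_over F"
    then have "\<theta> (fps_const (Poly_Mapping.lookup f m)) = fps_const (Poly_Mapping.lookup f m)" for m
      by (simp add: const mat_polys_over_def)
    then have "mat_poly_eval fps_const f (map_mat \<theta> A) = \<theta> (mat_poly_eval fps_const f A)"
      unfolding mat_poly_eval_hom[OF \<theta>, simplified] by (simp add: mat_poly_eval_def)
    also have "\<dots> = 0" using f A ring_hom_on_basic(3)[OF \<theta>] by (simp add: arcs_def)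
    finally show "mat_poly_eval fps_const f (map_mat \<theta> A) = 0" .
  qed
  moreover have "invertible (map_mat \<theta> A)" using A map_mat_invertible[OF \<theta>, of A] by (simp add: arcs_def)
  ultimately show ?thesis by (simp add: arcs_def)
qed

lemma infinite_UNIV_alg_closed: "infinite (UNIV :: 'a::alg_closed_field set)"
proof
  assume fin: "finite (UNIV :: 'a set)"
  define P where "P = (\<Prod>a\<in>(UNIV :: 'a set). [:- a, 1:]) + 1"
  have P: "poly P x = 1" for x
    using fin by (auto simp: P_def poly_prod prod_zero_iff)
  have deg: "Polynomial.degree (\<Prod>a\<in>(UNIV :: 'a set). [:- a, 1:]) = card (UNIV :: 'a set)"
    by (subst degree_prod_eq_sum_degree) auto
  have "card (UNIV :: 'a set) > 0" using fin by (simp add: card_gt_0_iff)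
  then have "Polynomial.degree P > 0" unfolding P_def by (subst degree_add_eq_left) (simp_all add: deg)
  from alg_closed_imp_poly_has_root[OF this] obtain x where "poly P x = 0" by blast
  with P show False by simp
qed

text \<open>A Cauchy product has finite sums of products as coefficients, so closure of
  \<open>S\<close> passes to these functions, and entries of products of arcs can be treated like
  scalars.\<close>

definition fps_funs :: "('b \<Rightarrow> 'a::comm_ring_1) set \<Rightarrow> ('b \<Rightarrow> 'a fps) set" where
  "fps_funs S = {\<phi>. \<forall>l. (\<lambda>x. fps_nth (\<phi> x) l) \<in> S}"

lemma funalg_fps_funs:
  assumes S: "funalg S" shows "funalg (fps_funs S)"
  unfolding funalg_def
proof (intro conjI allI ballI)
  show "(\<lambda>_. c) \<in> fps_funs S" for c by (simp add: fps_funs_def funalg_const[OF S])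
next
  fix f g assume fg: "f \<in> fps_funs S" "g \<in> fps_funs S"
  then show "(\<lambda>x. f x + g x) \<in> fps_funs S" by (simp add: fps_funs_def funalg_add[OF S])
  show "(\<lambda>x. f x * g x) \<in> fps_funs S"
    unfolding fps_funs_def fps_mult_nth mem_Collect_eq
    using fg by (intro allI funalg_sum[OF S] funalg_mult[OF S]) (simp_all add: fps_funs_def)
qed

lemma fps_funs_nth: "\<phi> \<in> fps_funs S \<Longrightarrow> (\<lambda>x. fps_nth (\<phi> x) l) \<in> S"
  by (simp add: fps_funs_def)

lemma funalg_matrix_mult:
  fixes A B :: "'b \<Rightarrow> 'a::comm_ring_1^'n::finite^'n"
  assumes S: "funalg S" and "\<And>i j. (\<lambda>x. A x $ i $ j) \<in> S" "\<And>i j. (\<lambda>x. B x $ i $ j) \<in> S"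
  shows "(\<lambda>x. (A x ** B x) $ i $ j) \<in> S"
  unfolding matrix_matrix_mult_def vec_lambda_beta
  by (intro funalg_sum[OF S] funalg_mult[OF S] assms(2,3))

lemma jets_funalg:
  fixes W :: "'t \<Rightarrow> 'a::field fps^'n::finite^'n" and U :: "'a fps^'n^'n"
  assumes S: "funalg S" and W: "\<And>i j. (\<lambda>t. W t $ i $ j) \<in> fps_funs S" and f: "f \<in> poly_funs V d"
  shows "(\<lambda>t. f (\<lambda>(i, j, l). fps_nth ((U ** W t) $ i $ j) l)) \<in> S"
proof (rule poly_funs_funalg[OF S _ f])
  fix v :: "'n \<times> 'n \<times> nat"
  have "(\<lambda>t. (U ** W t) $ i $ j) \<in> fps_funs S" for i j
    by (rule funalg_matrix_mult[OF funalg_fps_funs[OF S] funalg_const[OF funalg_fps_funs[OF S]] W])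
  from fps_funs_nth[OF this]
  show "(\<lambda>t. case v of (i, j, l) \<Rightarrow> fps_nth ((U ** W t) $ i $ j) l) \<in> S" by (simp add: case_prod_beta)
qed

lemma funalg_range_poly: "funalg (range poly :: ('a::comm_ring_1 \<Rightarrow> 'a) set)"
  unfolding funalg_def
proof (intro conjI allI ballI)
  fix c :: 'a
  have "(\<lambda>_. c) = poly [:c:]" by auto
  then show "(\<lambda>_. c) \<in> range poly" by simp
next
  fix f g :: "'a \<Rightarrow> 'a" assume "f \<in> range poly" "g \<in> range poly"
  then obtain p r where pr: "f = poly p" "g = poly r" by auto
  have "(\<lambda>x. f x + g x) = poly (p + r)" "(\<lambda>x. f x * g x) = poly (p * r)" by (auto simp: pr)
  then show "(\<lambda>x. f x + g x) \<in> range poly" "(\<lambda>x. f x * g x) \<in> range poly" by simp_all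
qed

lemma linear_algebraic_group_memI:
  fixes G :: "('a::alg_closed_field^'n::finite^'n) set"
  assumes G: "linear_algebraic_group G" and a: "invertible a"
    and eqs: "\<And>f. f \<in> vanishing_ideal G \<Longrightarrow> mat_poly_eval (\<lambda>x. x) f a = 0"
  shows "a \<in> G"
proof -
  obtain E where E: "closedin zariski_topology E" "G = E \<inter> carrier GL_group"
    using G unfolding linear_algebraic_group_def closedin_subtopology by blast
  then obtain S :: "('a, 'n) mat_poly set" where S: "UNIV - E = {A. \<exists>f\<in>S. mat_poly_eval (\<lambda>x. x) f A \<noteq> 0}"
    unfolding closedin_def openin_zariski topspace_zariski by blast
  have "S \<subseteq> vanishing_ideal G" unfolding vanishing_ideal_def using S E(2) by blast
  with eqs have "a \<notin> UNIV - E" unfolding S by blast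
  then show ?thesis using a E(2) by (simp add: GL_group_def)
qed

lemma arcs_const_term:
  fixes G :: "('a::alg_closed_field^'n::finite^'n) set"
  assumes G: "linear_algebraic_group G" and A: "A \<in> arcs G"
  shows "map_mat (\<lambda>f. fps_nth f 0) A \<in> G"
proof (rule linear_algebraic_group_memI[OF G])
  show "invertible (map_mat (\<lambda>f. fps_nth f 0) A)"
    using A map_mat_invertible[OF ring_hom_on_nth0, of A] by (simp add: arcs_def)
  fix f assume "f \<in> vanishing_ideal G"
  then have "fps_nth (mat_poly_eval fps_const f A) 0 = 0" using A by (simp add: arcs_def)
  then show "mat_poly_eval (\<lambda>x. x) f (map_mat (\<lambda>f. fps_nth f 0) A) = 0"
    by (subst (asm) mat_poly_eval_hom[OF ring_hom_on_nth0]) simp_all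
qed

text \<open>
  Arcs \<open>A\<close> and \<open>B\<close> are joined by the family \<open>A(st) A(0)\<^sup>-\<^sup>1 c B(0)\<^sup>-\<^sup>1 B((1 - s)t)\<close>, which is polynomial in
  \<open>s \<in> K\<close> and in \<open>c \<in> G(K)\<close>. This gives irreducibility of the space of jets that extend to arcs, without
  using that \<open>G\<close> is smooth.
\<close>

lemma arcs_jet_irreducible:
  fixes G :: "('a::alg_closed_field^'n::finite^'n) set" and U :: "'a fps^'n^'n"
    and V :: "('n \<times> 'n \<times> nat) set"
  assumes G: "linear_algebraic_group G" and conn: "connectedin zariski_topology G"
    and F: "defined_over F G"
    and p: "p \<in> poly_funs V d" and r: "r \<in> poly_funs V d"
    and pr: "\<forall>A\<in>arcs G. p (\<lambda>(i, j, l). fps_nth ((U ** A) $ i $ j) l) *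
                        r (\<lambda>(i, j, l). fps_nth ((U ** A) $ i $ j) l) = 0"
  shows "(\<forall>A\<in>arcs G. p (\<lambda>(i, j, l). fps_nth ((U ** A) $ i $ j) l) = 0) \<or>
         (\<forall>A\<in>arcs G. r (\<lambda>(i, j, l). fps_nth ((U ** A) $ i $ j) l) = 0)"
proof (rule ccontr)
  define J where "J A = (\<lambda>(i, j, l). fps_nth ((U ** A) $ i $ j) l)" for A :: "'a fps^'n^'n"
  have sub: "subgroup G GL_group" using G by (simp add: linear_algebraic_group_def)
  assume "\<not> ?thesis"
  then obtain A B where A: "A \<in> arcs G" "p (J A) \<noteq> 0" and B: "B \<in> arcs G" "r (J B) \<noteq> 0"
    unfolding J_def by blast
  define a where "a = map_mat (\<lambda>f. fps_nth f 0) A"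
  define b where "b = map_mat (\<lambda>f. fps_nth f 0) B"
  have aG: "a \<in> G" and bG: "b \<in> G" unfolding a_def b_def by (rule arcs_const_term[OF G A(1)] arcs_const_term[OF G B(1)])+
  obtain a' where a': "a' \<in> G" "a' ** a = mat 1" "a ** a' = mat 1" using subgroup_GL_inv[OF sub aG] by blast
  obtain b' where b': "b' \<in> G" "b' ** b = mat 1" "b ** b' = mat 1" using subgroup_GL_inv[OF sub bG] by blast
  let ?c = "map_mat fps_const :: 'a^'n^'n \<Rightarrow> 'a fps^'n^'n"
  note cmult = map_mat_mult(2)[OF hom_fps_const, simplified, symmetric]
  define w where "w s c = map_mat (fps_scale s) A ** ?c a' ** ?c c ** ?c b' ** map_mat (fps_scale (1 - s)) B" for s :: 'a and c :: "'a^'n^'n"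
  have scale0: "map_mat (fps_scale 0) A = ?c a" "map_mat (fps_scale 0) B = ?c b"
    by (auto simp: vec_eq_iff fps_eq_iff a_def b_def power_0_left)
  have scale1: "map_mat (fps_scale 1) A = A" "map_mat (fps_scale 1) B = B"
    by (auto simp: vec_eq_iff fps_eq_iff)
  have w1: "w 1 a = A"
  proof -
    have "w 1 a = A ** (?c a' ** ?c a) ** (?c b' ** ?c b)" by (simp add: w_def scale0 scale1 matrix_mul_assoc)
    then show ?thesis by (simp add: cmult a' b' map_mat_1[OF hom_fps_const])
  qed
  have w0: "w 0 b = B"
  proof -
    have "w 0 b = (?c a ** ?c a') ** (?c b ** ?c b') ** B" by (simp add: w_def scale0 scale1 matrix_mul_assoc)
    then show ?thesis by (simp add: cmult a' b' map_mat_1[OF hom_fps_const])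
  qed
  have w_arcs: "w s c \<in> arcs G" if "c \<in> G" for s c
    unfolding w_def
    by (intro arcs_mult[OF sub] arcs_const[OF sub] arcs_hom[OF ring_hom_on_fps_scale F] that a' b' A B)
      (auto simp: fps_eq_iff fps_const_def power_0_left)
  have poly_s: "(\<lambda>s. f (J (w s c))) \<in> range poly" if f: "f \<in> poly_funs V d" for f c
  proof (rule jets_funalg[OF funalg_range_poly _ f, of _ U, folded J_def])
    note S = funalg_range_poly[where 'a = 'a]
    note T = funalg_fps_funs[OF S]
    have id: "(\<lambda>s. s) \<in> range (poly :: 'a poly \<Rightarrow> 'a \<Rightarrow> 'a)"
      by (rule image_eqI[of _ _ "[:0, 1:]"]) auto
    have "(\<lambda>s. map_mat (fps_scale s) A $ i $ j) \<in> fps_funs (range poly)"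
      "(\<lambda>s. map_mat (fps_scale (1 - s)) B $ i $ j) \<in> fps_funs (range poly)" for i j
      unfolding fps_funs_def map_mat_nth fps_scale_nth mem_Collect_eq
      by (intro allI funalg_mult[OF S] funalg_power[OF S] funalg_diff[OF S] funalg_const[OF S] id)+
    then show "(\<lambda>s. w s c $ i $ j) \<in> fps_funs (range poly)" for i j
      unfolding w_def by (intro funalg_matrix_mult[OF T] funalg_const[OF T])
  qed
  have poly_c: "(\<lambda>c. f (J (w s c))) \<in> mat_poly_funs" if f: "f \<in> poly_funs V d" for f s
  proof (rule jets_funalg[OF funalg_mat_poly_funs _ f, of _ U, folded J_def])
    note S = funalg_mat_poly_funs[where 'a = 'a and 'n = 'n]
    note T = funalg_fps_funs[OF S]
    have "(\<lambda>c. ?c c $ i $ j) \<in> fps_funs mat_poly_funs" for i j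
    proof -
      have "(\<lambda>c :: 'a^'n^'n. if l = 0 then c $ i $ j else 0) \<in> mat_poly_funs" for l :: nat
        by (cases "l = 0") (simp_all add: mat_poly_funs_entry funalg_const[OF S])
      then show ?thesis by (simp add: fps_funs_def)
    qed
    then show "(\<lambda>c. w s c $ i $ j) \<in> fps_funs mat_poly_funs" for i j
      unfolding w_def by (intro funalg_matrix_mult[OF T] funalg_const[OF T])
  qed
  \<comment> \<open>For fixed \<open>c\<close> the values are polynomials in \<open>s\<close>,
    nonzero at \<open>s = 1\<close> and \<open>s = 0\<close> respectively. One \<open>s\<close>
    avoids the roots of both, and for this \<open>s\<close> only irreducibility of \<open>G\<close>
    in the variable \<open>c\<close> remains to be used.\<close>
  obtain P Q where P: "(\<lambda>s. p (J (w s a))) = poly P" and Q: "(\<lambda>s. r (J (w s b))) = poly Q"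
    using poly_s[OF p, of a] poly_s[OF r, of b] by blast
  have "poly P 1 \<noteq> 0" "poly Q 0 \<noteq> 0" using A(2) B(2) unfolding P[symmetric] Q[symmetric] w0 w1 .
  then have "P * Q \<noteq> 0" by auto
  then have "finite {s. poly (P * Q) s = 0}" by (rule poly_roots_finite)
  then obtain s where "s \<notin> {s. poly (P * Q) s = 0}"
    using infinite_UNIV_alg_closed ex_new_if_finite by blast
  then have s: "p (J (w s a)) \<noteq> 0" "r (J (w s b)) \<noteq> 0"
    using fun_cong[OF P, of s] fun_cong[OF Q, of s] by simp_all
  have "p (J (w s c)) * r (J (w s c)) = 0" if "c \<in> G" for c
    using pr w_arcs[OF that] unfolding J_def by blast
  from connected_group_irreducible[OF sub conn poly_c[OF p] poly_c[OF r] this] s aG bG show False by blast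
qed

section \<open>Lang's theorem for arcs\<close>

lemma det_map_mat:
  fixes A :: "'a::comm_ring_1^'n::finite^'n" and \<theta> :: "'a \<Rightarrow> 'b::comm_ring_1"
  assumes \<theta>: "ring_hom_on UNIV \<theta>"
  shows "det (map_mat \<theta> A) = \<theta> (det A)"
proof -
  note b = ring_hom_on_basic[OF \<theta>, simplified]
  have "\<theta> (- 1) + 1 = 0" using ring_hom_on_basic(7)[OF \<theta>, of "- 1" 1] by (simp add: b)
  then have m1: "\<theta> (- 1) = - 1" by (simp add: eq_neg_iff_add_eq_0)
  have "\<theta> (of_int (sign p) * (\<Prod>i\<in>UNIV. A $ i $ p i)) =
      of_int (sign p) * (\<Prod>i\<in>UNIV. \<theta> (A $ i $ p i))" for p :: "'n \<Rightarrow> 'n"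
    using ring_hom_on_prod[OF \<theta>, of UNIV "\<lambda>i. A $ i $ p i"] m1
    by (simp add: b sign_def)
  then show ?thesis unfolding det_def using ring_hom_on_sum[OF \<theta>, of "{p. p permutes (UNIV :: 'n set)}"]
    by simp
qed

section \<open>Jets and congruences modulo powers of \<open>t\<close>\<close>

definition fps_cong :: "nat \<Rightarrow> 'a fps \<Rightarrow> 'a fps \<Rightarrow> bool" where
  "fps_cong N f g \<longleftrightarrow> (\<forall>l<N. fps_nth f l = fps_nth g l)"

lemma fps_cong_refl [simp]: "fps_cong N f f"
  by (simp add: fps_cong_def)

lemma fps_cong_mult:
  fixes f g :: "'a::comm_ring_1 fps"
  shows "fps_cong N f f' \<Longrightarrow> fps_cong N g g' \<Longrightarrow> fps_cong N (f * g) (f' * g')"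
  by (simp add: fps_cong_def fps_mult_nth)

lemma fps_cong_sum:
  "(\<And>i. i \<in> I \<Longrightarrow> fps_cong N (f i) (g i)) \<Longrightarrow> fps_cong N (\<Sum>i\<in>I. f i) (\<Sum>i\<in>I. g i :: 'a::comm_ring_1 fps)"
  by (simp add: fps_cong_def fps_sum_nth)

lemma fps_cong_prod:
  "(\<And>i. i \<in> I \<Longrightarrow> fps_cong N (f i) (g i)) \<Longrightarrow> fps_cong N (\<Prod>i\<in>I. f i) (\<Prod>i\<in>I. g i :: 'a::comm_ring_1 fps)"
  by (induction I rule: infinite_finite_induct) (simp_all add: fps_cong_mult)

lemma fps_cong_power: "fps_cong N f g \<Longrightarrow> fps_cong N (f ^ k) (g ^ k :: 'a::comm_ring_1 fps)"
  by (induction k) (simp_all add: fps_cong_mult)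

lemma fps_cong_mat_poly_eval:
  fixes A B :: "'a::comm_ring_1 fps^'n::finite^'n"
  assumes "\<And>i j. fps_cong N (A $ i $ j) (B $ i $ j)"
  shows "fps_cong N (mat_poly_eval h f A) (mat_poly_eval h f B)"
  unfolding mat_poly_eval_def monom_eval_def
  by (intro fps_cong_sum fps_cong_mult fps_cong_refl fps_cong_prod fps_cong_power assms)

lemma fps_cong_matrix_mult:
  fixes A B :: "'a::comm_ring_1 fps^'n::finite^'n"
  assumes "\<And>i j. fps_cong N (A $ i $ j) (A' $ i $ j)" "\<And>i j. fps_cong N (B $ i $ j) (B' $ i $ j)"
  shows "fps_cong N ((A ** B) $ i $ j) ((A' ** B') $ i $ j)"
  unfolding matrix_matrix_mult_def vec_lambda_beta
  by (intro fps_cong_sum fps_cong_mult assms)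

definition jet :: "'a fps^'n^'n \<Rightarrow> 'n \<times> 'n \<times> nat \<Rightarrow> 'a" where
  "jet A = (\<lambda>(i, j, l). fps_nth (A $ i $ j) l)"

definition bilin :: "'v set \<Rightarrow> (('v \<Rightarrow> 'a) \<Rightarrow> ('v \<Rightarrow> 'a) \<Rightarrow> 'a::comm_ring_1) set" where
  "bilin V = {\<beta>. \<exists>\<gamma>. \<forall>x y. \<beta> x y = (\<Sum>w\<in>V. \<Sum>u\<in>V. \<gamma> w u * x w * y u)}"

lemma bilin_zero: "(\<lambda>x y. 0) \<in> bilin V"
  unfolding bilin_def by (intro CollectI exI[of _ "\<lambda>_ _. 0"]) simp

lemma bilin_add: "\<beta> \<in> bilin V \<Longrightarrow> \<beta>' \<in> bilin V \<Longrightarrow> (\<lambda>x y. \<beta> x y + \<beta>' x y) \<in> bilin V"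
proof -
  assume "\<beta> \<in> bilin V" "\<beta>' \<in> bilin V"
  then obtain \<gamma> \<gamma>' where "\<And>x y. \<beta> x y = (\<Sum>w\<in>V. \<Sum>u\<in>V. \<gamma> w u * x w * y u)"
    "\<And>x y. \<beta>' x y = (\<Sum>w\<in>V. \<Sum>u\<in>V. \<gamma>' w u * x w * y u)" unfolding bilin_def by auto
  then show ?thesis unfolding bilin_def
    by (intro CollectI exI[of _ "\<lambda>w u. \<gamma> w u + \<gamma>' w u"]) (simp add: algebra_simps sum.distrib)
qed

lemma bilin_sum: "(\<And>i. i \<in> I \<Longrightarrow> \<beta> i \<in> bilin V) \<Longrightarrow> (\<lambda>x y. \<Sum>i\<in>I. \<beta> i x y) \<in> bilin V"
  by (induction I rule: infinite_finite_induct) (simp_all add: bilin_zero bilin_add)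

lemma bilin_single:
  assumes "finite V" "w \<in> V" "u \<in> V"
  shows "(\<lambda>x y. x w * c * y u) \<in> bilin V"
proof -
  have "x w * c * y u = (\<Sum>w'\<in>V. \<Sum>u'\<in>V. (if w' = w then if u' = u then c else 0 else 0) * x w' * y u')"
    for x y
  proof -
    have "(\<Sum>w'\<in>V. \<Sum>u'\<in>V. (if w' = w then if u' = u then c else 0 else 0) * x w' * y u') =
        (\<Sum>w'\<in>V. if w' = w then \<Sum>u'\<in>V. if u' = u then c * x w' * y u' else 0 else 0)"
      by (intro sum.cong) (auto intro!: sum.cong)
    then show ?thesis using assms by (simp add: mult_ac)
  qed
  then show ?thesis unfolding bilin_def
    by (intro CollectI exI[of _ "\<lambda>w' u'. if w' = w then if u' = u then c else 0 else 0"]) simp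
qed

definition jet_index :: "nat \<Rightarrow> ('n::finite \<times> 'n \<times> nat) set" where
  "jet_index N = UNIV \<times> UNIV \<times> {..<N}"

lemma finite_jet_index: "finite (jet_index N :: ('n::finite \<times> 'n \<times> nat) set)"
  by (simp add: jet_index_def)

text \<open>The coefficient of \<open>t^l\<close> in a product involves only coefficients of index
  at most \<open>l\<close>, so truncation is compatible with products. The resulting bilinear form
  supplies the constants of \<open>frob_rel\<close>.\<close>

lemma jet_triple_product:
  fixes Y :: "'a::field fps^'n::finite^'n"
  shows "\<exists>\<gamma>. \<forall>A B. \<forall>v\<in>jet_index N. jet (A ** Y ** B) v =
     (\<Sum>w\<in>jet_index N. \<Sum>u\<in>jet_index N. \<gamma> v w u * jet A w * jet B u)"
proof -
  let ?V = "jet_index N :: ('n \<times> 'n \<times> nat) set"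
  have "\<exists>\<beta>\<in>bilin ?V. \<forall>A B. jet (A ** Y ** B) v = \<beta> (jet A) (jet B)" if "v \<in> ?V" for v
  proof -
    obtain i j l where v: "v = (i, j, l)" by (cases v)
    with that have l: "l < N" by (simp add: jet_index_def)
    define \<beta> where "\<beta> x y = (\<Sum>k\<in>UNIV. \<Sum>m\<in>UNIV. \<Sum>a\<in>{0..l}. \<Sum>b\<in>{0..a}.
       x (i, m, b) * fps_nth (Y $ m $ k) (a - b) * y (k, j, l - a))" for x y :: "'n \<times> 'n \<times> nat \<Rightarrow> 'a"
    have "\<beta> \<in> bilin ?V" unfolding \<beta>_def
      by (intro bilin_sum bilin_single finite_jet_index) (use l in \<open>auto simp: jet_index_def\<close>)
    moreover have "jet (A ** Y ** B) v = \<beta> (jet A) (jet B)" for A B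
      by (simp add: v jet_def matrix_matrix_mult_def fps_sum_nth fps_mult_nth \<beta>_def sum_distrib_right)
    ultimately show ?thesis by blast
  qed
  then have "\<forall>v\<in>?V. \<exists>\<gamma>. \<forall>A B. jet (A ** Y ** B) v = (\<Sum>w\<in>?V. \<Sum>u\<in>?V. \<gamma> w u * jet A w * jet B u)"
    (is "\<forall>v\<in>?V. \<exists>\<gamma>. ?P v \<gamma>")
  proof (intro ballI)
    fix v assume "v \<in> ?V"
    with \<open>\<And>v. v \<in> ?V \<Longrightarrow> \<exists>\<beta>\<in>bilin ?V. \<forall>A B. jet (A ** Y ** B) v = \<beta> (jet A) (jet B)\<close>
    obtain \<beta> where "\<beta> \<in> bilin ?V" "\<And>A B. jet (A ** Y ** B) v = \<beta> (jet A) (jet B)" by blast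
    moreover from this(1) obtain \<gamma> where "\<And>x y. \<beta> x y = (\<Sum>w\<in>?V. \<Sum>u\<in>?V. \<gamma> w u * x w * y u)"
      unfolding bilin_def by auto
    ultimately show "\<exists>\<gamma>. ?P v \<gamma>" by (intro exI[of _ \<gamma>]) simp
  qed
  from bchoice[OF this] obtain \<gamma> where "\<forall>v\<in>?V. ?P v (\<gamma> v)" by (rule exE)
  then show ?thesis by (intro exI[of _ \<gamma>] allI ballI) simp
qed

definition jet_mat :: "nat \<Rightarrow> ('n \<times> 'n \<times> nat \<Rightarrow> 'a::zero) \<Rightarrow> 'a fps^'n::finite^'n" where
  "jet_mat N x = (\<chi> i j. Abs_fps (\<lambda>l. if l < N then x (i, j, l) else 0))"

lemma jet_mat_nth [simp]: "fps_nth (jet_mat N x $ i $ j) l = (if l < N then x (i, j, l) else 0)"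
  by (simp add: jet_mat_def)

lemma jet_jet_mat: "v \<in> jet_index N \<Longrightarrow> jet (jet_mat N x) v = x v"
  by (auto simp: jet_def jet_index_def)

lemma jet_mat_jet: "fps_cong N (jet_mat N (jet A) $ i $ j) (A $ i $ j)"
  by (simp add: fps_cong_def jet_def)

text \<open>From \<open>D \<phi>(Y) = Y\<close> follows \<open>\<phi>(Yi) = Yi D\<close>, so for
  \<open>x = Yi A\<close> and \<open>y = Yi L(A)\<close> the Lang relation becomes
  \<open>\<phi>(x) = x Y y\<close>, without \<open>D\<close>. At the unit \<open>y = Yi\<close> and
  the right side is \<open>x\<close>, so all \<open>F\<close>-valued \<open>x\<close> satisfy the
  relation. This is the situation of \<open>fixed_point_in_closure\<close>.\<close>

lemma lang_jets:
  fixes G :: "('a::alg_closed_field^'n::finite^'n) set" and D Y Yi :: "'a fps^'n^'n"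
  assumes G: "linear_algebraic_group G" and conn: "connectedin zariski_topology G"
    and def: "defined_over F G" and D: "D \<in> arcs G"
    and Y: "Y ** Yi = mat 1" "Yi ** Y = mat 1" "D ** map_mat (fps_map (\<lambda>x. x ^ q)) Y = Y"
    and q: "q \<ge> 2" and add: "\<And>x y :: 'a. (x + y) ^ q = x ^ q + y ^ q"
    and F: "finite F" "card F = q" "\<And>x. x \<in> F \<Longrightarrow> x ^ q = x" and N: "N > 0"
  shows "\<exists>c\<in>jet_index N \<rightarrow>\<^sub>E F. det (\<chi> i j. c (i, j, 0)) \<noteq> 0 \<and>
     (\<forall>f\<in>vanishing_ideal G. fps_cong N (mat_poly_eval fps_const f (Y ** jet_mat N c)) 0)"
proof -
  let ?V = "jet_index N :: ('n \<times> 'n \<times> nat) set"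
  let ?fr = "map_mat (fps_map (\<lambda>x :: 'a. x ^ q)) :: 'a fps^'n^'n \<Rightarrow> 'a fps^'n^'n"
  have sub: "subgroup G GL_group" using G by (simp add: linear_algebraic_group_def)
  have hq: "ring_hom_on UNIV (\<lambda>x :: 'a. x ^ q)"
    by (rule ring_hom_onI) (use q add in \<open>simp_all add: power_mult_distrib power_0_left\<close>)
  then have hfr: "ring_hom_on UNIV (fps_map (\<lambda>x :: 'a. x ^ q))"
    using ring_hom_on_fps_map[OF hq] by simp
  note fr_mult = map_mat_mult(2)[OF hfr, simplified]
  define J where "J A = jet (Yi ** A)" for A
  define L where "L A = matrix_inv A ** D ** ?fr A" for A
  have inv: "A ** matrix_inv A = mat 1" "matrix_inv A ** A = mat 1" if "A \<in> arcs G" for A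
  proof -
    have "\<exists>B. A ** B = mat 1 \<and> B ** A = mat 1" using that by (simp add: arcs_def invertible_def)
    from someI_ex[OF this] show "A ** matrix_inv A = mat 1" "matrix_inv A ** A = mat 1"
      by (simp_all add: matrix_inv_def)
  qed
  have L_arcs: "L A \<in> arcs G" if A: "A \<in> arcs G" for A
  proof -
    have "?fr A \<in> arcs G"
      by (rule arcs_hom[OF hfr def _ A]) (use F(3) q in \<open>auto simp: fps_eq_iff power_0_left\<close>)
    then show ?thesis unfolding L_def
      by (intro arcs_mult[OF sub] arcs_inverse[OF sub A inv[OF A]] D)
  qed
  have "?fr Y ** ?fr Yi = mat 1"
    using fr_mult[of Y Yi] Y(1) map_mat_1[OF hfr, where 'c = 'n] by simp
  then have "Yi ** (D ** ?fr Y) ** ?fr Yi = Yi ** D"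
    by (simp add: matrix_mul_assoc[symmetric])
  then have frYi: "?fr Yi = Yi ** D" unfolding Y(3) Y(2) by simp
  have rel0: "?fr (Yi ** A) = (Yi ** A) ** Y ** (Yi ** L A)" if A: "A \<in> arcs G" for A
  proof -
    have "(Yi ** A) ** Y ** (Yi ** L A) = Yi ** A ** (Y ** Yi) ** L A" by (simp add: matrix_mul_assoc)
    also have "\<dots> = Yi ** (A ** matrix_inv A) ** D ** ?fr A" unfolding Y(1) L_def by (simp add: matrix_mul_assoc)
    also have "\<dots> = ?fr Yi ** ?fr A" by (simp add: inv[OF A] frYi)
    finally show ?thesis by (simp add: fr_mult)
  qed
  obtain \<gamma> where \<gamma>: "\<And>A B v. v \<in> ?V \<Longrightarrow> jet (A ** Y ** B) v = (\<Sum>w\<in>?V. \<Sum>u\<in>?V. \<gamma> v w u * jet A w * jet B u)"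
    using jet_triple_product[of N Y] by blast
  have jet_fr: "jet (?fr A) v = jet A v ^ q" for A v by (simp add: jet_def case_prod_beta)
  interpret frob_set ?V q \<gamma> "arcs G" J L "mat 1"
  proof
    show "finite ?V" by (rule finite_jet_index)
    show "2 \<le> q" by (rule q)
    show "mat 1 \<in> arcs G"
      using arcs_const[OF sub subgroup_GL_one[OF sub]] by (simp add: map_mat_1[OF hom_fps_const])
    show "L g \<in> arcs G" if "g \<in> arcs G" for g by (rule L_arcs[OF that])
    show "frob_rel ?V q \<gamma> (J g) (J (L g))" if "g \<in> arcs G" for g
      unfolding frob_rel_def J_def
      using \<gamma>[of _ "Yi ** g" "Yi ** L g"] rel0[OF that] jet_fr[of "Yi ** g"] by simp
    show "(\<forall>g\<in>arcs G. p (J g) = 0) \<or> (\<forall>g\<in>arcs G. r (J g) = 0)"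
      if "p \<in> poly_funs ?V d" "r \<in> poly_funs ?V d" "\<forall>g\<in>arcs G. p (J g) * r (J g) = 0" for d p r
      using arcs_jet_irreducible[OF G conn def that(1,2), of Yi] that(3) by (simp add: J_def jet_def)
  qed
  note S = funalg_poly_funs[of ?V, where 'b = 'a]
  have var: "(\<lambda>x. x (i, j, l)) \<in> (\<Union>d. poly_funs ?V d)" if "l < N" for i j l
    by (rule UN_I[OF UNIV_I], rule poly_funs_var) (use that in \<open>simp add: jet_index_def\<close>)
  define z where "z A = map_mat (\<lambda>f. fps_nth f 0) A" for A :: "'a fps^'n^'n"
  note hz = ring_hom_on_nth0[where 'a = 'a]
  have z_mult: "z (A ** B) = z A ** z B" for A B unfolding z_def by (simp add: map_mat_mult(2)[OF hz])
  have z_1: "z (mat 1) = mat 1" unfolding z_def by (rule map_mat_1[OF hz])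
  \<comment> \<open>Determinants of constant terms in \<open>\<phi>(x) = x Y y\<close> give
    \<open>\<delta>(x)^q = \<delta>(x) \<epsilon>(y)\<close>. The condition
    \<open>\<delta> c \<noteq> 0\<close> is carried along because equations alone cannot exclude
    singular matrices.\<close>
  define \<delta> where "\<delta> x = det (\<chi> i j. x (i, j, 0 :: nat))" for x :: "'n \<times> 'n \<times> nat \<Rightarrow> 'a"
  define \<epsilon> where "\<epsilon> x = det (z Y ** (\<chi> i j. x (i, j, 0 :: nat)))" for x :: "'n \<times> 'n \<times> nat \<Rightarrow> 'a"
  have zJ: "(\<chi> i j. J A (i, j, 0)) = z (Yi ** A)" for A by (simp add: J_def jet_def z_def vec_eq_iff)
  have "\<exists>c\<in>?V \<rightarrow>\<^sub>E F. \<delta> c \<noteq> 0 \<and> (\<forall>d. \<forall>p\<in>poly_funs ?V d. (\<forall>g\<in>arcs G. p (J g) = 0) \<longrightarrow> p c = 0)"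
  proof (rule fixed_point_in_closure[OF F(1,2)])
    fix c assume c: "c \<in> ?V \<rightarrow>\<^sub>E F"
    have "jet_mat N c ** Y ** (Yi ** mat 1) = jet_mat N c ** (Y ** Yi)" by (simp add: matrix_mul_assoc)
    then have *: "jet_mat N c ** Y ** (Yi ** mat 1) = jet_mat N c" by (simp add: Y(1))
    show "frob_rel ?V q \<gamma> c (J (mat 1))"
      unfolding frob_rel_def J_def
    proof
      fix v assume v: "v \<in> ?V"
      have "c v ^ q = jet (jet_mat N c) v" using F(3) c v jet_jet_mat[OF v, of c] by auto
      also have "\<dots> = (\<Sum>w\<in>?V. \<Sum>u\<in>?V. \<gamma> v w u * jet (jet_mat N c) w * jet (Yi ** mat 1) u)"
        using \<gamma>[OF v, of "jet_mat N c" "Yi ** mat 1"] unfolding * .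
      also have "\<dots> = (\<Sum>w\<in>?V. \<Sum>u\<in>?V. \<gamma> v w u * c w * jet (Yi ** mat 1) u)"
        by (intro sum.cong refl) (simp add: jet_jet_mat)
      finally show "c v ^ q = (\<Sum>w\<in>?V. \<Sum>u\<in>?V. \<gamma> v w u * c w * jet (Yi ** mat 1) u)" .
    qed
  next
    show "\<delta> \<in> (\<Union>d. poly_funs ?V d)" unfolding \<delta>_def
      by (rule funalg_det[OF S]) (use var[OF N] in simp)
    show "\<epsilon> \<in> (\<Union>d. poly_funs ?V d)" unfolding \<epsilon>_def
      by (intro funalg_det[OF S] funalg_matrix_mult[OF S] funalg_const[OF S]) (use var[OF N] in simp)
    have "z Y ** z Yi = mat 1" by (simp add: z_mult[symmetric] Y(1) z_1)
    then show "\<epsilon> (J (mat 1)) = 1" unfolding \<epsilon>_def zJ by simp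
    fix g assume g: "g \<in> arcs G"
    have "\<delta> (J g) ^ q = det (map_mat (\<lambda>x. x ^ q) (z (Yi ** g)))"
      unfolding \<delta>_def zJ by (simp add: det_map_mat[OF hq])
    also have "map_mat (\<lambda>x. x ^ q) (z (Yi ** g)) = z (?fr (Yi ** g))" by (simp add: z_def vec_eq_iff)
    also have "det \<dots> = \<delta> (J g) * \<epsilon> (J (L g))"
      unfolding rel0[OF g] z_mult \<delta>_def \<epsilon>_def zJ by (simp add: z_mult det_mul)
    finally have 1: "\<delta> (J g) ^ q = \<delta> (J g) * \<epsilon> (J (L g))" .
    have "z (Yi ** g) ** z (matrix_inv g ** Y) = mat 1"
    proof -
      have "Yi ** g ** (matrix_inv g ** Y) = Yi ** (g ** matrix_inv g) ** Y" by (simp add: matrix_mul_assoc)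
      then show ?thesis by (simp add: z_mult[symmetric] inv[OF g] Y z_1)
    qed
    then have "det (z (Yi ** g)) * det (z (matrix_inv g ** Y)) = 1" by (simp add: det_mul[symmetric])
    then have "\<delta> (J g) \<noteq> 0" unfolding \<delta>_def zJ by auto
    moreover have "\<delta> (J g) ^ q = \<delta> (J g) * \<delta> (J g) ^ (q - 1)" using q by (simp add: power_eq_if)
    ultimately show "\<delta> (J g) ^ (q - 1) = \<epsilon> (J (L g))" using 1 by simp
  qed
  then obtain c where c: "c \<in> ?V \<rightarrow>\<^sub>E F" "\<delta> c \<noteq> 0"
    "\<And>d p. p \<in> poly_funs ?V d \<Longrightarrow> \<forall>g\<in>arcs G. p (J g) = 0 \<Longrightarrow> p c = 0" by blast
  have "fps_nth (mat_poly_eval fps_const f (Y ** jet_mat N c)) l = 0"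
    if f: "f \<in> vanishing_ideal G" and l: "l < N" for f l
  proof -
    note T = funalg_fps_funs[OF S]
    have "(\<lambda>x :: 'n \<times> 'n \<times> nat \<Rightarrow> 'a. jet_mat N x $ i $ j) \<in> fps_funs (\<Union>d. poly_funs ?V d)" for i j
    proof -
      have *: "(\<lambda>x :: 'n \<times> 'n \<times> nat \<Rightarrow> 'a. if l < N then x (i, j, l) else 0) \<in> (\<Union>d. poly_funs ?V d)" for l
      proof (cases "l < N")
        case True
        then show ?thesis by (simp only: if_True var)
      next
        case False
        show ?thesis unfolding if_not_P[OF False] by (rule funalg_const[OF S])
      qed
      show ?thesis unfolding fps_funs_def jet_mat_nth mem_Collect_eq by (intro allI *)
    qed
    then have "(\<lambda>x. mat_poly_eval fps_const f (Y ** jet_mat N x)) \<in> fps_funs (\<Union>d. poly_funs ?V d)"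
      by (intro mat_poly_eval_funalg[OF T] funalg_matrix_mult[OF T] funalg_const[OF T])
    from fps_funs_nth[OF this, of l]
    obtain d where "(\<lambda>x. fps_nth (mat_poly_eval fps_const f (Y ** jet_mat N x)) l) \<in> poly_funs ?V d" by blast
    then show ?thesis
    proof (rule c(3), intro ballI)
      fix g assume g: "g \<in> arcs G"
      \<comment> \<open>To order \<open>N\<close> the matrix rebuilt from the coordinates of
        \<open>g\<close> is \<open>Yi ** g\<close>, and multiplication by \<open>Y\<close> returns
        \<open>g\<close>.\<close>
      have "fps_cong N ((Y ** jet_mat N (J g)) $ i $ j) ((Y ** (Yi ** g)) $ i $ j)" for i j
        unfolding J_def by (intro fps_cong_matrix_mult fps_cong_refl jet_mat_jet)
      from fps_cong_mat_poly_eval[OF this, of fps_const f] l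
      have "fps_nth (mat_poly_eval fps_const f (Y ** jet_mat N (J g))) l =
          fps_nth (mat_poly_eval fps_const f (Y ** (Yi ** g))) l" by (simp add: fps_cong_def)
      also have "Y ** (Yi ** g) = g" by (simp add: matrix_mul_assoc Y(1))
      finally show "fps_nth (mat_poly_eval fps_const f (Y ** jet_mat N (J g))) l = 0"
        using f g by (simp add: arcs_def)
    qed
  qed
  then show ?thesis using c(1,2) unfolding \<delta>_def fps_cong_def by (intro bexI[of _ c]) auto
qed

text \<open>Koenig's lemma: a prefix shared by infinitely many of the sequences can be prolonged by
  one entry, by the pigeonhole principle.\<close>

lemma sequence_compactness:
  fixes c :: "nat \<Rightarrow> nat \<Rightarrow> 'x"
  assumes fin: "finite S" and c: "\<And>N l. c N l \<in> S"
  shows "\<exists>g. (\<forall>l. g l \<in> S) \<and> (\<forall>N. \<exists>M\<ge>N. \<forall>l<N. g l = c M l)"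
proof -
  define P where "P n g \<longleftrightarrow> infinite {M. \<forall>l<n. g l = c M l}" for n and g :: "nat \<Rightarrow> 'x"
  have "\<exists>f. \<forall>n. P n (f n) \<and> (\<forall>l<n. f (Suc n) l = f n l)"
  proof (rule dependent_nat_choice)
    show "\<exists>g. P 0 g" by (simp add: P_def)
    fix g n assume "P n g"
    then have inf: "infinite {M. \<forall>l<n. g l = c M l}" by (simp add: P_def)
    have "(\<lambda>M. c M n) ` {M. \<forall>l<n. g l = c M l} \<subseteq> S" using c by blast
    from pigeonhole_infinite[OF inf finite_subset[OF this fin]]
    obtain M0 where M0: "infinite {M \<in> {M. \<forall>l<n. g l = c M l}. c M n = c M0 n}" by blast
    have "{M \<in> {M. \<forall>l<n. g l = c M l}. c M n = c M0 n} = {M. \<forall>l<Suc n. (g(n := c M0 n)) l = c M l}"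
      by (auto simp: less_Suc_eq)
    with M0 show "\<exists>g'. P (Suc n) g' \<and> (\<forall>l<n. g' l = g l)"
      by (intro exI[of _ "g(n := c M0 n)"]) (simp add: P_def)
  qed
  then obtain f where f: "\<And>n. P n (f n)" "\<And>n l. l < n \<Longrightarrow> f (Suc n) l = f n l" by blast
  define g where "g l = f (Suc l) l" for l
  have fg: "f n l = g l" if "l < n" for n l
    using that
  proof (induction n)
    case (Suc n)
    then show ?case by (cases "l = n") (simp_all add: g_def f(2))
  qed simp
  have g: "\<exists>M\<ge>N. \<forall>l<N. g l = c M l" for N
  proof -
    have "infinite {M. \<forall>l<N. f N l = c M l}" using f(1)[of N] by (simp add: P_def)
    then obtain M where "M \<ge> N" "\<forall>l<N. f N l = c M l" unfolding infinite_nat_iff_unbounded_le by blast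
    then show ?thesis using fg by (intro exI[of _ M]) simp
  qed
  have "g l \<in> S" for l
  proof -
    obtain M where "\<forall>k<Suc l. g k = c M k" using g[of "Suc l"] by blast
    then show ?thesis using c[of M l] by simp
  qed
  with g show ?thesis by blast
qed

text \<open>The adjugate over a commutative ring: multilinearity turns an entry of \<open>A\<close>
  times the adjugate into the determinant of \<open>A\<close> with row \<open>c\<close> replaced by
  row \<open>a\<close>, which has two equal rows unless \<open>a = c\<close>.\<close>

lemma right_inverse_of_unit_det:
  fixes A :: "'a::comm_ring_1^'n::finite^'n"
  assumes u: "u * det A = 1"
  shows "\<exists>B. A ** B = mat 1"
proof -
  define adj where "adj = (\<chi> b c. det (\<chi> k. if k = c then axis b 1 else A $ k))"
  have "(\<Sum>b\<in>UNIV. A $ a $ b * adj $ b $ c) = (if a = c then det A else 0)" for a c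
  proof -
    have "(\<Sum>b\<in>UNIV. A $ a $ b * adj $ b $ c) =
        (\<Sum>b\<in>UNIV. det (\<chi> k. if k = c then A $ a $ b *s axis b 1 else A $ k))"
      by (simp add: adj_def det_row_mul)
    also have "\<dots> = det (\<chi> k. if k = c then \<Sum>b\<in>UNIV. A $ a $ b *s axis b 1 else A $ k)"
      by (rule det_linear_row_sum[symmetric]) simp
    also have "(\<Sum>b\<in>UNIV. A $ a $ b *s axis b 1) = A $ a"
      by (simp add: vec_eq_iff axis_def if_distrib[of "\<lambda>x. _ * x"] cong: if_cong)
    also have "det (\<chi> k. if k = c then A $ a else A $ k) = (if a = c then det A else 0)"
    proof (cases "a = c")
      case True
      then have "(\<chi> k. if k = c then A $ a else A $ k) = A" by (simp add: vec_eq_iff)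
      then show ?thesis using True by simp
    next
      case False
      then show ?thesis
        by (simp, intro det_identical_rows[of a c]) (simp_all add: row_def)
    qed
    finally show ?thesis .
  qed
  then have "A ** (\<chi> b c. u * adj $ b $ c) = mat 1"
    using u by (simp add: vec_eq_iff matrix_matrix_mult_def mat_def mult.left_commute[of _ u]
      sum_distrib_left[symmetric])
  then show ?thesis by blast
qed

text \<open>The right inverse \<open>B\<close> again has a unit determinant and thus a right
  inverse, which must be \<open>A\<close>.\<close>

lemma invertible_of_unit_det:
  fixes A :: "'a::comm_ring_1^'n::finite^'n"
  assumes u: "u * det A = 1"
  shows "invertible A"
proof -
  obtain B where B: "A ** B = mat 1" using right_inverse_of_unit_det[OF u] by blast
  then have "det A * det B = 1" by (simp add: det_mul[symmetric])
  then obtain C where C: "B ** C = mat 1" using right_inverse_of_unit_det[of "det A" B] by blast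
  have "A = A ** (B ** C)" by (simp add: C)
  also have "\<dots> = C" by (simp add: matrix_mul_assoc B)
  finally show ?thesis using B C by (auto simp: invertible_def)
qed

lemma fps_invertible_matrix:
  fixes A :: "'a::field fps^'n::finite^'n"
  assumes "det (map_mat (\<lambda>f. fps_nth f 0) A) \<noteq> 0"
  shows "invertible A"
proof (rule invertible_of_unit_det)
  have "fps_nth (det A) 0 \<noteq> 0" using assms by (simp add: det_map_mat[OF ring_hom_on_nth0])
  then show "inverse (det A) * det A = 1" by (rule inverse_mult_eq_1)
qed

text \<open>The approximate solutions have coefficients in the finite set \<open>F\<close>, so a
  limit sequence agrees with solutions of arbitrarily high order on each initial segment.\<close>

lemma lang_arcs:
  fixes G :: "('a::alg_closed_field^'n::finite^'n) set" and D Y Yi :: "'a fps^'n^'n"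
  assumes G: "linear_algebraic_group G" and conn: "connectedin zariski_topology G"
    and def: "defined_over F G" and D: "D \<in> arcs G"
    and Y: "Y ** Yi = mat 1" "Yi ** Y = mat 1" "D ** map_mat (fps_map (\<lambda>x. x ^ q)) Y = Y"
    and q: "q \<ge> 2" and add: "\<And>x y :: 'a. (x + y) ^ q = x ^ q + y ^ q"
    and F: "finite F" "card F = q" "\<And>x. x \<in> F \<Longrightarrow> x ^ q = x" "0 \<in> F"
  shows "\<exists>C. (\<forall>i j l. fps_nth (C $ i $ j) l \<in> F) \<and> invertible C \<and> Y ** C \<in> arcs G"
proof -
  have "\<forall>N. \<exists>c. c \<in> jet_index (Suc N) \<rightarrow>\<^sub>E F \<and> det (\<chi> i j. c (i, j, 0)) \<noteq> 0 \<and>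
     (\<forall>f\<in>vanishing_ideal G. fps_cong (Suc N) (mat_poly_eval fps_const f (Y ** jet_mat (Suc N) c)) 0)"
    (is "\<forall>N. \<exists>c. ?P N c")
  proof
    fix N
    have "\<exists>c\<in>jet_index (Suc N) \<rightarrow>\<^sub>E F. det (\<chi> i j. c (i, j, 0)) \<noteq> 0 \<and>
     (\<forall>f\<in>vanishing_ideal G. fps_cong (Suc N) (mat_poly_eval fps_const f (Y ** jet_mat (Suc N) c)) 0)"
      by (rule lang_jets[OF G conn def D Y q add F(1,2)]) (simp_all add: F(3))
    then show "\<exists>c. ?P N c" unfolding Bex_def .
  qed
  then obtain c where c: "\<forall>N. ?P N (c N)" unfolding choice_iff by (rule exE)
  \<comment> \<open>The matrix of coefficients of \<open>t^l\<close> in the solution of order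
    \<open>Suc N\<close>, padded with \<open>0 \<in> F\<close> beyond that order so that all terms
    lie in one finite set.\<close>
  define d where "d N l = (\<lambda>(i, j). if l < Suc N then c N (i, j, l) else 0)" for N l
  have dF: "d N l \<in> UNIV \<rightarrow>\<^sub>E F" for N l
  proof -
    have "c N (i, j, l) \<in> F" if "l < Suc N" for i j
      using c that by (auto simp: jet_index_def PiE_iff)
    then show ?thesis using F(4) by (auto simp: d_def)
  qed
  have "finite ((UNIV :: ('n \<times> 'n) set) \<rightarrow>\<^sub>E F)" by (rule finite_PiE) (simp_all add: F(1))
  from sequence_compactness[OF this dF]
  obtain g where g0: "(\<forall>l. g l \<in> UNIV \<rightarrow>\<^sub>E F) \<and> (\<forall>N. \<exists>M\<ge>N. \<forall>l<N. g l = d M l)" by (rule exE)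
  have g: "g l \<in> UNIV \<rightarrow>\<^sub>E F" "\<exists>M\<ge>N. \<forall>k<N. g k = d M k" for l N
    using g0 by simp_all
  define C where "C = (\<chi> i j. Abs_fps (\<lambda>l. g l (i, j)))"
  have CF: "fps_nth (C $ i $ j) l \<in> F" for i j l using PiE_mem[OF g(1), of "(i, j)" l] by (simp add: C_def)
  have C_cong: "\<exists>M\<ge>N. \<forall>i j. fps_cong N (C $ i $ j) (jet_mat (Suc M) (c M) $ i $ j)" for N
  proof -
    obtain M where "M \<ge> N" "\<forall>l<N. g l = d M l" using g(2) by blast
    then show ?thesis by (intro exI[of _ M]) (simp add: fps_cong_def C_def d_def)
  qed
  have "invertible C"
  proof (rule fps_invertible_matrix)
    obtain M where "\<forall>i j. fps_cong 1 (C $ i $ j) (jet_mat (Suc M) (c M) $ i $ j)" using C_cong by blast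
    then have "map_mat (\<lambda>f. fps_nth f 0) C = (\<chi> i j. c M (i, j, 0))" by (simp add: vec_eq_iff fps_cong_def)
    then show "det (map_mat (\<lambda>f. fps_nth f 0) C) \<noteq> 0" using c by simp
  qed
  moreover have "mat_poly_eval fps_const f (Y ** C) = 0" if f: "f \<in> vanishing_ideal G" for f
  proof (rule fps_ext)
    fix l
    obtain M where M: "M \<ge> Suc l" "\<forall>i j. fps_cong (Suc l) (C $ i $ j) (jet_mat (Suc M) (c M) $ i $ j)"
      using C_cong by blast
    have "fps_cong (Suc l) (mat_poly_eval fps_const f (Y ** C)) (mat_poly_eval fps_const f (Y ** jet_mat (Suc M) (c M)))"
      by (intro fps_cong_mat_poly_eval fps_cong_matrix_mult fps_cong_refl) (use M(2) in blast)
    moreover have "fps_cong (Suc M) (mat_poly_eval fps_const f (Y ** jet_mat (Suc M) (c M))) 0" using c f by blast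
    ultimately show "fps_nth (mat_poly_eval fps_const f (Y ** C)) l = fps_nth 0 l"
      using M(1) by (simp add: fps_cong_def)
  qed
  moreover have "invertible Y" using Y(1,2) unfolding invertible_def by blast
  ultimately have "Y ** C \<in> arcs G" by (simp add: arcs_def invertible_mult)
  with CF \<open>invertible C\<close> show ?thesis by blast
qed

section \<open>Finite subfields and their Frobenius map\<close>

lemma power_fixed_points:
  fixes F :: "'a::field set"
  assumes n: "n \<ge> 2" and F: "card F = n" "\<And>x. x \<in> F \<Longrightarrow> x ^ n = x"
  shows "F = {x. x ^ n = x}"
proof -
  let ?p = "Polynomial.monom 1 n - Polynomial.monom 1 1 :: 'a poly"
  have "Polynomial.coeff ?p n = 1" using n by simp
  then have p0: "?p \<noteq> 0" by (metis coeff_0 zero_neq_one)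
  have "Polynomial.degree ?p \<le> n"
    using n by (intro Polynomial.degree_diff_le) (auto intro: order_trans[OF Polynomial.degree_monom_le])
  then have "card {x. poly ?p x = 0} \<le> n" using card_poly_roots_bound[OF p0] by linarith
  moreover have "F \<subseteq> {x. poly ?p x = 0}" using F(2) by (auto simp: poly_monom)
  ultimately have "F = {x. poly ?p x = 0}"
    using F(1) by (intro card_seteq[OF poly_roots_finite[OF p0]]) simp_all
  then show ?thesis by (simp add: poly_monom)
qed

lemma
  fixes F :: "'a::field set"
  assumes "subfield F ring_of_type_algebra"
  shows subfield_type_0: "0 \<in> F" and subfield_type_1: "1 \<in> F"
    and subfield_type_add: "x \<in> F \<Longrightarrow> y \<in> F \<Longrightarrow> x + y \<in> F"
    and subfield_type_mult: "x \<in> F \<Longrightarrow> y \<in> F \<Longrightarrow> x * y \<in> F"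
proof -
  have "subring F ring_of_type_algebra" by (rule subfieldE(1)[OF assms])
  from subringE[OF this] show "0 \<in> F" "1 \<in> F"
    "x \<in> F \<Longrightarrow> y \<in> F \<Longrightarrow> x + y \<in> F" "x \<in> F \<Longrightarrow> y \<in> F \<Longrightarrow> x * y \<in> F"
    by (simp_all add: ring_of_type_algebra_def)
qed

context
  fixes F :: "'a::field set" and q :: nat
  assumes q: "primepow q" and F: "subfield F ring_of_type_algebra" and card: "card F = q"
begin

lemma q_ge_2: "q \<ge> 2"
  using primepow_gt_Suc_0[OF q] by simp

lemma finite_subfield: "finite F"
  by (rule card_ge_0_finite) (use card q_ge_2 in simp)

lemma finite_subfield_power: "x \<in> F \<Longrightarrow> x ^ q = x"
proof (cases "x = 0")
  case True
  then show ?thesis using q_ge_2 by (simp add: power_0_left)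
next
  case False
  assume x: "x \<in> F"
  let ?S = "F - {0}"
  have fin: "finite ?S" using finite_subfield by simp
  have "inj_on ((*) x) ?S" using False by (simp add: inj_on_def)
  moreover have "(\<lambda>y. x * y) ` ?S \<subseteq> ?S"
  proof (rule image_subsetI)
    fix y assume "y \<in> ?S"
    then show "x * y \<in> ?S" using subfield_type_mult[OF F x, of y] False by simp
  qed
  ultimately have "bij_betw ((*) x) ?S ?S" using fin by (simp add: bij_betw_def endo_inj_surj)
  then have "(\<Prod>y\<in>?S. x * y) = \<Prod>?S" by (rule prod.reindex_bij_betw)
  then have "x ^ card ?S * \<Prod>?S = \<Prod>?S" by (simp add: prod.distrib)
  moreover have "\<Prod>?S \<noteq> 0" using fin by simp
  ultimately have "x ^ card ?S = 1" by simp
  moreover have "card ?S = q - 1" using subfield_type_0[OF F] card finite_subfield by simp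
  ultimately have "x ^ Suc (q - 1) = x" by simp
  then show ?thesis using q_ge_2 by simp
qed

lemma finite_subfield_iff: "x \<in> F \<longleftrightarrow> x ^ q = x"
proof -
  have "F = {x. x ^ q = x}" by (rule power_fixed_points[OF q_ge_2 card finite_subfield_power])
  then show ?thesis by blast
qed

text \<open>Translation by 1 permutes \<open>F\<close>; comparing the sums of all elements gives
  \<open>q = 0\<close> in the field, so the characteristic divides the prime power
  \<open>q\<close>.\<close>

lemma finite_subfield_char: "\<exists>k. q = CHAR('a) ^ k \<and> k > 0 \<and> Factorial_Ring.prime CHAR('a)"
proof -
  have inj: "inj_on (\<lambda>x. x + 1) F" by (simp add: inj_on_def)
  have sub: "(\<lambda>x. x + 1) ` F \<subseteq> F"
  proof (rule image_subsetI)
    fix x assume "x \<in> F"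
    then show "x + 1 \<in> F" by (rule subfield_type_add[OF F _ subfield_type_1[OF F]])
  qed
  have "bij_betw (\<lambda>x. x + 1) F F"
    unfolding bij_betw_def using inj endo_inj_surj[OF finite_subfield sub inj] by (rule conjI)
  then have "(\<Sum>x\<in>F. x + 1) = (\<Sum>x\<in>F. x)" by (rule sum.reindex_bij_betw)
  also have "(\<Sum>x\<in>F. x + 1) = (\<Sum>x\<in>F. x) + of_nat (card F)" unfolding sum.distrib by simp
  finally have "(of_nat q :: 'a) = 0" using card by (simp only: add_cancel_left_right)
  then have dvd: "CHAR('a) dvd q" by (simp add: of_nat_eq_0_iff_char_dvd)
  then have pr: "Factorial_Ring.prime CHAR('a)" 
  proof (intro prime_CHAR_semidom Nat.gr0I)
    assume "CHAR('a) = 0"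
    with dvd q_ge_2 show False by simp
  qed
  obtain p k where pk: "Factorial_Ring.prime p" "k > 0" "q = p ^ k" using q unfolding primepow_def by auto
  have "CHAR('a) dvd p" using prime_dvd_power[OF pr] dvd unfolding pk(3) by simp
  then have "CHAR('a) = p" using pr pk(1) by (simp add: primes_dvd_imp_eq)
  then show ?thesis using pk by auto
qed

lemma power_q_add: "(x + y :: 'a) ^ q = x ^ q + y ^ q"
proof -
  obtain k where "q = CHAR('a) ^ k" "Factorial_Ring.prime CHAR('a)" using finite_subfield_char by auto
  then show ?thesis using freshmans_dream'[of q k x y] by simp
qed

lemma finite_subfield_gen: "\<exists>a\<in>F. \<forall>x\<in>F. x = 0 \<or> (\<exists>i. x = a ^ i)"
proof -
  let ?R = "ring_of_type_algebra :: 'a ring"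
  interpret R: Ring.field ?R by (rule field_from_type_algebra)
  interpret K: Ring.field "?R\<lparr>carrier := F\<rparr>" by (rule R.subfield_iff(2)[OF F])
  have pow: "a [^]\<^bsub>?R\<lparr>carrier := F\<rparr>\<^esub> i = a ^ i" for a and i :: nat
    by (induction i) (simp_all add: nat_pow_def ring_of_type_algebra_def mult.commute)
  have "finite (carrier (?R\<lparr>carrier := F\<rparr>))" using finite_subfield by simp
  from K.finite_field_mult_group_has_gen[OF this] obtain a where
    a: "a \<in> carrier (Multiplicative_Group.mult_of (?R\<lparr>carrier := F\<rparr>))"
    "carrier (Multiplicative_Group.mult_of (?R\<lparr>carrier := F\<rparr>)) =
      {a [^]\<^bsub>?R\<lparr>carrier := F\<rparr>\<^esub> i | i::nat. i \<in> UNIV}" by (rule bexE)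
  have *: "carrier (Multiplicative_Group.mult_of (?R\<lparr>carrier := F\<rparr>)) = F - {0}"
    by (simp add: ring_of_type_algebra_def)
  from a(2) have "F - {0} = range (\<lambda>i. a ^ i)" unfolding * pow by auto
  moreover have "a \<in> F" using a(1) unfolding * by simp
  ultimately show ?thesis by (intro bexI[of _ a]) auto
qed

end

section \<open>The valuation ring and its residue field\<close>

context
  fixes v :: "'a::field \<Rightarrow> real"
  assumes v: "nonarch_abs v"
begin

lemma nonarch_abs_basic:
  shows "0 \<le> v x" "v x = 0 \<longleftrightarrow> x = 0" "v (x * y) = v x * v y" "v (x + y) \<le> max (v x) (v y)"
  using v unfolding nonarch_abs_def by blast+

lemma nonarch_abs_1: "v 1 = 1"
proof -
  have "v 1 * v 1 = v 1" using nonarch_abs_basic(3)[of 1 1] by simp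
  then show ?thesis using nonarch_abs_basic(2)[of 1] by simp
qed

lemma nonarch_abs_minus: "v (- x) = v x"
  using nonarch_abs_basic(3)[of "- 1" x] nonarch_abs_minus_one[OF v] by simp

lemma nonarch_abs_power: "v (x ^ n) = v x ^ n"
  by (induction n) (simp_all add: nonarch_abs_1 nonarch_abs_basic(3))

lemma nonarch_abs_sum:
  "(\<And>i. i \<in> I \<Longrightarrow> v (f i) \<le> B) \<Longrightarrow> 0 \<le> B \<Longrightarrow> v (sum f I) \<le> B"
proof (induction I rule: infinite_finite_induct)
  case (insert i I)
  then show ?case using nonarch_abs_basic(4)[of "f i" "sum f I"] by (simp add: order_trans)
qed (simp_all add: nonarch_abs_basic(2)[THEN iffD2])

lemma valuation_ring_closed:
  shows "0 \<in> valuation_ring v" "1 \<in> valuation_ring v"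
    and "x \<in> valuation_ring v \<Longrightarrow> y \<in> valuation_ring v \<Longrightarrow> x + y \<in> valuation_ring v"
    and "x \<in> valuation_ring v \<Longrightarrow> y \<in> valuation_ring v \<Longrightarrow> x * y \<in> valuation_ring v"
    and "x \<in> valuation_ring v \<Longrightarrow> - x \<in> valuation_ring v"
  using nonarch_abs_basic(4)[of x y]
  by (auto simp: valuation_ring_def nonarch_abs_1 nonarch_abs_minus nonarch_abs_basic(1,3)
      nonarch_abs_basic(2)[THEN iffD2] mult_le_one)

lemma valuation_ring_fixed: "x ^ q = x \<Longrightarrow> q \<ge> 2 \<Longrightarrow> x \<in> valuation_ring v"
proof (rule ccontr)
  assume "x ^ q = x" "q \<ge> 2" "x \<notin> valuation_ring v"
  then have "v x > 1" "v x ^ q = v x" by (simp_all add: valuation_ring_def flip: nonarch_abs_power)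
  moreover have "v x ^ 1 < v x ^ q" using \<open>v x > 1\<close> \<open>q \<ge> 2\<close> by (intro power_strict_increasing) auto
  ultimately show False by simp
qed

text \<open>Composing with the residue map turns the embedding into a map on elements of the
  valuation ring, so that cosets do not appear later.\<close>

lemma residue_hom:
  assumes "residue_field_embeds v"
  shows "\<exists>\<rho>. ring_hom_on (valuation_ring v) \<rho> \<and> (\<forall>x. v x < 1 \<longrightarrow> \<rho> x = (0 :: 'a))"
proof -
  let ?K = "ring_of_type_algebra :: 'a ring"
  let ?O = "?K\<lparr>carrier := valuation_ring v\<rparr>"
  let ?m = "maximal_ideal v"
  interpret K: Ring.field ?K by (rule field_from_type_algebra)
  have neg: "\<ominus>\<^bsub>?K\<^esub> x = - x" for x
    by (rule K.minus_equality) (simp_all add: ring_of_type_algebra_def)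
  have O: "subring (valuation_ring v) ?K"
    by (rule K.subringI, unfold neg)
      (auto simp: ring_of_type_algebra_def valuation_ring_closed)
  interpret O: ring ?O by (rule K.subring_is_ring[OF O])
  have small: "x \<in> ?m \<Longrightarrow> y \<in> ?m \<Longrightarrow> x + y \<in> ?m" "x \<in> ?m \<Longrightarrow> - x \<in> ?m" "0 \<in> ?m"
    "?m \<subseteq> valuation_ring v" for x y
    using nonarch_abs_basic(4)[of x y] nonarch_abs_basic(2)[of 0]
    by (auto simp: maximal_ideal_def valuation_ring_def nonarch_abs_minus)
  have small_mult: "a * x \<in> ?m" if "a \<in> ?m" "x \<in> valuation_ring v" for a x
  proof -
    have "v a * v x \<le> v a * 1" using that by (intro mult_left_mono) (simp_all add: valuation_ring_def nonarch_abs_basic(1))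
    then show ?thesis using that by (simp add: maximal_ideal_def nonarch_abs_basic(3))
  qed
  have ideal: "ideal ?m ?O"
  proof (rule idealI[OF O.ring_axioms])
    show "subgroup ?m (add_monoid ?O)"
    proof (rule O.add.subgroupI)
      fix a assume a: "a \<in> ?m"
      have "\<ominus>\<^bsub>?O\<^esub> a = - a"
        by (rule O.minus_equality) (use a small valuation_ring_closed in \<open>auto simp: ring_of_type_algebra_def\<close>)
      then show "\<ominus>\<^bsub>?O\<^esub> a \<in> ?m" using a small by simp
    qed (use small in \<open>auto simp: ring_of_type_algebra_def\<close>)
  qed (use small_mult in \<open>auto simp: ring_of_type_algebra_def mult.commute\<close>)
  obtain h where h: "h \<in> ring_hom (?O Quot ?m) ?K"
    using assms unfolding residue_field_embeds_def residue_field_def by blast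
  define \<rho> where "\<rho> x = h (?m +>\<^bsub>?O\<^esub> x)" for x
  have "h \<circ> (+>\<^bsub>?O\<^esub>) ?m \<in> ring_hom ?O ?K"
    by (rule ring_hom_trans[OF ideal.rcos_ring_hom[OF ideal] h])
  then have hom: "\<And>x y. x \<in> valuation_ring v \<Longrightarrow> y \<in> valuation_ring v \<Longrightarrow> \<rho> (x + y) = \<rho> x + \<rho> y"
    "\<And>x y. x \<in> valuation_ring v \<Longrightarrow> y \<in> valuation_ring v \<Longrightarrow> \<rho> (x * y) = \<rho> x * \<rho> y" "\<rho> 1 = 1"
    by (simp_all add: ring_hom_def \<rho>_def ring_of_type_algebra_def)
  have "\<rho> 0 + \<rho> 0 = \<rho> 0" using hom(1)[of 0 0] by (simp add: valuation_ring_closed)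
  then have \<rho>0: "\<rho> 0 = 0" unfolding add_cancel_left_right .
  have "\<rho> x = 0" if x: "v x < 1" for x
  proof -
    have "?m +>\<^bsub>?O\<^esub> x = ?m +>\<^bsub>?O\<^esub> 0"
      unfolding a_r_coset_def r_coset_def
    proof (rule Set.set_eqI)
      have xm: "x \<in> ?m" using x by (simp add: maximal_ideal_def)
      fix y
      have "(\<exists>z\<in>?m. y = z + x) \<longleftrightarrow> y \<in> ?m"
      proof
        assume "y \<in> ?m"
        then have "y + - x \<in> ?m" by (intro small xm)
        then show "\<exists>z\<in>?m. y = z + x" by (intro bexI[of _ "y + - x"]) simp_all
      qed (use small(1) xm in blast)
      then show "y \<in> (\<Union>h\<in>?m. {h \<otimes>\<^bsub>add_monoid ?O\<^esub> x}) \<longleftrightarrow> y \<in> (\<Union>h\<in>?m. {h \<otimes>\<^bsub>add_monoid ?O\<^esub> 0})"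
        by (simp add: ring_of_type_algebra_def)
    qed
    then have "\<rho> x = \<rho> 0" by (simp add: \<rho>_def)
    then show ?thesis by (simp add: \<rho>0)
  qed
  moreover have "ring_hom_on (valuation_ring v) \<rho>"
    unfolding ring_hom_on_def by (simp add: valuation_ring_closed hom \<rho>0)
  ultimately show ?thesis by blast
qed

end

text \<open>The images of \<open>0, ..., p - 1\<close> are \<open>p\<close> distinct fixed points of
  the \<open>p\<close>-th power, and there is no room for more.\<close>

lemma prime_field_eq:
  fixes c :: "'a::field"
  assumes p: "Factorial_Ring.prime CHAR('a)" and c: "c ^ CHAR('a) = c"
  shows "\<exists>k. c = of_nat k"
proof -
  let ?p = "CHAR('a)"
  have p2: "?p \<ge> 2" using p by (simp add: prime_ge_2_nat)
  have fixed: "of_nat k ^ ?p = (of_nat k :: 'a)" for k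
  proof (induction k)
    case 0
    show ?case using p2 by (simp add: power_0_left)
  next
    case (Suc k)
    then show ?case using freshmans_dream[OF p refl, of 1 "of_nat k"] by simp
  qed
  have "inj_on (of_nat :: nat \<Rightarrow> 'a) {..<?p}"
  proof (rule linorder_inj_onI)
    fix i j assume ij: "i < j" "i \<in> {..<?p}" "j \<in> {..<?p}"
    show "of_nat i \<noteq> (of_nat j :: 'a)"
    proof
      assume "of_nat i = (of_nat j :: 'a)"
      then have "of_nat (j - i) = (0 :: 'a)" using ij(1) by (simp add: of_nat_diff)
      then have "?p dvd j - i" by (simp add: of_nat_eq_0_iff_char_dvd)
      then show False using ij by (auto dest: dvd_imp_le)
    qed
  qed auto
  then have "card ((of_nat :: nat \<Rightarrow> 'a) ` {..<?p}) = ?p" by (simp add: card_image)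
  then have "(of_nat :: nat \<Rightarrow> 'a) ` {..<?p} = {x. x ^ ?p = x}"
    by (rule power_fixed_points[OF p2]) (use fixed in auto)
  with c show ?thesis by blast
qed

text \<open>
  A homomorphism from the residue field to \<open>K\<close> may act on \<open>F\<close> by an automorphism. That automorphism is a
  power of the Frobenius, since the minimal polynomial \<open>P\<close> of a generator \<open>a\<close> over the prime field has
  only the conjugates \<open>a ^ (p ^ i)\<close> as roots; composing with a further power of the Frobenius makes it
  trivial.
\<close>

lemma residue_hom_fixing:
  fixes F :: "'a::alg_closed_field set" and v :: "'a \<Rightarrow> real"
  assumes v: "nonarch_abs v" and emb: "residue_field_embeds v"
    and q: "primepow q" and F: "subfield F ring_of_type_algebra" and card: "card F = q"
  shows "\<exists>\<rho>. ring_hom_on (valuation_ring v) \<rho> \<and> (\<forall>x. v x < 1 \<longrightarrow> \<rho> x = (0 :: 'a)) \<and> (\<forall>x\<in>F. \<rho> x = x)"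
proof -
  obtain \<rho> where \<rho>: "ring_hom_on (valuation_ring v) \<rho>" "\<forall>x. v x < 1 \<longrightarrow> \<rho> x = (0 :: 'a)"
    using residue_hom[OF v emb] by blast
  note r = ring_hom_on_basic[OF \<rho>(1)]
  let ?p = "CHAR('a)"
  obtain k where k: "q = ?p ^ k" "k > 0" and p: "Factorial_Ring.prime ?p"
    using finite_subfield_char[OF q F card] by auto
  have p2: "?p \<ge> 2" using p by (simp add: prime_ge_2_nat)
  note frob_add = freshmans_dream[OF p refl]
  have frob_diff: "(x - y) ^ ?p = x ^ ?p - y ^ ?p" for x y :: 'a
    using frob_add[of "x - y" y] by simp
  note fixed = finite_subfield_power[OF q F card]
  have F_O: "x \<in> valuation_ring v" if "x \<in> F" for x
    by (rule valuation_ring_fixed[OF v fixed[OF that] q_ge_2[OF q F card]])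
  obtain a where a: "a \<in> F" "\<forall>x\<in>F. x = 0 \<or> (\<exists>i. x = a ^ i)" using finite_subfield_gen[OF q F card] by blast
  have powF: "x ^ i \<in> F" if "x \<in> F" for x i
    using that by (induction i) (simp_all add: subfield_type_1[OF F] subfield_type_mult[OF F])
  define S where "S = range (\<lambda>i. a ^ (?p ^ i))"
  have SF: "S \<subseteq> F" using powF[OF a(1)] by (auto simp: S_def)
  have finS: "finite S" using SF finite_subfield[OF q F card] by (rule finite_subset)
  have "(\<lambda>s. s ^ ?p) ` S \<subseteq> S"
  proof (rule image_subsetI)
    fix s assume "s \<in> S"
    then obtain i where "s = a ^ (?p ^ i)" by (auto simp: S_def)
    then have "s ^ ?p = a ^ (?p ^ Suc i)" by (simp add: power_mult[symmetric] mult.commute)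
    then show "s ^ ?p \<in> S" unfolding S_def by blast
  qed
  moreover have "inj_on (\<lambda>s. s ^ ?p) S"
  proof (rule inj_onI)
    fix s t :: 'a assume "s ^ ?p = t ^ ?p"
    then have "(s - t) ^ ?p = 0" by (simp add: frob_diff)
    then show "s = t" by simp
  qed
  ultimately have bij: "bij_betw (\<lambda>s. s ^ ?p) S S"
    unfolding bij_betw_def using endo_inj_surj[OF finS] by blast
  define P where "P = (\<Prod>s\<in>S. [:- s, 1:])"
  have polyP: "poly P x = (\<Prod>s\<in>S. x - s)" for x by (simp add: P_def poly_prod)
  \<comment> \<open>The Frobenius map permutes the set \<open>S\<close> of conjugates of
    \<open>a\<close>, so \<open>P\<close> commutes with it; this forces the coefficients of
    \<open>P\<close> into the prime field.\<close>
  have polyP_frob: "poly P x ^ ?p = poly P (x ^ ?p)" for x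
  proof -
    have "poly P x ^ ?p = (\<Prod>s\<in>S. x ^ ?p - s ^ ?p)" by (simp add: polyP prod_power_distrib frob_diff)
    also have "\<dots> = (\<Prod>s\<in>S. x ^ ?p - s)" by (rule prod.reindex_bij_betw[OF bij])
    finally show ?thesis by (simp add: polyP)
  qed
  let ?d = "Polynomial.degree P" and ?a = "Polynomial.coeff P"
  \<comment> \<open>The difference between \<open>P\<close> with Frobenius applied to its
    coefficients and \<open>P\<close> itself. It vanishes at every \<open>y\<close>, since every
    \<open>y\<close> is a \<open>p\<close>-th power, and the field is infinite.\<close>
  define Q where "Q = (\<Sum>i\<le>?d. Polynomial.monom (?a i ^ ?p - ?a i) i)"
  have "poly Q y = 0" for y
  proof -
    obtain x where x: "x ^ ?p = y" using nth_root_exists[of ?p y] p2 by auto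
    have "poly P x ^ ?p = (\<Sum>i\<le>?d. (?a i * x ^ i) ^ ?p)"
      unfolding poly_altdef by (rule freshmans_dream_sum[OF p refl])
    also have "\<dots> = (\<Sum>i\<le>?d. ?a i ^ ?p * y ^ i)"
      unfolding x[symmetric] by (simp add: power_mult_distrib power_mult[symmetric] mult.commute)
    finally have "poly P y = (\<Sum>i\<le>?d. ?a i ^ ?p * y ^ i)"
      unfolding polyP_frob x .
    then have "(\<Sum>i\<le>?d. ?a i ^ ?p * y ^ i) =
        (\<Sum>i\<le>?d. ?a i * y ^ i)"
      unfolding poly_altdef by (rule sym)
    then show ?thesis by (simp add: Q_def poly_sum poly_monom left_diff_distrib sum_subtractf)
  qed
  then have "Q = 0" using poly_roots_finite[of Q] infinite_UNIV_alg_closed[where 'a = 'a] by auto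
  have "\<exists>k. ?a i = of_nat k" if i: "i \<le> ?d" for i
  proof (rule prime_field_eq[OF p])
    have "Polynomial.coeff Q i = ?a i ^ ?p - ?a i"
      using i by (simp add: Q_def Polynomial.coeff_sum)
    then show "?a i ^ ?p = ?a i" using \<open>Q = 0\<close> by simp
  qed
  moreover have nat: "of_nat n \<in> valuation_ring v \<and> \<rho> (of_nat n) = of_nat n" for n
    by (induction n) (simp_all add: r)
  ultimately have coeff: "?a i \<in> valuation_ring v \<and> \<rho> (?a i) = ?a i"
    if "i \<le> ?d" for i using that by metis
  have aO: "a \<in> valuation_ring v" by (rule F_O[OF a(1)])
  note pow = ring_hom_on_power[OF \<rho>(1)]
  have "poly P (\<rho> a) = (\<Sum>i\<le>?d. \<rho> (?a i * a ^ i))"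
    unfolding poly_altdef using coeff pow[OF aO] by (intro sum.cong) (simp_all add: r)
  also have "\<dots> = \<rho> (poly P a)"
    unfolding poly_altdef
    using ring_hom_on_sum[OF \<rho>(1), of "{..?d}" "\<lambda>i. ?a i * a ^ i"] coeff pow[OF aO]
    by (simp add: r)
  also have "a \<in> S" unfolding S_def by (rule range_eqI[of _ _ 0]) simp
  then have "poly P a = 0" using finS by (auto simp: polyP)
  finally have "poly P (\<rho> a) = 0" by (simp add: r)
  then have "\<rho> a \<in> S" using finS by (simp add: polyP)
  then obtain i where i: "\<rho> a = a ^ (?p ^ i)" by (auto simp: S_def)
  \<comment> \<open>Chosen so that \<open>p^i j = p^(i k) = q^i\<close>: the two Frobenius powers
    together then act trivially on \<open>F\<close>.\<close>
  define j where "j = ?p ^ (i * (k - 1))"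
  have j: "j > 0" using p2 by (simp add: j_def)
  have iter: "x ^ (q ^ n) = x" if "x \<in> F" for x n
    by (induction n) (simp_all add: power_mult fixed[OF that])
  have "?p ^ i * j = q ^ i"
  proof -
    have "i + i * (k - 1) = k * i" using k(2) by (cases k) (simp_all add: algebra_simps)
    then show ?thesis by (simp add: j_def k(1) power_add[symmetric] power_mult[symmetric])
  qed
  then have \<rho>a: "\<rho> a ^ j = a" by (simp add: i power_mult[symmetric] iter[OF a(1)])
  have jadd: "(x + y) ^ j = x ^ j + y ^ j" for x y :: 'a
    by (rule freshmans_dream'[OF p j_def])
  show ?thesis
  proof (intro exI[of _ "\<lambda>x. \<rho> x ^ j"] conjI allI impI ballI)
    show "ring_hom_on (valuation_ring v) (\<lambda>x. \<rho> x ^ j)"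
      unfolding ring_hom_on_def using j by (simp add: r jadd power_mult_distrib power_0_left)
    show "\<rho> x ^ j = 0" if "v x < 1" for x using \<rho>(2) that j by (simp add: power_0_left)
    fix x assume "x \<in> F"
    then consider "x = 0" | n where "x = a ^ n" using a(2) by blast
    then show "\<rho> x ^ j = x"
    proof cases
      case 1
      then show ?thesis using j by (simp add: r power_0_left)
    next
      case 2
      have "\<rho> (a ^ n) ^ j = (\<rho> a ^ j) ^ n" using pow[OF aO] by (simp add: power_mult[symmetric] mult.commute)
      then show ?thesis by (simp add: 2 \<rho>a)
    qed
  qed
qed

section \<open>Restricted power series\<close>

definition restricted_fps :: "('a::field \<Rightarrow> real) \<Rightarrow> 'a fps set" where
  "restricted_fps v = {f. (\<lambda>n. v (fps_nth f n)) \<longlonglongrightarrow> 0}"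

lemma restricted_fps_eventually_zero:
  assumes "nonarch_abs v" "\<And>n. n \<ge> N \<Longrightarrow> fps_nth f n = 0"
  shows "f \<in> restricted_fps v"
proof -
  have "eventually (\<lambda>n. v (fps_nth f n) = 0) sequentially"
    using assms(2) nonarch_abs_basic(2)[OF assms(1), of 0]
    by (intro eventually_sequentiallyI[of N]) simp
  then show ?thesis unfolding restricted_fps_def mem_Collect_eq by (rule tendsto_eventually)
qed

text \<open>In a late coefficient of the product each term has one small factor and one bounded
  factor, and the ultrametric inequality bounds the sum by its largest term.\<close>

lemma restricted_fps_mult:
  assumes v: "nonarch_abs v" and f: "f \<in> restricted_fps v" and g: "g \<in> restricted_fps v"
  shows "f * g \<in> restricted_fps v"
proof -
  note nn = nonarch_abs_basic(1)[OF v]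
  have bnd: "\<exists>B>0. \<forall>n. v (fps_nth h n) \<le> B" if "h \<in> restricted_fps v" for h
  proof -
    have "Bseq (\<lambda>n. v (fps_nth h n))"
      using that by (intro convergent_imp_Bseq convergentI) (simp add: restricted_fps_def)
    then obtain B where "B > 0" "\<forall>n. norm (v (fps_nth h n)) \<le> B" by (rule BseqE)
    then show ?thesis using nn by (intro exI[of _ B]) simp
  qed
  obtain A where A: "A > 0" "\<And>n. v (fps_nth f n) \<le> A" using bnd[OF f] by blast
  obtain B where B: "B > 0" "\<And>n. v (fps_nth g n) \<le> B" using bnd[OF g] by blast
  have ev: "\<exists>N. \<forall>n\<ge>N. v (fps_nth h n) \<le> \<epsilon>" if "h \<in> restricted_fps v" "\<epsilon> > 0" for h \<epsilon>
  proof -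
    have "eventually (\<lambda>n. v (fps_nth h n) < \<epsilon>) sequentially"
      using that by (intro order_tendstoD(2)[of _ 0]) (simp_all add: restricted_fps_def)
    then show ?thesis unfolding eventually_sequentially by (meson less_imp_le)
  qed
  have "(\<lambda>n. v (fps_nth (f * g) n)) \<longlonglongrightarrow> 0"
  proof (rule LIMSEQ_I)
    fix r :: real assume r: "r > 0"
    obtain M where M: "\<And>n. n \<ge> M \<Longrightarrow> v (fps_nth f n) \<le> r / 2 / B" using ev[OF f, of "r / 2 / B"] r B(1) by auto
    obtain N where N: "\<And>n. n \<ge> N \<Longrightarrow> v (fps_nth g n) \<le> r / 2 / A" using ev[OF g, of "r / 2 / A"] r A(1) by auto
    have "v (fps_nth (f * g) n) \<le> r / 2" if n: "n \<ge> M + N" for n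
      unfolding fps_mult_nth
    proof (rule nonarch_abs_sum[OF v])
      fix i assume "i \<in> {0..n}"
      then consider "i \<ge> M" | "n - i \<ge> N" using n by force
      then show "v (fps_nth f i * fps_nth g (n - i)) \<le> r / 2"
      proof cases
        case 1
        then have "v (fps_nth f i) * v (fps_nth g (n - i)) \<le> r / 2 / B * B"
          using M B nn r by (intro mult_mono) simp_all
        then show ?thesis using B(1) by (simp add: nonarch_abs_basic(3)[OF v])
      next
        case 2
        then have "v (fps_nth f i) * v (fps_nth g (n - i)) \<le> A * (r / 2 / A)"
          using N A nn by (intro mult_mono) simp_all
        then show ?thesis using A(1) by (simp add: nonarch_abs_basic(3)[OF v])
      qed
    qed (use r in simp)
    then have "norm (v (fps_nth (f * g) n) - 0) < r" if "n \<ge> M + N" for n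
      using that r nn[of "fps_nth (f * g) n"] by (simp add: order_le_less_trans[of _ "r / 2"])
    then show "\<exists>no. \<forall>n\<ge>no. norm (v (fps_nth (f * g) n) - 0) < r" by blast
  qed
  then show ?thesis by (simp add: restricted_fps_def)
qed

lemma restricted_fps_ring:
  assumes v: "nonarch_abs v" shows "ring_hom_on (restricted_fps v) (\<lambda>f. f)"
  unfolding ring_hom_on_def
proof (intro conjI ballI refl)
  show "0 \<in> restricted_fps v" by (rule restricted_fps_eventually_zero[OF v, of 0]) simp
  show "1 \<in> restricted_fps v" by (rule restricted_fps_eventually_zero[OF v, of 1]) (simp add: fps_one_nth)
  fix f g assume fg: "f \<in> restricted_fps v" "g \<in> restricted_fps v"
  show "f * g \<in> restricted_fps v" by (rule restricted_fps_mult[OF v fg])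
  have lim: "(\<lambda>n. max (v (fps_nth f n)) (v (fps_nth g n))) \<longlonglongrightarrow> max 0 0"
    using fg by (intro tendsto_max) (simp_all add: restricted_fps_def)
  have "(\<lambda>n. v (fps_nth (f + g) n)) \<longlonglongrightarrow> 0"
  proof (rule tendsto_sandwich[where f = "\<lambda>_. 0"])
    show "(\<lambda>n. max (v (fps_nth f n)) (v (fps_nth g n))) \<longlonglongrightarrow> 0" using lim by simp
  qed (simp_all add: nonarch_abs_basic(1,4)[OF v])
  then show "f + g \<in> restricted_fps v" by (simp add: restricted_fps_def)
qed

text \<open>\<open>ring_hom_on\<close> speaks of sums and products only; \<open>- 1 \<in> R\<close>
  provides the signs of permutations.\<close>

lemma det_in_subring:
  fixes A :: "'a::comm_ring_1^'n::finite^'n"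
  assumes R: "ring_hom_on R (\<lambda>x. x)" "- 1 \<in> R" and A: "A \<in> mat_over R"
  shows "det A \<in> R"
proof -
  note b = ring_hom_on_basic[OF R(1)]
  have *: "of_int (sign p) * (\<Prod>i\<in>UNIV. A $ i $ p i) \<in> R" for p :: "'n \<Rightarrow> 'n"
    using ring_hom_on_prod[OF R(1), of UNIV "\<lambda>i. A $ i $ p i"] A R(2) b
    by (simp add: sign_def mat_over_def)
  show ?thesis unfolding det_def
    by (rule ring_hom_on_sum[OF R(1), THEN conjunct1]) (rule *)
qed

text \<open>By Cramer's rule the determinant clears all denominators at once. This is how inverses
  of matrices of restricted series come to lie in \<open>L\<close>.\<close>

lemma inverse_common_denominator:
  fixes A B :: "'a::idom^'n::finite^'n"
  assumes R: "ring_hom_on R (\<lambda>x. x)" "- 1 \<in> R" and A: "A \<in> mat_over R" and BA: "B ** A = mat 1"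
  shows "\<exists>g\<in>R. g \<noteq> 0 \<and> (\<forall>i j. g * B $ i $ j \<in> R)"
proof (intro bexI[of _ "det A"] conjI allI)
  show "det A \<in> R" by (rule det_in_subring[OF R A])
  show "det A \<noteq> 0" using det_mul[of B A] BA by auto
  fix i j
  have "(\<chi> a b. if a = j then if b = i then 1 else 0 else A $ a $ b) \<in> mat_over R"
    using A ring_hom_on_basic[OF R(1)] by (simp add: mat_over_def)
  from det_in_subring[OF R this] show "det A * B $ i $ j \<in> R"
    unfolding inverse_entry_det[OF BA, symmetric] by (simp add: mult.commute)
qed

section \<open>The descent to \<open>L\<close>\<close>

lemma hom_fps_to_fls: "ring_hom_on UNIV (fps_to_fls :: 'a::comm_ring_1 fps \<Rightarrow> 'a fls)"
  by (rule ring_hom_onI) (simp_all add: fls_times_fps_to_fls)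

lemma mat_over_image:
  assumes "A \<in> mat_over (h ` S)" shows "\<exists>a\<in>mat_over S. A = map_mat h a"
proof -
  have "\<forall>i. \<forall>j. \<exists>x. x \<in> S \<and> A $ i $ j = h x" using assms by (auto simp: mat_over_def)
  then obtain f where "\<forall>i j. f i j \<in> S \<and> A $ i $ j = h (f i j)" unfolding choice_iff by blast
  then show ?thesis
    by (intro bexI[of _ "\<chi> i j. f i j"]) (simp_all add: vec_eq_iff mat_over_def)
qed

lemma map_fps_to_fls_inj: "map_mat fps_to_fls a = map_mat fps_to_fls b \<longleftrightarrow> a = b"
  by (simp add: vec_eq_iff)

lemma GL_over_fps_to_fls:
  fixes A :: "'a::field fls^'n::finite^'n"
  shows "A \<in> GL_over (fps_to_fls ` S) \<longleftrightarrow>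
    (\<exists>a\<in>mat_over S. \<exists>b\<in>mat_over S. A = map_mat fps_to_fls a \<and> a ** b = mat 1 \<and> b ** a = mat 1)"
proof
  note hm = map_mat_mult(2)[OF hom_fps_to_fls, simplified, symmetric]
  note h1 = map_mat_1[OF hom_fps_to_fls, symmetric]
  assume "A \<in> GL_over (fps_to_fls ` S)"
  then obtain B where B: "A \<in> mat_over (fps_to_fls ` S)" "B \<in> mat_over (fps_to_fls ` S)" "A ** B = mat 1" "B ** A = mat 1"
    unfolding GL_over_def by blast
  obtain a where a: "a \<in> mat_over S" "A = map_mat fps_to_fls a" using mat_over_image[OF B(1)] by blast
  obtain b where b: "b \<in> mat_over S" "B = map_mat fps_to_fls b" using mat_over_image[OF B(2)] by blast
  have "a ** b = mat 1" "b ** a = mat 1"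
    using B(3,4) unfolding a(2) b(2) hm h1 map_fps_to_fls_inj .
  with a b show "\<exists>a\<in>mat_over S. \<exists>b\<in>mat_over S. A = map_mat fps_to_fls a \<and> a ** b = mat 1 \<and> b ** a = mat 1"
    by blast
next
  note hm = map_mat_mult(2)[OF hom_fps_to_fls, simplified, symmetric]
  assume "\<exists>a\<in>mat_over S. \<exists>b\<in>mat_over S. A = map_mat fps_to_fls a \<and> a ** b = mat 1 \<and> b ** a = mat 1"
  then obtain a b where ab: "a \<in> mat_over S" "b \<in> mat_over S" "A = map_mat fps_to_fls a" "a ** b = mat 1" "b ** a = mat 1"
    by blast
  show "A \<in> GL_over (fps_to_fls ` S)"
    unfolding GL_over_def
    by (intro CollectI conjI bexI[of _ "map_mat fps_to_fls b"])
      (use ab in \<open>auto simp: mat_over_def hm map_mat_1[OF hom_fps_to_fls]\<close>)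
qed

lemma frob_mat_fps_to_fls:
  assumes "q > 0"
  shows "frob_mat q (map_mat fps_to_fls a) = map_mat fps_to_fls (map_mat (fps_map (\<lambda>x. x ^ q)) a)"
proof -
  have "frob q (fps_to_fls f) = fps_to_fls (fps_map (\<lambda>x. x ^ q) f)" for f :: "'a fps"
    using assms by (intro fls_eqI) (simp add: fls_nth_frob power_0_left)
  then show ?thesis by (simp add: frob_mat_def vec_eq_iff)
qed

lemma mat_poly_eval_fps_to_fls:
  "mat_poly_eval fls_const f (map_mat fps_to_fls a) = fps_to_fls (mat_poly_eval fps_const f a)"
  using mat_poly_eval_hom[OF hom_fps_to_fls, of fps_const f a] by simp

lemma map_mat_fixed_inverse:
  fixes A B :: "'a::comm_ring_1^'n::finite^'n"
  assumes h: "ring_hom_on UNIV h" and "map_mat h A = A" "A ** B = mat 1" "B ** A = mat 1"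
  shows "map_mat h B = B"
proof -
  have "A ** map_mat h B = mat 1"
    using map_mat_mult(2)[OF h, of A B] assms(2,3) by (simp add: map_mat_1[OF h])
  then have "B ** (A ** map_mat h B) = B" by simp
  then show ?thesis by (simp add: matrix_mul_assoc assms(4))
qed

theorem theorem4p6:
  fixes v :: "'a::alg_closed_field \<Rightarrow> real"
    and k F :: "'a set"
    and q :: nat
    and G :: "('a^'n::finite^'n) set"
    and D :: "'a fls^'n^'n"
  assumes "primepow q"
    and "subfield k ring_of_type_algebra"
    and "subfield F ring_of_type_algebra" and "card F = q" and "F \<subseteq> k"
    and "nonarch_abs v" and "nontrivial_on v k"
    and "completed_algebraic_closure_of v k"
    and "residue_field_embeds v"
    and "linear_algebraic_group G" and "connectedin zariski_topology G" and "defined_over F G"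
    and "D \<in> group_points F G (integral_series v)"
    and "\<forall>l>0. mat_max_norm v (mat_coeff D l) < 1"
    and "\<exists>Y \<in> GL_over (integral_series v) \<inter> mat_over (integral_restricted_series v).
           D ** frob_mat q Y = Y"
  shows "\<exists>Y' \<in> group_points F G (quot_restricted_series v \<inter> integral_series v).
           D ** frob_mat q Y' = Y'"
proof -
  note q = assms(1) and F = assms(3) and card = assms(4) and v = assms(6) and G = assms(10)
  note q2 = q_ge_2[OF q F card]
  have sub: "subgroup G GL_group" using G by (simp add: linear_algebraic_group_def)
  define IS where "IS = {f :: 'a fps. \<forall>n. fps_nth f n \<in> valuation_ring v}"
  define RS where "RS = restricted_fps v"
  have series: "integral_series v = fps_to_fls ` IS" "restricted_series v = fps_to_fls ` RS"
    "integral_restricted_series v = fps_to_fls ` (IS \<inter> RS)"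
    by (auto simp: integral_series_def restricted_series_def integral_restricted_series_def IS_def RS_def
        restricted_fps_def)
  have hRS: "ring_hom_on RS (\<lambda>f. f)" unfolding RS_def by (rule restricted_fps_ring[OF v])
  have const_RS: "fps_const c \<in> RS" for c
    unfolding RS_def by (rule restricted_fps_eventually_zero[OF v, of 1]) simp
  have m1_RS: "- 1 \<in> RS" using const_RS[of "- 1"] by (simp flip: fps_const_neg)
  note hm = map_mat_mult(2)[OF hom_fps_to_fls, simplified, symmetric]
  let ?fr = "map_mat (fps_map (\<lambda>x :: 'a. x ^ q)) :: 'a fps^'n^'n \<Rightarrow> 'a fps^'n^'n"
  let ?c = "map_mat fps_const :: 'a^'n^'n \<Rightarrow> 'a fps^'n^'n"
  let ?z = "map_mat (\<lambda>f. fps_nth f 0) :: 'a fps^'n^'n \<Rightarrow> 'a^'n^'n"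
  let ?fz = "map_mat (\<lambda>x. x ^ q) :: 'a^'n^'n \<Rightarrow> 'a^'n^'n"
  note cm = map_mat_mult(2)[OF hom_fps_const, simplified, symmetric]
  note zm = map_mat_mult(2)[OF ring_hom_on_nth0, simplified]
  have hq: "ring_hom_on UNIV (\<lambda>x :: 'a. x ^ q)"
    by (rule ring_hom_onI) (use q2 power_q_add[OF q F card] in \<open>simp_all add: power_mult_distrib power_0_left\<close>)
  have hfr: "ring_hom_on UNIV (fps_map (\<lambda>x :: 'a. x ^ q))"
    using ring_hom_on_fps_map[OF hq] by simp
  note frm = map_mat_mult(2)[OF hfr, simplified]
  have frobF: "frob_mat q (map_mat fps_to_fls a) = map_mat fps_to_fls (?fr a)" for a
    using q2 by (intro frob_mat_fps_to_fls) simp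
  have fr_c: "?fr (?c a) = ?c (?fz a)" for a
    using q2 by (simp add: vec_eq_iff fps_eq_iff power_0_left)
  have fixed: "x ^ q = x" if "x \<in> F" for x by (rule finite_subfield_power[OF q F card that])
  have F_O: "x \<in> valuation_ring v" if "x \<in> F" for x by (rule valuation_ring_fixed[OF v fixed[OF that] q2])
  have fr_fixed: "fps_nth (A $ i $ j) l \<in> F" if "?fr A = A" for A :: "'a fps^'n^'n" and i j l
  proof -
    have "fps_nth (?fr A $ i $ j) l = fps_nth (A $ i $ j) l" using that by simp
    then show ?thesis by (simp add: finite_subfield_iff[OF q F card])
  qed
  obtain d d' where d: "d \<in> mat_over IS" "D = map_mat fps_to_fls d" "d ** d' = mat 1" "d' ** d = mat 1"
    using assms(13) unfolding group_points_def series(1) GL_over_fps_to_fls by blast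
  have "invertible d" using d(3,4) unfolding invertible_def by blast
  moreover have "mat_poly_eval fps_const f d = 0" if "f \<in> vanishing_ideal G" for f
  proof (rule vanishing_ideal_defined_over[OF assms(12) hom_fps_const _ that])
    fix f assume "f \<in> vanishing_ideal G \<inter> mat_polys_over F"
    then have "mat_poly_eval fls_const f D = 0" using assms(13) by (simp add: group_points_def)
    then show "mat_poly_eval fps_const f d = 0" by (simp add: d(2) mat_poly_eval_fps_to_fls)
  qed
  ultimately have d_arcs: "d \<in> arcs G" by (simp add: arcs_def)
  obtain Y where Y: "Y \<in> GL_over (fps_to_fls ` IS)" "Y \<in> mat_over (fps_to_fls ` (IS \<inter> RS))" "D ** frob_mat q Y = Y"
    using assms(15) unfolding series by blast
  obtain y yi where y: "y \<in> mat_over IS" "yi \<in> mat_over IS" "Y = map_mat fps_to_fls y" "y ** yi = mat 1" "yi ** y = mat 1"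
    using Y(1) unfolding GL_over_fps_to_fls by blast
  obtain y' where y': "y' \<in> mat_over (IS \<inter> RS)" "Y = map_mat fps_to_fls y'" using mat_over_image[OF Y(2)] by blast
  \<comment> \<open>\<open>Y\<close> is lifted twice, once with an integral inverse and once as a
    restricted matrix; the embedding of power series is injective, so the lifts agree.\<close>
  have "y = y'" using y(3) y'(2) by (simp add: map_fps_to_fls_inj)
  then have yRS: "y \<in> mat_over RS" using y'(1) by (simp add: mat_over_def)
  have dy: "d ** ?fr y = y"
    using Y(3) unfolding y(3) d(2) frobF hm map_fps_to_fls_inj .
  have "\<exists>C. (\<forall>i j l. fps_nth (C $ i $ j) l \<in> F) \<and> invertible C \<and> y ** C \<in> arcs G"
    by (rule lang_arcs[OF G assms(11,12) d_arcs y(4,5) dy q2 power_q_add[OF q F card]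
        finite_subfield[OF q F card] card _ subfield_type_0[OF F]]) (rule fixed)
  then obtain C :: "'a fps^'n^'n" where C: "\<And>i j l. fps_nth (C $ i $ j) l \<in> F" "invertible C" "y ** C \<in> arcs G" by blast
  obtain Ci where Ci: "C ** Ci = mat 1" "Ci ** C = mat 1" using C(2) unfolding invertible_def by blast
  have frC: "?fr C = C" using C(1) fixed by (simp add: vec_eq_iff fps_eq_iff)
  have C_IS: "C \<in> mat_over IS" using C(1) F_O by (simp add: mat_over_def IS_def)
  define W where "W = y ** C"
  obtain \<rho> where \<rho>: "ring_hom_on (valuation_ring v) \<rho>" "\<And>x. v x < 1 \<Longrightarrow> \<rho> x = 0" "\<And>x. x \<in> F \<Longrightarrow> \<rho> x = x"
    using residue_hom_fixing[OF v assms(9) q F card] by blast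
  have hR: "ring_hom_on IS (fps_map \<rho>)" unfolding IS_def by (rule ring_hom_on_fps_map[OF \<rho>(1)])
  let ?R = "map_mat (fps_map \<rho>) :: 'a fps^'n^'n \<Rightarrow> 'a fps^'n^'n"
  note Rm = map_mat_mult[OF hR]
  have W_IS: "W \<in> mat_over IS" unfolding W_def by (rule Rm(1)[OF y(1) C_IS])
  \<comment> \<open>The reason for having \<open>\<rho>\<close> fix \<open>F\<close>: the reduction
    does not change \<open>C\<close>.\<close>
  have RC: "?R C = C" using C(1) \<rho>(3) by (simp add: vec_eq_iff fps_eq_iff)
  have RW: "?R W = ?R y ** C" unfolding W_def Rm(2)[OF y(1) C_IS] RC ..
  have Ry: "?R y ** ?R yi = mat 1" "?R yi ** ?R y = mat 1"
    by (simp_all add: Rm(2)[OF y(1,2), symmetric] Rm(2)[OF y(2,1), symmetric] y(4,5) map_mat_1[OF hR])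
  define d0 where "d0 = (\<chi> i j. \<rho> (fps_nth (d $ i $ j) 0))"
  \<comment> \<open>This is the effect of the norm condition on \<open>D\<close>: every coefficient
    of positive index reduces to zero.\<close>
  have Rd: "?R d = ?c d0"
  proof -
    have small: "v (fps_nth (d $ i $ j) l) < 1" if "l > 0" for i j l
    proof -
      have "{v (mat_coeff D l $ a $ b) | a b. True} = (\<lambda>(a, b). v (mat_coeff D l $ a $ b)) ` UNIV" by auto
      then have "v (mat_coeff D l $ i $ j) \<le> mat_max_norm v (mat_coeff D l)"
        unfolding mat_max_norm_def by (intro Max_ge) auto
      also have "\<dots> < 1" using assms(14) that by blast
      finally show ?thesis by (simp add: mat_coeff_def d(2))
    qed
    then show ?thesis by (simp add: vec_eq_iff fps_eq_iff d0_def \<rho>(2))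
  qed
  have RW_arcs: "?R W \<in> arcs G"
  proof -
    have "invertible (?R y)" using Ry unfolding invertible_def by blast
    then have "invertible (?R W)" unfolding RW using C(2) by (rule invertible_mult)
    moreover have "mat_poly_eval fps_const f (?R W) = 0" if "f \<in> vanishing_ideal G" for f
    proof (rule vanishing_ideal_defined_over[OF assms(12) hom_fps_const _ that])
      fix f assume f: "f \<in> vanishing_ideal G \<inter> mat_polys_over F"
      then have fF: "Poly_Mapping.lookup f m \<in> F" for m by (simp add: mat_polys_over_def)
      have const: "fps_const x \<in> IS" "fps_map \<rho> (fps_const x) = fps_const x" if "x \<in> F" for x
        using F_O[OF that] \<rho>(3)[OF that] ring_hom_on_basic(3)[OF \<rho>(1)] valuation_ring_closed(1)[OF v]
        by (auto simp: IS_def fps_eq_iff)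
      have "fps_map \<rho> (mat_poly_eval fps_const f W) = mat_poly_eval (\<lambda>x. fps_map \<rho> (fps_const x)) f (?R W)"
        by (rule mat_poly_eval_hom[OF hR, where h = fps_const]) (rule const(1)[OF fF], rule W_IS)
      also have "\<dots> = mat_poly_eval fps_const f (?R W)"
        unfolding mat_poly_eval_def by (simp add: const(2)[OF fF])
      also have "mat_poly_eval fps_const f W = 0" using f C(3) unfolding W_def arcs_def by simp
      finally show "mat_poly_eval fps_const f (?R W) = 0" by (simp add: ring_hom_on_basic(3)[OF hR])
    qed
    ultimately show ?thesis by (simp add: arcs_def)
  qed
  \<comment> \<open>\<open>C\<close> is fixed by the Frobenius map, so \<open>W\<close> solves the
    same equation as \<open>y\<close>; \<open>\<rho>\<close> commutes with \<open>q\<close>-th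
    powers, so the equation survives reduction.\<close>
  have eqW: "?c d0 ** ?fr (?R W) = ?R W"
  proof -
    have frW: "?fr W \<in> mat_over IS" "?R (?fr W) = ?fr (?R W)"
      using W_IS ring_hom_on_power[OF \<rho>(1)] by (simp_all add: mat_over_def IS_def vec_eq_iff fps_eq_iff)
    have "d ** ?fr W = W" unfolding W_def frm frC matrix_mul_assoc dy ..
    then have "?R d ** ?R (?fr W) = ?R W" using Rm(2)[OF d(1) frW(1)] by simp
    then show ?thesis unfolding Rd frW(2) .
  qed
  \<comment> \<open>Its constant term satisfies \<open>d0 \<phi>(z) = z\<close>. Multiplication by
    the inverse of \<open>z\<close> therefore trivialises the reduced equation, and it stays in the
    group because \<open>z\<close> lies in \<open>G\<close>.\<close>
  define z where "z = ?z (?R W)"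
  have zG: "z \<in> G" unfolding z_def by (rule arcs_const_term[OF G RW_arcs])
  obtain z' where z': "z' \<in> G" "z ** z' = mat 1" "z' ** z = mat 1" using subgroup_GL_inv[OF sub zG] by blast
  have "?z (?c d0) ** ?z (?fr (?R W)) = z" unfolding zm[symmetric] eqW z_def ..
  moreover have "?z (?c d0) = d0" "?z (?fr (?R W)) = ?fz z" by (simp_all add: vec_eq_iff z_def)
  ultimately have "d0 ** ?fz z = z" by simp
  have "?fz z ** ?fz z' = mat 1"
    using map_mat_mult(2)[OF hq, of z z'] by (simp add: z'(2) map_mat_1[OF hq])
  then have "z' ** d0 = z' ** (d0 ** ?fz z) ** ?fz z'" by (simp add: matrix_mul_assoc[symmetric])
  then have fz': "?fz z' = z' ** d0" unfolding \<open>d0 ** ?fz z = z\<close> z'(3) by simp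
  define B where "B = ?c z' ** ?R y"
  define Bi where "Bi = ?R yi ** ?c z"
  define E where "E = ?c z' ** ?R W"
  have cz: "?c z ** ?c z' = mat 1" "?c z' ** ?c z = mat 1" by (simp_all add: cm z' map_mat_1[OF hom_fps_const])
  have "B ** Bi = ?c z' ** (?R y ** ?R yi) ** ?c z" "Bi ** B = ?R yi ** (?c z ** ?c z') ** ?R y"
    by (simp_all add: B_def Bi_def matrix_mul_assoc)
  then have BBi: "B ** Bi = mat 1" "Bi ** B = mat 1" unfolding Ry cz by (simp_all add: Ry cz)
  have EBC: "E = B ** C" unfolding E_def B_def RW by (simp add: matrix_mul_assoc)
  have "?fr E = ?c z' ** (?c d0 ** ?fr (?R W))" unfolding E_def frm fr_c fz' by (simp add: cm[symmetric] matrix_mul_assoc)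
  then have frE: "?fr E = E" unfolding eqW E_def .
  \<comment> \<open>Both \<open>E = B ** C\<close> and \<open>C\<close> are fixed by the Frobenius
    map, and \<open>C\<close> is invertible, so \<open>B\<close> is fixed too.\<close>
  have "?fr B ** C = B ** C" using frE unfolding EBC frm frC .
  then have "?fr B ** (C ** Ci) = B ** (C ** Ci)" by (simp add: matrix_mul_assoc)
  then have frB: "?fr B = B" by (simp add: Ci)
  have frBi: "?fr Bi = Bi" by (rule map_mat_fixed_inverse[OF hfr frB BBi])
  have B_IS: "B \<in> mat_over IS" "Bi \<in> mat_over IS"
    using fr_fixed[OF frB] fr_fixed[OF frBi] F_O by (simp_all add: mat_over_def IS_def)
  \<comment> \<open>Almost all coefficients of \<open>y\<close> have absolute value below 1, so the
    reduction has finitely many nonzero coefficients and is restricted whatever the absolute values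
    of those are.\<close>
  have "?R y \<in> mat_over RS"
    unfolding mat_over_def
  proof (intro CollectI allI)
    fix i j
    have "(\<lambda>n. v (fps_nth (y $ i $ j) n)) \<longlonglongrightarrow> 0"
      using yRS by (simp add: mat_over_def RS_def restricted_fps_def)
    then have "eventually (\<lambda>n. v (fps_nth (y $ i $ j) n) < 1) sequentially"
      by (rule order_tendstoD(2)) simp
    then obtain N where "\<And>n. n \<ge> N \<Longrightarrow> v (fps_nth (y $ i $ j) n) < 1"
      unfolding eventually_sequentially by blast
    then show "?R y $ i $ j \<in> RS"
      unfolding RS_def by (intro restricted_fps_eventually_zero[OF v, of N]) (simp add: \<rho>(2))
  qed
  then have B_RS: "B \<in> mat_over RS"
    unfolding B_def by (intro map_mat_mult(1)[OF hRS]) (simp_all add: mat_over_def const_RS)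
  define Z where "Z = y ** Bi"
  define Xi where "Xi = B ** yi"
  have X_IS: "Z \<in> mat_over IS" "Xi \<in> mat_over IS"
    unfolding Z_def Xi_def by (rule Rm(1)[OF y(1) B_IS(2)], rule Rm(1)[OF B_IS(1) y(2)])
  have "Z ** Xi = y ** (Bi ** B) ** yi" "Xi ** Z = B ** (yi ** y) ** Bi"
    by (simp_all add: Z_def Xi_def matrix_mul_assoc)
  then have XXi: "Z ** Xi = mat 1" "Xi ** Z = mat 1" by (simp_all add: BBi y)
  have E_arcs: "E \<in> arcs G" unfolding E_def by (rule arcs_mult[OF sub arcs_const[OF sub z'(1)] RW_arcs])
  \<comment> \<open>\<open>Ci ** Bi\<close> is the inverse of \<open>E\<close>, so \<open>Z\<close>
    equals \<open>W\<close> times the inverse of a point of the group. From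
    \<open>Z = y ** Bi\<close> alone membership in the group is not visible.\<close>
  have "E ** (Ci ** Bi) = B ** (C ** Ci) ** Bi" "(Ci ** Bi) ** E = Ci ** (Bi ** B) ** C"
    by (simp_all add: EBC matrix_mul_assoc)
  then have "E ** (Ci ** Bi) = mat 1" "(Ci ** Bi) ** E = mat 1" by (simp_all add: Ci BBi)
  from arcs_inverse[OF sub E_arcs this] have "y ** C ** (Ci ** Bi) \<in> arcs G" by (rule arcs_mult[OF sub C(3)])
  also have "y ** C ** (Ci ** Bi) = y ** (C ** Ci) ** Bi" by (simp add: matrix_mul_assoc)
  also have "\<dots> = Z" by (simp add: Ci Z_def)
  finally have X_arcs: "Z \<in> arcs G" .
  have quot: "fps_to_fls f \<in> quot_restricted_series v" if "g \<in> RS" "g \<noteq> 0" "g * f \<in> RS" for f g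
  proof -
    have eq: "fps_to_fls f = fps_to_fls (g * f) / fps_to_fls g" using that(2) by (simp add: fls_times_fps_to_fls)
    show ?thesis
      unfolding quot_restricted_series_def series(2)
      by (intro CollectI exI[of _ "fps_to_fls (g * f)"] exI[of _ "fps_to_fls g"] conjI eq imageI that)
        (simp add: that(2))
  qed
  have RS_sum: "(\<Sum>k\<in>UNIV. f k) \<in> RS" if "\<And>k. f k \<in> RS" for f :: "'n \<Rightarrow> 'a fps"
    using ring_hom_on_sum[OF hRS, of UNIV f] that by simp
  have X_quot: "fps_to_fls (Z $ i $ j) \<in> quot_restricted_series v" for i j
  proof -
    obtain g where g: "g \<in> RS" "g \<noteq> 0" "\<And>i j. g * Bi $ i $ j \<in> RS"
      using inverse_common_denominator[OF hRS m1_RS B_RS BBi(2)] by blast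
    have "g * Z $ i $ j = (\<Sum>k\<in>UNIV. y $ i $ k * (g * Bi $ k $ j))"
      by (simp add: Z_def matrix_matrix_mult_def sum_distrib_left mult.left_commute)
    also have "\<dots> \<in> RS"
      using yRS by (intro RS_sum ring_hom_on_basic(6)[OF hRS] g(3)) (simp add: mat_over_def)
    finally show ?thesis by (rule quot[OF g(1,2)])
  qed
  \<comment> \<open>Membership in \<open>GL_over\<close> asks for entries in \<open>L\<close> also
    of the inverse \<open>Xi = B ** yi\<close>; here the denominator comes from \<open>y\<close> and
    no longer from \<open>B\<close>.\<close>
  have Xi_quot: "fps_to_fls (Xi $ i $ j) \<in> quot_restricted_series v" for i j
  proof -
    obtain g where g: "g \<in> RS" "g \<noteq> 0" "\<And>i j. g * yi $ i $ j \<in> RS"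
      using inverse_common_denominator[OF hRS m1_RS yRS y(5)] by blast
    have "g * Xi $ i $ j = (\<Sum>k\<in>UNIV. B $ i $ k * (g * yi $ k $ j))"
      by (simp add: Xi_def matrix_matrix_mult_def sum_distrib_left mult.left_commute)
    also have "\<dots> \<in> RS"
      using B_RS by (intro RS_sum ring_hom_on_basic(6)[OF hRS] g(3)) (simp add: mat_over_def)
    finally show ?thesis by (rule quot[OF g(1,2)])
  qed
  show ?thesis
  proof (rule bexI[of _ "map_mat fps_to_fls Z"])
    have "d ** ?fr Z = Z" unfolding Z_def frm frBi matrix_mul_assoc dy ..
    then show "D ** frob_mat q (map_mat fps_to_fls Z) = map_mat fps_to_fls Z"
      unfolding d(2) frobF hm by simp
    have "map_mat fps_to_fls Z \<in> GL_over (quot_restricted_series v \<inter> integral_series v)"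
      unfolding GL_over_def series(1)
    proof (intro CollectI conjI bexI[of _ "map_mat fps_to_fls Xi"])
      show "map_mat fps_to_fls Z ** map_mat fps_to_fls Xi = mat 1" "map_mat fps_to_fls Xi ** map_mat fps_to_fls Z = mat 1"
        by (simp_all add: hm XXi map_mat_1[OF hom_fps_to_fls])
    qed (use X_quot Xi_quot X_IS in \<open>simp_all add: mat_over_def\<close>)
    then show "map_mat fps_to_fls Z \<in> group_points F G (quot_restricted_series v \<inter> integral_series v)"
      using X_arcs by (simp add: group_points_def mat_poly_eval_fps_to_fls arcs_def)
  qed
qed

end
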